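(* Let $s\in(0,1)$, $1<p<\frac ns$, define $q$ by $\frac1q=\frac1p-\frac sn$ and $q'$ by $\frac1{q'}+\frac1q=1$. For all $\phi,f,g\in C_c^\infty(\mathbb R^n)$, $$\Big|\int_{\mathbb R^n}[(-\Delta)^{s/2},\phi](f)\,g\Big|\lesssim[\phi]_{BMO}\,\|(-\Delta)^{s/2}f\|_{L^p}\,\|(-\Delta)^{s/2}g\|_{L^{q'}},$$ where $[(-\Delta)^{s/2},\phi](f)=(-\Delta)^{s/2}(\phi f)-\phi(-\Delta)^{s/2}f$.
   Context: Fractional Laplacian: $\widehat{(-\Delta)^{s/2}g}(\xi)=(2\pi|\xi|)^s\widehat g(\xi)$, $\widehat g(\xi)=\int g(x)e^{-2\pi ix\cdot\xi}dx$. BMO seminorm $[\phi]_{BMO}=\sup_B\frac1{|B|}\int_B|\phi-(\phi)_B|$ over balls. $A\lesssim B$ means $A\le CB$, $C$ depending only on parameters. *)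

theory Defs
  imports "HOL-Analysis.Analysis"
begin

text \<open>Infinitely differentiable (C-infinity) real functions on a Euclidean space:
  f lies in some class of everywhere differentiable functions that is closed under
  taking directional derivatives in every direction.\<close>
definition smooth_fun :: "('a::euclidean_space \<Rightarrow> real) \<Rightarrow> bool" where
  "smooth_fun f \<longleftrightarrow> (\<exists>S. f \<in> S \<and>
     (\<forall>h\<in>S. (\<forall>x. h differentiable at x) \<and>
        (\<forall>v. (\<lambda>x. frechet_derivative h (at x) v) \<in> S)))"

definition compact_support :: "('a::euclidean_space \<Rightarrow> real) \<Rightarrow> bool" where
  "compact_support f \<longleftrightarrow> compact (closure {x. f x \<noteq> 0})"

definition Cc_inf :: "('a::euclidean_space \<Rightarrow> real) set" where
  "Cc_inf = {f. smooth_fun f \<and> compact_support f}"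

definition fourier :: "('a::euclidean_space \<Rightarrow> complex) \<Rightarrow> 'a \<Rightarrow> complex" where
  "fourier g \<xi> = (\<integral>x. g x * cis (- 2 * pi * (x \<bullet> \<xi>)) \<partial>lborel)"

text \<open>Fractional Laplacian (-Delta)^(s/2), defined by the Fourier multiplier (2 pi |xi|)^s,
  i.e. by the inverse Fourier transform of (2 pi |xi|)^s hat g(xi).\<close>
definition frac_lap :: "real \<Rightarrow> ('a::euclidean_space \<Rightarrow> complex) \<Rightarrow> 'a \<Rightarrow> complex" where
  "frac_lap s g x = (\<integral>\<xi>. complex_of_real ((2 * pi * norm \<xi>) powr s) * fourier g \<xi>
                          * cis (2 * pi * (x \<bullet> \<xi>)) \<partial>lborel)"

definition frac_comm :: "real \<Rightarrow> ('a::euclidean_space \<Rightarrow> real) \<Rightarrow> ('a \<Rightarrow> real) \<Rightarrow> 'a \<Rightarrow> complex" where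
  "frac_comm s \<phi> f x = frac_lap s (\<lambda>y. complex_of_real (\<phi> y * f y)) x
                         - complex_of_real (\<phi> x) * frac_lap s (\<lambda>y. complex_of_real (f y)) x"

definition Lp_norm :: "real \<Rightarrow> ('a::euclidean_space \<Rightarrow> complex) \<Rightarrow> real" where
  "Lp_norm p h = enn2real (\<integral>\<^sup>+ x. ennreal (cmod (h x) powr p) \<partial>lborel) powr (1 / p)"

definition ball_avg :: "('a::euclidean_space \<Rightarrow> real) \<Rightarrow> 'a \<Rightarrow> real \<Rightarrow> real" where
  "ball_avg \<phi> x r = (LINT y:ball x r|lborel. \<phi> y) / measure lborel (ball x r)"

definition bmo_seminorm :: "('a::euclidean_space \<Rightarrow> real) \<Rightarrow> real" where
  "bmo_seminorm \<phi> = (SUP (x, r) \<in> UNIV \<times> {0<..}.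
      (LINT y:ball x r|lborel. \<bar>\<phi> y - ball_avg \<phi> x r\<bar>) / measure lborel (ball x r))"

end

theory Submission
  imports Defs "HOL-Probability.Probability"
begin

text \<open>
  Put \<open>F = (-\<Delta>)\<^bsup>s/2\<^esup> f\<close> and \<open>G = (-\<Delta>)\<^bsup>s/2\<^esup> g\<close>. Both are bounded and integrable, and \<open>f\<close>, \<open>g\<close> are multiples of
  their Riesz potentials, so self-adjointness turns the left-hand side into a multiple of
  \<open>\<integral>\<integral> (\<phi> x - \<phi> y) \<bar>x - y\<bar>\<^bsup>s-n\<^esup> F y G x dx dy\<close>. This is Chanillo's commutator of \<open>\<phi>\<close> with a Riesz potential;
  the kernel is positive, so absolute values may be taken inside. Writing the kernel as a superposition over
  all radii \<open>\<rho>\<close> and centres \<open>z\<close> of indicators of \<open>x, y \<in> B(z, 2\<rho>)\<close>, the John--Nirenberg inequality and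
  Hoelder's inequality on each ball reduce the form to
  \<open>[\<phi>] \<integral>\<integral> \<rho>\<^bsup>s-1\<^esup> A F z \<rho> \<cdot> A G z \<rho> d\<rho> dz\<close>, where \<open>A\<close> is an \<open>L\<^sup>k\<close> average with \<open>k > 1\<close> close to \<open>1\<close>. Hedberg's
  trick bounds the \<open>\<rho>\<close>-integral by \<open>M G \<cdot> (M F)\<^bsup>p/q\<^esup> \<cdot> \<parallel>F\<parallel>\<^bsup>sp/n\<^esup>\<close>, with maximal functions \<open>M\<close>, and Hoelder's
  inequality with the maximal theorem concludes.
\<close>

text \<open>The seminorm says nothing about \<open>\<phi> x - \<phi> y\<close> at a single pair of
  points, only about means over balls. The singular kernel therefore has to be cut into ball
  indicators, and on each ball \<phi> is compared with its own average. Any gain of integrability,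
  however small, then suffices: every finite moment of the oscillation is available, so the exponent
  \<open>k\<close> left for F and G can lie strictly between 1 and \<open>min p q'\<close>. The
  strictness is what the maximal theorem needs, applied to k-th powers at the exponents
  \<open>p / k\<close> and \<open>q' / k\<close>.

  Continuity and boundedness of \<phi> act only qualitatively, through stopping radii and finite
  suprema. On the Fourier side the obstacle is integrability of F: it is not compactly supported,
  and its multiplier is not smooth at the origin. The heat semigroup supplies it, because a
  Lipschitz estimate gives differences of order \<open>sqrt t\<close>, integrable against
  \<open>t powr (- s / 2 - 1)\<close> near 0 for \<open>s < 1\<close>. The same Gaussians yield
  Fourier inversion and the potential representation.\<close>

section \<open>Averages over balls\<close>

text \<open>Vitali's selection gives countably many disjoint balls whose five-fold closed dilates
  cover \<open>S\<close>. The local inequality is summed over them: on the left the dilates cover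
  \<open>S\<close>, on the right each point is counted at most once. The factor 6 instead of 5
  leaves room to pass from closed to open balls, and the common bound \<open>b\<close> on the radii
  is what the selection requires. A constant \<open>g\<close> gives the weak type estimate, a power
  of the oscillation gives John--Nirenberg.\<close>

lemma vitali_nn_integral:
  fixes S :: "'a::euclidean_space set" and r :: "'a \<Rightarrow> real" and g h :: "'a \<Rightarrow> ennreal"
  assumes g [measurable]: "g \<in> borel_measurable borel" and h [measurable]: "h \<in> borel_measurable borel"
    and r: "\<And>x. x \<in> S \<Longrightarrow> 0 < r x \<and> r x \<le> b"
    and le: "\<And>x. x \<in> S \<Longrightarrow> (\<integral>\<^sup>+y. g y * indicator (ball x (6 * r x)) y \<partial>lborel)
                \<le> (\<integral>\<^sup>+y. h y * indicator (ball x (r x)) y \<partial>lborel)"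
  shows "(\<integral>\<^sup>+y. g y * indicator S y \<partial>lborel) \<le> (\<integral>\<^sup>+y. h y \<partial>lborel)"
proof -
  have "S \<subseteq> (\<Union>i\<in>S. cball i (r i))" using r by force
  obtain C where C: "countable C" "C \<subseteq> S"
    and disj: "pairwise (\<lambda>i j. disjnt (cball i (r i)) (cball j (r j))) C"
    and cov: "S \<subseteq> (\<Union>i\<in>C. cball i (5 * r i))"
    by (rule Vitali_covering_lemma_cballs[OF \<open>S \<subseteq> _\<close> r])
  have "(\<integral>\<^sup>+y. g y * indicator S y \<partial>lborel)
      \<le> (\<integral>\<^sup>+y. \<integral>\<^sup>+i. g y * indicator (ball i (6 * r i)) y \<partial>count_space C \<partial>lborel)"
  proof (rule nn_integral_mono)
    fix y :: 'a
    show "g y * indicator S y \<le> (\<integral>\<^sup>+i. g y * indicator (ball i (6 * r i)) y \<partial>count_space C)"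
    proof (cases "y \<in> S")
      case True
      then obtain i where i: "i \<in> C" "y \<in> cball i (5 * r i)" using cov by blast
      then have "0 < r i" using r C by blast
      then have "y \<in> ball i (6 * r i)" using i by auto
      then show ?thesis
        using nn_integral_ge_point[OF i(1), of "\<lambda>i. g y * indicator (ball i (6 * r i)) y"] True by simp
    qed simp
  qed
  also have "\<dots> = (\<integral>\<^sup>+i. \<integral>\<^sup>+y. g y * indicator (ball i (6 * r i)) y \<partial>lborel \<partial>count_space C)"
    by (rule nn_integral_count_space_nn_integral[OF C(1)])
      (auto intro!: borel_measurable_times_ennreal borel_measurable_indicator)
  also have "\<dots> \<le> (\<integral>\<^sup>+i. \<integral>\<^sup>+y. h y * indicator (ball i (r i)) y \<partial>lborel \<partial>count_space C)"
    by (rule nn_integral_mono) (use le C(2) in auto)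
  also have "\<dots> = (\<integral>\<^sup>+y. \<integral>\<^sup>+i. h y * indicator (ball i (r i)) y \<partial>count_space C \<partial>lborel)"
    by (rule nn_integral_count_space_nn_integral[OF C(1), symmetric])
      (auto intro!: borel_measurable_times_ennreal borel_measurable_indicator)
  also have "\<dots> \<le> (\<integral>\<^sup>+y. h y \<partial>lborel)"
  proof (rule nn_integral_mono)
    fix y :: 'a
    show "(\<integral>\<^sup>+i. h y * indicator (ball i (r i)) y \<partial>count_space C) \<le> h y"
    proof (cases "\<exists>i\<in>C. y \<in> ball i (r i)")
      case True
      then obtain i where i: "i \<in> C" "y \<in> ball i (r i)" by blast
      have uniq: "j = i" if "j \<in> C" "y \<in> ball j (r j)" for j
      proof (rule ccontr)
        assume "j \<noteq> i"
        then have "disjnt (cball j (r j)) (cball i (r i))" using disj that i by (auto simp: pairwise_def)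
        moreover have "y \<in> cball j (r j)" "y \<in> cball i (r i)" using that i by auto
        ultimately show False by (auto simp only: disjnt_iff)
      qed
      have "h y * indicator (ball j (r j)) y = h y * indicator {i} j" if "j \<in> C" for j
        using uniq[OF that] i by (cases "j = i") (auto simp: indicator_def simp del: mem_ball)
      then have "(\<integral>\<^sup>+j. h y * indicator (ball j (r j)) y \<partial>count_space C)
          = (\<integral>\<^sup>+j. h y * indicator {i} j \<partial>count_space C)"
        by (intro nn_integral_cong) simp
      also have "\<dots> = h y" using i by (simp add: nn_integral_cmult_indicator)
      finally show ?thesis by simp
    next
      case False
      then have "(\<integral>\<^sup>+j. h y * indicator (ball j (r j)) y \<partial>count_space C)
          = (\<integral>\<^sup>+j. 0 \<partial>count_space C)"
        by (intro nn_integral_cong) (simp del: mem_ball)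
      then show ?thesis by simp
    qed
  qed
  finally show ?thesis .
qed

text \<open>A pointwise bound makes averages over balls exist and be linear, and keeps finite the
  suprema in the seminorm, in the John--Nirenberg absorption and in the maximal function. The
  constants of \<open>john_nirenberg\<close> and \<open>commutator_form_bound\<close> are fixed
  before the functions, so they do not see this bound.\<close>

definition bounded_borel :: "('a::euclidean_space \<Rightarrow> real) \<Rightarrow> bool" where
  "bounded_borel h \<longleftrightarrow> h \<in> borel_measurable borel \<and> (\<exists>K. \<forall>x. \<bar>h x\<bar> \<le> K)"

lemma bounded_borelI: "h \<in> borel_measurable borel \<Longrightarrow> (\<And>x. \<bar>h x\<bar> \<le> K) \<Longrightarrow> bounded_borel h"
  by (auto simp: bounded_borel_def)

lemma bounded_borel_measurable: "bounded_borel h \<Longrightarrow> h \<in> borel_measurable borel"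
  by (simp add: bounded_borel_def)

lemma bounded_borel_const [simp]: "bounded_borel (\<lambda>x. c)"
  by (auto simp: bounded_borel_def)

lemma bounded_borel_add:
  assumes "bounded_borel f" "bounded_borel g" shows "bounded_borel (\<lambda>x. f x + g x)"
proof -
  obtain K L where "\<And>x. \<bar>f x\<bar> \<le> K" "\<And>x. \<bar>g x\<bar> \<le> L" using assms by (auto simp: bounded_borel_def)
  then have "\<bar>f x + g x\<bar> \<le> K + L" for x by (meson abs_triangle_ineq add_mono order_trans)
  with assms show ?thesis by (intro bounded_borelI) (auto simp: bounded_borel_def)
qed

lemma bounded_borel_mult:
  assumes "bounded_borel f" "bounded_borel g" shows "bounded_borel (\<lambda>x. f x * g x)"
proof -
  obtain K L where KL: "\<And>x. \<bar>f x\<bar> \<le> K" "\<And>x. \<bar>g x\<bar> \<le> L" using assms by (auto simp: bounded_borel_def)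
  have "\<bar>f x * g x\<bar> \<le> K * L" for x
    unfolding abs_mult by (rule mult_mono) (use KL[of x] in \<open>auto intro: order_trans[OF abs_ge_zero]\<close>)
  with assms show ?thesis by (intro bounded_borelI) (auto simp: bounded_borel_def)
qed

lemma bounded_borel_diff:
  assumes "bounded_borel f" "bounded_borel g" shows "bounded_borel (\<lambda>x. f x - g x)"
  using bounded_borel_add[OF assms(1) bounded_borel_mult[OF bounded_borel_const[of "-1"] assms(2)]]
  by simp

lemma bounded_borel_abs: "bounded_borel f \<Longrightarrow> bounded_borel (\<lambda>x. \<bar>f x\<bar>)"
  by (auto simp: bounded_borel_def)

lemma bounded_borel_power: "bounded_borel f \<Longrightarrow> bounded_borel (\<lambda>x. f x ^ m)"
  by (induction m) (auto intro: bounded_borel_mult)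

lemma bounded_borel_powr:
  assumes "bounded_borel f" "0 \<le> a" shows "bounded_borel (\<lambda>x. \<bar>f x\<bar> powr a)"
proof -
  obtain K where "\<And>x. \<bar>f x\<bar> \<le> K" using assms by (auto simp: bounded_borel_def)
  then have "\<bar>\<bar>f x\<bar> powr a\<bar> \<le> K powr a" for x using assms by (auto intro: powr_mono2)
  with assms show ?thesis by (intro bounded_borelI) (auto simp: bounded_borel_def)
qed

lemmas bounded_borel_intros = bounded_borel_const bounded_borel_add bounded_borel_mult
  bounded_borel_diff bounded_borel_abs bounded_borel_power bounded_borel_powr

lemma set_integrable_ball:
  fixes h :: "'a::euclidean_space \<Rightarrow> real"
  assumes "bounded_borel h" shows "set_integrable lborel (ball x r) h"
proof -
  obtain K where K: "\<And>x. \<bar>h x\<bar> \<le> K" using assms by (auto simp: bounded_borel_def)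
  have [measurable]: "h \<in> borel_measurable borel" using assms by (rule bounded_borel_measurable)
  show ?thesis unfolding set_integrable_def
  proof (rule integrableI_bounded_set_indicator[where B=K])
    show "emeasure lborel (ball x r) < \<infinity>"
      using emeasure_bounded_finite[OF bounded_ball] by simp
  qed (use K in auto)
qed

lemma content_ball_scale:
  fixes x y :: "'a::euclidean_space"
  assumes "0 \<le> r" "0 \<le> c" shows "measure lborel (ball x (c * r)) = c ^ DIM('a) * measure lborel (ball y r)"
  using assms by (simp add: content_ball power_mult_distrib)

lemma content_ball_ratio:
  fixes x y :: "'a::euclidean_space"
  assumes "0 < r" "0 < t" shows "measure lborel (ball x r) / measure lborel (ball y t) = (r / t) ^ DIM('a)"
proof -
  have "unit_ball_vol (real DIM('a)) \<noteq> 0" using unit_ball_vol_pos[of "real DIM('a)"] by linarith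
  then show ?thesis using assms by (simp add: content_ball power_divide)
qed

lemma nn_integral_ball:
  fixes h :: "'a::euclidean_space \<Rightarrow> real"
  assumes "bounded_borel h" "\<And>x. 0 \<le> h x" "0 < r"
  shows "(\<integral>\<^sup>+y. ennreal (h y) * indicator (ball x r) y \<partial>lborel) = ennreal (measure lborel (ball x r) * ball_avg h x r)"
proof -
  have "(\<integral>\<^sup>+y. ennreal (h y) * indicator (ball x r) y \<partial>lborel)
      = (\<integral>\<^sup>+y. ennreal (indicator (ball x r) y *\<^sub>R h y) \<partial>lborel)"
    by (intro nn_integral_cong) (auto simp: indicator_def)
  also have "\<dots> = ennreal (LINT y:ball x r|lborel. h y)"
    unfolding set_lebesgue_integral_def using set_integrable_ball[OF assms(1)] assms(2)
    by (intro nn_integral_eq_integral) (auto simp: set_integrable_def)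
  also have "(LINT y:ball x r|lborel. h y) = measure lborel (ball x r) * ball_avg h x r"
    using assms(3) by (simp add: ball_avg_def)
  finally show ?thesis .
qed

lemma ball_avg_mono:
  fixes h :: "'a::euclidean_space \<Rightarrow> real"
  assumes "bounded_borel h" "bounded_borel k" "\<And>y. y \<in> ball x r \<Longrightarrow> h y \<le> k y"
  shows "ball_avg h x r \<le> ball_avg k x r"
  unfolding ball_avg_def
  by (intro divide_right_mono set_integral_mono set_integrable_ball assms) auto

lemma ball_avg_const [simp]: "0 < r \<Longrightarrow> ball_avg (\<lambda>y::'a::euclidean_space. c) x r = c"
  by (simp add: ball_avg_def set_lebesgue_integral_def)

lemma ball_avg_add:
  assumes "bounded_borel h" "bounded_borel k"
  shows "ball_avg (\<lambda>y. h y + k y) x r = ball_avg h x r + ball_avg k x r"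
  unfolding ball_avg_def using assms
  by (subst set_integral_add) (auto intro: set_integrable_ball simp: add_divide_distrib)

lemma ball_avg_diff:
  assumes "bounded_borel h" "bounded_borel k"
  shows "ball_avg (\<lambda>y. h y - k y) x r = ball_avg h x r - ball_avg k x r"
  unfolding ball_avg_def using assms
  by (subst set_integral_diff) (auto intro: set_integrable_ball simp: diff_divide_distrib)

lemma ball_avg_cmult: "ball_avg (\<lambda>y. c * h y) x r = c * ball_avg h x r"
  unfolding ball_avg_def by simp

lemma ball_avg_abs:
  assumes "bounded_borel h" shows "\<bar>ball_avg h x r\<bar> \<le> ball_avg (\<lambda>y. \<bar>h y\<bar>) x r"
proof -
  have "ball_avg (\<lambda>y. (-1) * \<bar>h y\<bar>) x r \<le> ball_avg h x r"
    by (intro ball_avg_mono bounded_borel_mult bounded_borel_const bounded_borel_abs assms) auto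
  then have "- ball_avg (\<lambda>y. \<bar>h y\<bar>) x r \<le> ball_avg h x r"
    by (simp only: ball_avg_cmult)
  moreover have "ball_avg h x r \<le> ball_avg (\<lambda>y. \<bar>h y\<bar>) x r"
    using assms by (intro ball_avg_mono bounded_borel_intros) auto
  ultimately show ?thesis by linarith
qed

lemma ball_avg_nonneg:
  assumes "\<And>y. 0 \<le> h y" shows "0 \<le> ball_avg h x r"
  unfolding ball_avg_def set_lebesgue_integral_def using assms
  by (intro divide_nonneg_nonneg integral_nonneg) auto

lemma ball_avg_enlarge:
  fixes h :: "'a::euclidean_space \<Rightarrow> real"
  assumes "bounded_borel h" "\<And>y. 0 \<le> h y" "0 < r" "ball x r \<subseteq> ball x' r'"
  shows "ball_avg h x r \<le> (r' / r) ^ DIM('a) * ball_avg h x' r'"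
proof -
  have r': "0 < r'" using assms(3,4) by (metis ball_eq_empty not_le subset_empty)
  have "(LINT y:ball x r|lborel. h y) \<le> (LINT y:ball x' r'|lborel. h y)"
    unfolding set_lebesgue_integral_def
    using set_integrable_ball[OF assms(1)] assms
    by (intro integral_mono) (auto simp: set_integrable_def indicator_def)
  then have "ball_avg h x r \<le> (LINT y:ball x' r'|lborel. h y) / measure lborel (ball x r)"
    unfolding ball_avg_def by (intro divide_right_mono) auto
  also have "\<dots> = (measure lborel (ball x' r') / measure lborel (ball x r)) * ball_avg h x' r'"
    using r' by (simp add: ball_avg_def)
  finally show ?thesis unfolding content_ball_ratio[OF r' assms(3)] .
qed

section \<open>Mean oscillation and the BMO seminorm\<close>

definition mean_osc_le :: "('a::euclidean_space \<Rightarrow> real) \<Rightarrow> real \<Rightarrow> bool" where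
  "mean_osc_le \<phi> N \<longleftrightarrow> (\<forall>x r. 0 < r \<longrightarrow> ball_avg (\<lambda>y. \<bar>\<phi> y - ball_avg \<phi> x r\<bar>) x r \<le> N)"

lemma bounded_borel_osc: "bounded_borel \<phi> \<Longrightarrow> bounded_borel (\<lambda>y. \<bar>\<phi> y - c\<bar>)"
  by (intro bounded_borel_intros)

lemma ball_avg_le:
  fixes h :: "'a::euclidean_space \<Rightarrow> real"
  assumes "bounded_borel h" "\<And>y. h y \<le> K" "0 < r" shows "ball_avg h x r \<le> K"
  using ball_avg_mono[of h "\<lambda>y. K" x r] assms by simp

text \<open>A supremum of reals dominates its members only when the family is bounded above; here
  \<open>2 * K\<close> is an upper bound, since the averages of \<phi> are bounded by
  \<open>K\<close> as well. The estimates work with the relation \<open>mean_osc_le\<close>, which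
  allows \<open>N\<close> to be enlarged and kept positive even if the seminorm is 0.\<close>

lemma mean_osc_le_bmo_seminorm:
  fixes \<phi> :: "'a::euclidean_space \<Rightarrow> real"
  assumes "bounded_borel \<phi>" shows "mean_osc_le \<phi> (bmo_seminorm \<phi>)"
proof -
  obtain K where K: "\<And>x. \<bar>\<phi> x\<bar> \<le> K" using assms by (auto simp: bounded_borel_def)
  have K': "\<bar>ball_avg \<phi> x r\<bar> \<le> K" if "0 < r" for x r
    using ball_avg_abs[OF assms, of x r] ball_avg_le[OF bounded_borel_abs[OF assms] K that, of x] by linarith
  define osc where "osc = (\<lambda>(x, r). ball_avg (\<lambda>y. \<bar>\<phi> y - ball_avg \<phi> x r\<bar>) x r)"
  have "osc z \<le> 2 * K" if z: "z \<in> UNIV \<times> {0<..}" for z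
  proof -
    obtain x r where z: "z = (x, r)" "0 < r" using z by auto
    have "\<bar>\<phi> y - ball_avg \<phi> x r\<bar> \<le> 2 * K" for y using K[of y] K'[of r x] z by linarith
    then show ?thesis unfolding osc_def z prod.case
      by (intro ball_avg_le bounded_borel_osc assms z)
  qed
  then have bdd: "bdd_above (osc ` (UNIV \<times> {0<..}))" by (auto intro!: bdd_aboveI)
  have eq: "bmo_seminorm \<phi> = (SUP z \<in> UNIV \<times> {0<..}. osc z)"
    unfolding bmo_seminorm_def osc_def ball_avg_def[of "\<lambda>y. \<bar>_ y\<bar>"]
    by (rule SUP_cong) (auto simp: ball_avg_def)
  show ?thesis unfolding mean_osc_le_def
  proof (intro allI impI)
    fix x and r :: real assume "0 < r"
    then show "ball_avg (\<lambda>y. \<bar>\<phi> y - ball_avg \<phi> x r\<bar>) x r \<le> bmo_seminorm \<phi>"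
      using cSUP_upper[OF _ bdd, of "(x, r)"] by (auto simp: eq osc_def)
  qed
qed

text \<open>The difference of the averages is the mean over the small ball of
  \<open>\<phi> - c\<close>, with \<open>c\<close> the average over the large one; passing to the
  large ball costs the volume ratio. Only the ratios 2 and 3 of radii occur later, so the cost is a
  dimensional constant.\<close>

lemma mean_osc_avg_diff:
  fixes \<phi> :: "'a::euclidean_space \<Rightarrow> real"
  assumes \<phi>: "bounded_borel \<phi>" and N: "mean_osc_le \<phi> N" and "0 < r" "ball x r \<subseteq> ball x' r'"
  shows "\<bar>ball_avg \<phi> x r - ball_avg \<phi> x' r'\<bar> \<le> (r' / r) ^ DIM('a) * N"
proof -
  have r': "0 < r'" using assms(3,4) by (metis ball_eq_empty not_le subset_empty)
  define c where "c = ball_avg \<phi> x' r'"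
  have "\<bar>ball_avg \<phi> x r - c\<bar> = \<bar>ball_avg (\<lambda>y. \<phi> y - c) x r\<bar>"
    using \<phi> assms(3) by (subst ball_avg_diff) auto
  also have "\<dots> \<le> ball_avg (\<lambda>y. \<bar>\<phi> y - c\<bar>) x r"
    by (intro ball_avg_abs bounded_borel_intros \<phi>)
  also have "\<dots> \<le> (r' / r) ^ DIM('a) * ball_avg (\<lambda>y. \<bar>\<phi> y - c\<bar>) x' r'"
    by (intro ball_avg_enlarge bounded_borel_osc \<phi> assms) auto
  also have "\<dots> \<le> (r' / r) ^ DIM('a) * N"
    using N r' assms(3) by (intro mult_left_mono) (auto simp: mean_osc_le_def c_def)
  finally show ?thesis by (simp add: c_def)
qed

section \<open>The John--Nirenberg inequality in power form\<close>

lemma power_add_le: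
  fixes a b :: real
  assumes "0 \<le> a" "0 \<le> b" shows "(a + b) ^ m \<le> 2 ^ m * (a ^ m + b ^ m)"
proof -
  have "(a + b) ^ m \<le> (2 * max a b) ^ m" using assms by (intro power_mono) auto
  also have "\<dots> = 2 ^ m * max a b ^ m" by (simp add: power_mult_distrib)
  also have "\<dots> \<le> 2 ^ m * (a ^ m + b ^ m)" using assms by (intro mult_left_mono) (auto simp: max_def)
  finally show ?thesis .
qed

lemma ball_avg_ge:
  fixes h :: "'a::euclidean_space \<Rightarrow> real"
  assumes "bounded_borel h" "\<And>y. y \<in> ball x r \<Longrightarrow> K \<le> h y" "0 < r" shows "K \<le> ball_avg h x r"
  using ball_avg_mono[of "\<lambda>y. K" h x r] assms by simp

text \<open>Radii are halved starting from \<open>R\<close>. Continuity stands in for Lebesgue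
  differentiation: \<psi> exceeds \<open>l\<close> near \<open>x\<close>, so some index has mean at
  least \<open>l\<close>. The first such index is not 0, because the mean over radius
  \<open>R\<close> is below \<open>l\<close>, and its predecessor gives the bound at the doubled
  radius.\<close>

lemma stopping_radius:
  fixes \<psi> :: "'a::euclidean_space \<Rightarrow> real"
  assumes \<psi>: "continuous_on UNIV \<psi>" "bounded_borel \<psi>" and "0 < R" "ball_avg \<psi> x R < l" "l < \<psi> x"
  obtains \<rho> where "0 < \<rho>" "2 * \<rho> \<le> R" "l \<le> ball_avg \<psi> x \<rho>" "ball_avg \<psi> x (2 * \<rho>) < l"
proof -
  define P where "P j \<longleftrightarrow> l \<le> ball_avg \<psi> x (R / 2 ^ j)" for j :: nat
  have "open {y. l < \<psi> y}" using \<psi>(1) by (intro open_Collect_less continuous_on_const)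
  then obtain d where d: "0 < d" "ball x d \<subseteq> {y. l < \<psi> y}"
    using assms(5) by (metis mem_Collect_eq open_contains_ball)
  obtain j where j: "R / d < 2 ^ j" using real_arch_pow[of 2 "R / d"] by auto
  have "R / 2 ^ j < d" using j d(1) by (simp add: field_simps)
  then have "ball x (R / 2 ^ j) \<subseteq> ball x d" by (intro subset_ball) simp
  then have "P j" unfolding P_def using d \<open>0 < R\<close> by (intro ball_avg_ge \<psi>) force+
  define k where "k = (LEAST j. P j)"
  have k: "P k" "\<And>i. i < k \<Longrightarrow> \<not> P i"
    unfolding k_def using \<open>P j\<close> by (auto intro: LeastI dest: not_less_Least)
  have "\<not> P 0" using assms(4) by (simp add: P_def)
  then obtain i where i: "k = Suc i" using k(1) by (cases k) auto
  show thesis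
  proof (rule that[of "R / 2 ^ k"])
    have e: "2 * (R / 2 ^ k) = R / 2 ^ i" by (simp add: i)
    show "ball_avg \<psi> x (2 * (R / 2 ^ k)) < l" unfolding e using k(2)[of i] i by (simp add: P_def)
    show "2 * (R / 2 ^ k) \<le> R" unfolding e using \<open>0 < R\<close> by (simp add: field_simps)
  qed (use k \<open>0 < R\<close> in \<open>auto simp: P_def\<close>)
qed

text \<open>Each point where the oscillation exceeds \<open>\<Lambda> N\<close> is the centre of a ball on which the mean of
  \<open>\<bar>\<phi> - c\<bar>\<close> first exceeds \<open>\<Lambda> N\<close>. Disjoint such balls have total measure \<open>O(1 / \<Lambda>)\<close>, and on their
  enlargements the a priori bound \<open>A\<close> applies to \<open>\<phi>\<close> again.\<close>

lemma john_nirenberg_step: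
  fixes \<phi> :: "'a::euclidean_space \<Rightarrow> real" and m :: nat
  assumes cont: "continuous_on UNIV \<phi>" and bb: "bounded_borel \<phi>" and N: "0 < N" "mean_osc_le \<phi> N"
    and A: "0 \<le> A" "\<And>x r. 0 < r \<Longrightarrow> ball_avg (\<lambda>y. \<bar>\<phi> y - ball_avg \<phi> x r\<bar> ^ m) x r \<le> A"
    and \<Lambda>: "2 ^ DIM('a) < \<Lambda>" and R: "0 < R"
  shows "ball_avg (\<lambda>y. \<bar>\<phi> y - ball_avg \<phi> x0 (2 * R)\<bar> ^ m) x0 R
     \<le> \<Lambda> ^ m * N ^ m + 2 ^ m * 12 ^ DIM('a) / \<Lambda> * (A + (3 ^ DIM('a) + \<Lambda>) ^ m * N ^ m)"
proof -
  define c where "c = ball_avg \<phi> x0 (2 * R)"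
  define \<psi> where "\<psi> = (\<lambda>y. \<bar>\<phi> y - c\<bar>)"
  define l where "l = \<Lambda> * N"
  define V where "V = measure lborel (ball x0 R)"
  \<comment> \<open>\<open>6 ^ DIM('a)\<close> is the volume ratio of the Vitali dilate to the
    selected ball. The rest bounds the mean of \<open>\<psi> y ^ m\<close> over the dilate:
    \<open>A\<close> for the oscillation there, the other term for the distance of its average from
    \<open>c\<close>.\<close>
  define K where "K = 2 ^ m * 6 ^ DIM('a) * (A + (3 ^ DIM('a) + \<Lambda>) ^ m * N ^ m)"
  have \<Lambda>0: "0 < \<Lambda>" using \<Lambda> by (meson zero_less_numeral zero_less_power less_trans)
  then have l0: "0 < l" using N by (simp add: l_def)
  have K0: "0 \<le> K" using A \<Lambda>0 N by (simp add: K_def)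
  have V0: "0 < V" using R by (simp add: V_def)
  have bb\<psi>: "bounded_borel \<psi>" unfolding \<psi>_def by (intro bounded_borel_osc bb)
  have cont\<psi>: "continuous_on UNIV \<psi>" unfolding \<psi>_def by (intro continuous_intros cont)
  have \<psi>0: "0 \<le> \<psi> y" for y by (simp add: \<psi>_def)
  have [measurable]: "\<psi> \<in> borel_measurable borel" using bb\<psi> by (rule bounded_borel_measurable)
  have avg2: "ball_avg \<psi> x0 (2 * R) \<le> N"
    using N R by (auto simp: mean_osc_le_def \<psi>_def c_def)
  define E where "E = {x \<in> ball x0 R. l < \<psi> x}"
  \<comment> \<open>Passing from \<open>ball x0 (2 * R)\<close> to \<open>ball x R\<close> costs
    \<open>2 ^ DIM('a)\<close>. This is why \<Lambda> must exceed that number: the mean over the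
    starting radius is then below \<open>l\<close>, and the stopping argument applies at every point
    of \<open>E\<close>.\<close>
  have "\<exists>\<rho>. 0 < \<rho> \<and> 2 * \<rho> \<le> R \<and> l \<le> ball_avg \<psi> x \<rho> \<and> ball_avg \<psi> x (2 * \<rho>) < l" if x: "x \<in> E" for x
  proof -
    have "ball x R \<subseteq> ball x0 (2 * R)"
      using x by (auto simp: E_def subset_iff dist_commute) (metis add_strict_mono dist_commute dist_triangle less_le_trans mult_2 not_less)
    then have "ball_avg \<psi> x R \<le> (2 * R / R) ^ DIM('a) * ball_avg \<psi> x0 (2 * R)"
      by (intro ball_avg_enlarge bb\<psi> \<psi>0 R)
    also have "\<dots> \<le> 2 ^ DIM('a) * N" using R avg2 by (simp add: mult_left_mono)
    also have "\<dots> < l" unfolding l_def using \<Lambda> N by simp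
    finally have "ball_avg \<psi> x R < l" .
    from stopping_radius[OF cont\<psi> bb\<psi> R this] x show ?thesis by (auto simp: E_def)
  qed
  then obtain \<rho> where \<rho>: "\<And>x. x \<in> E \<Longrightarrow> 0 < \<rho> x \<and> 2 * \<rho> x \<le> R \<and> l \<le> ball_avg \<psi> x (\<rho> x) \<and> ball_avg \<psi> x (2 * \<rho> x) < l"
    by metis
  \<comment> \<open>At radius \<open>2 * \<rho> x\<close> the mean of \<psi> is still below
    \<open>l\<close>, which ties \<open>c2\<close> to \<open>c\<close>; the average
    \<open>c6\<close> over the dilate differs from \<open>c2\<close> by at most
    \<open>3 ^ DIM('a) * N\<close>. On the dilate \<psi> is thus at most an oscillation about
    \<open>c6\<close>, controlled by \<open>A\<close>, plus a bounded shift.\<close>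
  have local: "ball_avg (\<lambda>y. \<psi> y ^ m) x (6 * \<rho> x) \<le> K / 6 ^ DIM('a)" if x: "x \<in> E" for x
  proof -
    note r = \<rho>[OF x]
    define c6 where "c6 = ball_avg \<phi> x (6 * \<rho> x)"
    define c2 where "c2 = ball_avg \<phi> x (2 * \<rho> x)"
    have "ball x (2 * \<rho> x) \<subseteq> ball x (6 * \<rho> x)" using r by (intro subset_ball) auto
    then have "\<bar>c2 - c6\<bar> \<le> (6 * \<rho> x / (2 * \<rho> x)) ^ DIM('a) * N"
      unfolding c2_def c6_def using r by (intro mean_osc_avg_diff bb N) auto
    also have "6 * \<rho> x / (2 * \<rho> x) = 3" using r by simp
    finally have d1: "\<bar>c2 - c6\<bar> \<le> 3 ^ DIM('a) * N" .
    have "\<bar>c2 - c\<bar> = \<bar>ball_avg (\<lambda>y. \<phi> y - c) x (2 * \<rho> x)\<bar>"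
      unfolding c2_def using r bb by (subst ball_avg_diff) auto
    also have "\<dots> \<le> ball_avg \<psi> x (2 * \<rho> x)"
      unfolding \<psi>_def by (intro ball_avg_abs bounded_borel_intros bb)
    finally have d2: "\<bar>c2 - c\<bar> \<le> l" using r by linarith
    have d: "\<bar>c6 - c\<bar> \<le> (3 ^ DIM('a) + \<Lambda>) * N" using d1 d2 by (simp add: l_def algebra_simps)
    have pt: "\<psi> y ^ m \<le> 2 ^ m * (\<bar>\<phi> y - c6\<bar> ^ m + (3 ^ DIM('a) + \<Lambda>) ^ m * N ^ m)" for y
    proof -
      have "\<psi> y ^ m \<le> (\<bar>\<phi> y - c6\<bar> + (3 ^ DIM('a) + \<Lambda>) * N) ^ m"
        unfolding \<psi>_def using d by (intro power_mono) linarith+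
      also have "\<dots> \<le> 2 ^ m * (\<bar>\<phi> y - c6\<bar> ^ m + ((3 ^ DIM('a) + \<Lambda>) * N) ^ m)"
        using \<Lambda>0 N by (intro power_add_le) auto
      finally show ?thesis by (simp add: power_mult_distrib)
    qed
    have "ball_avg (\<lambda>y. \<psi> y ^ m) x (6 * \<rho> x)
       \<le> ball_avg (\<lambda>y. 2 ^ m * (\<bar>\<phi> y - c6\<bar> ^ m + (3 ^ DIM('a) + \<Lambda>) ^ m * N ^ m)) x (6 * \<rho> x)"
      by (intro ball_avg_mono pt bounded_borel_intros bb bb\<psi>)
    also have "\<dots> = 2 ^ m * (ball_avg (\<lambda>y. \<bar>\<phi> y - c6\<bar> ^ m) x (6 * \<rho> x) + (3 ^ DIM('a) + \<Lambda>) ^ m * N ^ m)"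
      using r by (subst ball_avg_cmult, subst ball_avg_add) (auto intro!: bounded_borel_intros bb)
    also have "\<dots> \<le> 2 ^ m * (A + (3 ^ DIM('a) + \<Lambda>) ^ m * N ^ m)"
      using A(2)[of "6 * \<rho> x" x] r by (intro mult_left_mono add_right_mono) (auto simp: c6_def)
    finally show ?thesis by (simp add: K_def)
  qed
  \<comment> \<open>The stopping condition trades the constant \<open>K\<close> for
    \<open>K / l\<close> times the mean of \<psi> over the selected ball. Summed over disjoint balls
    inside \<open>ball x0 (2 * R)\<close>, this is at most \<open>K / l\<close> times the mass of
    \<psi> there, which is of order \<open>V * N\<close>. As \<open>l = \<Lambda> * N\<close>, the
    gain is \<open>1 / \<Lambda>\<close>.\<close>
  have "(\<integral>\<^sup>+y. ennreal (\<psi> y ^ m) * indicator E y \<partial>lborel)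
     \<le> (\<integral>\<^sup>+y. ennreal (K / l * \<psi> y) * indicator (ball x0 (2 * R)) y \<partial>lborel)"
  proof (rule vitali_nn_integral[where r=\<rho> and b=R])
    show "0 < \<rho> x \<and> \<rho> x \<le> R" if "x \<in> E" for x using \<rho>[OF that] by auto
    show "(\<integral>\<^sup>+y. ennreal (\<psi> y ^ m) * indicator (ball x (6 * \<rho> x)) y \<partial>lborel)
        \<le> (\<integral>\<^sup>+y. ennreal (K / l * \<psi> y) * indicator (ball x0 (2 * R)) y * indicator (ball x (\<rho> x)) y \<partial>lborel)"
      if x: "x \<in> E" for x
    proof -
      note r = \<rho>[OF x]
      define W where "W = measure lborel (ball x (\<rho> x))"
      have W0: "0 \<le> W" by (simp add: W_def)
      have sub: "y \<in> ball x0 (2 * R)" if "y \<in> ball x (\<rho> x)" for y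
        using that x r dist_triangle[of x0 y x] by (auto simp: E_def)
      have "(\<integral>\<^sup>+y. ennreal (\<psi> y ^ m) * indicator (ball x (6 * \<rho> x)) y \<partial>lborel)
          = ennreal (measure lborel (ball x (6 * \<rho> x)) * ball_avg (\<lambda>y. \<psi> y ^ m) x (6 * \<rho> x))"
        using r by (intro nn_integral_ball bounded_borel_intros bb\<psi>) (auto simp: \<psi>0)
      also have "measure lborel (ball x (6 * \<rho> x)) = 6 ^ DIM('a) * W"
        unfolding W_def using r by (intro content_ball_scale) auto
      also have "ennreal (6 ^ DIM('a) * W * ball_avg (\<lambda>y. \<psi> y ^ m) x (6 * \<rho> x)) \<le> ennreal (W * K)"
        using mult_left_mono[OF local[OF x], of "6 ^ DIM('a) * W"] W0
        by (intro ennreal_leI) simp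
      also have "\<dots> \<le> ennreal (W * (K / l * ball_avg \<psi> x (\<rho> x)))"
      proof -
        have "K \<le> K / l * ball_avg \<psi> x (\<rho> x)"
          using mult_left_mono[of l "ball_avg \<psi> x (\<rho> x)" "K / l"] r K0 l0 by auto
        then show ?thesis using W0 by (intro ennreal_leI mult_left_mono)
      qed
      also have "\<dots> = ennreal (W * ball_avg (\<lambda>y. K / l * \<psi> y) x (\<rho> x))"
        by (simp only: ball_avg_cmult)
      also have "\<dots> = (\<integral>\<^sup>+y. ennreal (K / l * \<psi> y) * indicator (ball x (\<rho> x)) y \<partial>lborel)"
        unfolding W_def using r K0 l0 \<psi>0
        by (intro nn_integral_ball[symmetric] bounded_borel_intros bb\<psi>) auto
      also have "\<dots> = (\<integral>\<^sup>+y. ennreal (K / l * \<psi> y) * indicator (ball x0 (2 * R)) y * indicator (ball x (\<rho> x)) y \<partial>lborel)"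
        using sub by (intro nn_integral_cong) (auto simp: indicator_def)
      finally show ?thesis .
    qed
  qed (auto intro!: borel_measurable_times_ennreal borel_measurable_indicator)
  also have "\<dots> = ennreal (measure lborel (ball x0 (2 * R)) * ball_avg (\<lambda>y. K / l * \<psi> y) x0 (2 * R))"
    using R K0 l0 \<psi>0 by (intro nn_integral_ball bounded_borel_intros bb\<psi>) auto
  also have "\<dots> = ennreal (2 ^ DIM('a) * V * (K / l * ball_avg \<psi> x0 (2 * R)))"
    unfolding ball_avg_cmult V_def using R by (subst content_ball_scale[of R 2 x0 x0]) auto
  also have "\<dots> \<le> ennreal (2 ^ DIM('a) * V * (K / l * N))"
    using V0 K0 l0 avg2 by (intro ennreal_leI mult_left_mono) auto
  also have "2 ^ DIM('a) * V * (K / l * N) = V * (2 ^ DIM('a) * K / \<Lambda>)"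
    using N by (simp add: l_def)
  finally have Ebound: "(\<integral>\<^sup>+y. ennreal (\<psi> y ^ m) * indicator E y \<partial>lborel) \<le> ennreal (V * (2 ^ DIM('a) * K / \<Lambda>))" .
  have "ennreal (V * ball_avg (\<lambda>y. \<psi> y ^ m) x0 R) = (\<integral>\<^sup>+y. ennreal (\<psi> y ^ m) * indicator (ball x0 R) y \<partial>lborel)"
    unfolding V_def using R \<psi>0 by (intro nn_integral_ball[symmetric] bounded_borel_intros bb\<psi>) auto
  also have "\<dots> \<le> (\<integral>\<^sup>+y. ennreal (l ^ m) * indicator (ball x0 R) y + ennreal (\<psi> y ^ m) * indicator E y \<partial>lborel)"
  proof (rule nn_integral_mono)
    fix y
    show "ennreal (\<psi> y ^ m) * indicator (ball x0 R) y
        \<le> ennreal (l ^ m) * indicator (ball x0 R) y + ennreal (\<psi> y ^ m) * indicator E y"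
      using power_mono[of "\<psi> y" l m] \<psi>0[of y] by (auto simp: indicator_def E_def ennreal_leI)
  qed
  also have "\<dots> = (\<integral>\<^sup>+y. ennreal (l ^ m) * indicator (ball x0 R) y \<partial>lborel) + (\<integral>\<^sup>+y. ennreal (\<psi> y ^ m) * indicator E y \<partial>lborel)"
    unfolding E_def by (intro nn_integral_add) (auto intro!: borel_measurable_times_ennreal borel_measurable_indicator)
  also have "(\<integral>\<^sup>+y. ennreal (l ^ m) * indicator (ball x0 R) y \<partial>lborel) = ennreal (V * l ^ m)"
    using nn_integral_ball[of "\<lambda>y. l ^ m" R x0] R l0 by (simp add: V_def)
  also have "ennreal (V * l ^ m) + (\<integral>\<^sup>+y. ennreal (\<psi> y ^ m) * indicator E y \<partial>lborel)
      \<le> ennreal (V * l ^ m) + ennreal (V * (2 ^ DIM('a) * K / \<Lambda>))"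
    by (intro add_left_mono Ebound)
  also have "\<dots> = ennreal (V * (l ^ m + 2 ^ DIM('a) * K / \<Lambda>))"
    using V0 l0 K0 \<Lambda>0 by (simp add: ennreal_plus[symmetric] algebra_simps del: ennreal_plus)
  finally have "V * ball_avg (\<lambda>y. \<psi> y ^ m) x0 R \<le> V * (l ^ m + 2 ^ DIM('a) * K / \<Lambda>)"
    using V0 l0 K0 \<Lambda>0 by (subst (asm) ennreal_le_iff) auto
  then have "ball_avg (\<lambda>y. \<psi> y ^ m) x0 R \<le> l ^ m + 2 ^ DIM('a) * K / \<Lambda>" using V0 by simp
  also have "\<dots> = \<Lambda> ^ m * N ^ m + 2 ^ m * 12 ^ DIM('a) / \<Lambda> * (A + (3 ^ DIM('a) + \<Lambda>) ^ m * N ^ m)"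
  proof -
    have "(2::real) ^ DIM('a) * 6 ^ DIM('a) = 12 ^ DIM('a)" by (simp add: power_mult_distrib[symmetric])
    then show ?thesis by (simp add: l_def K_def power_mult_distrib)
  qed
  finally show ?thesis by (simp add: \<psi>_def c_def)
qed

text \<open>The step estimate bounds the m-th moment on one ball by a constant plus a small multiple
  of the largest m-th moment over all balls, and the latter is absorbed. This reaches each fixed
  power directly, without passing through exponential decay of the distribution function.\<close>

lemma john_nirenberg:
  fixes m :: nat
  shows "\<exists>C>0. \<forall>(\<phi>::'a::euclidean_space \<Rightarrow> real) N x r. continuous_on UNIV \<phi> \<longrightarrow> bounded_borel \<phi> \<longrightarrow>
    0 < N \<longrightarrow> mean_osc_le \<phi> N \<longrightarrow> 0 < r \<longrightarrow> ball_avg (\<lambda>y. \<bar>\<phi> y - ball_avg \<phi> x r\<bar> ^ m) x r \<le> C * N ^ m"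
proof -
  define n where "n = DIM('a)"
  \<comment> \<open>Chosen so that the total factor in front of \<open>S\<close> below is 1/2, see
    \<open>eps\<close>: \<open>12 ^ n\<close> and one \<open>2 ^ m\<close> come from the step
    estimate, the other \<open>2 ^ m\<close> from recentring.\<close>
  define \<Lambda> :: real where "\<Lambda> = 2 * 4 ^ m * 12 ^ n"
  define c1 where "c1 = 2 ^ m * (\<Lambda> ^ m + 2 ^ m * 12 ^ n / \<Lambda> * (3 ^ n + \<Lambda>) ^ m + (2 ^ n) ^ m)"
  have \<Lambda>0: "0 < \<Lambda>" by (simp add: \<Lambda>_def)
  have c10: "0 < c1" unfolding c1_def using \<Lambda>0
    by (intro mult_pos_pos add_pos_nonneg add_nonneg_nonneg) auto
  have \<Lambda>: "2 ^ n < \<Lambda>"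
  proof -
    have "(2::real) ^ n \<le> 12 ^ n" by (intro power_mono) auto
    also have "\<dots> < (2 * 4 ^ m) * 12 ^ n"
    proof -
      have "(1::real) \<le> 4 ^ m" by simp
      then have "(1::real) < 2 * 4 ^ m" by linarith
      then show ?thesis by simp
    qed
    finally show ?thesis by (simp add: \<Lambda>_def)
  qed
  have eps: "2 ^ m * (2 ^ m * 12 ^ n / \<Lambda>) = 1 / 2"
  proof -
    have "(4::real) ^ m = 2 ^ m * 2 ^ m" by (simp add: power_mult_distrib[symmetric])
    then show ?thesis by (simp add: \<Lambda>_def)
  qed
  show ?thesis
  proof (intro exI[of _ "2 * c1"] conjI allI impI)
    fix \<phi> :: "'a \<Rightarrow> real" and N x0 and r0 :: real
    assume cont: "continuous_on UNIV \<phi>" and bb: "bounded_borel \<phi>" and N: "0 < N" "mean_osc_le \<phi> N" and "0 < r0"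
    obtain K where K: "\<And>x. \<bar>\<phi> x\<bar> \<le> K" using bb by (auto simp: bounded_borel_def)
    have K': "\<bar>ball_avg \<phi> x r\<bar> \<le> K" if "0 < r" for x r
      using ball_avg_abs[OF bb, of x r] ball_avg_le[OF bounded_borel_abs[OF bb] K that, of x] by linarith
    define J where "J = (\<lambda>(x, r). ball_avg (\<lambda>y. \<bar>\<phi> y - ball_avg \<phi> x r\<bar> ^ m) x r)"
    define I where "I = (UNIV :: 'a set) \<times> {0::real<..}"
    have "J z \<le> (2 * K) ^ m" if zI: "z \<in> I" for z
    proof -
      obtain x r where z: "z = (x, r)" "0 < r" using zI by (auto simp: I_def)
      have "\<bar>\<phi> y - ball_avg \<phi> x r\<bar> \<le> 2 * K" for y using K[of y] K'[of r x] z by linarith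
      then show ?thesis unfolding J_def z prod.case
        by (intro ball_avg_le bounded_borel_intros bb z power_mono) auto
    qed
    then have bdd: "bdd_above (J ` I)" by (auto intro!: bdd_aboveI)
    \<comment> \<open>Finite only because \<open>\<phi>\<close> is bounded; this is what allows the term \<open>S / 2\<close> to be absorbed below.\<close>
    define S where "S = (SUP z\<in>I. J z)"
    have up: "J z \<le> S" if "z \<in> I" for z unfolding S_def by (intro cSUP_upper that bdd)
    have S0: "0 \<le> S" using up[of "(x0, r0)"] \<open>0 < r0\<close> ball_avg_nonneg[of "\<lambda>y. \<bar>\<phi> y - ball_avg \<phi> x0 r0\<bar> ^ m" x0 r0]
      by (auto simp: I_def J_def)
    have "J z \<le> c1 * N ^ m + S / 2" if zI: "z \<in> I" for z
    proof -
      obtain x r where z: "z = (x, r)" "0 < r" using zI by (auto simp: I_def)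
      \<comment> \<open>The step estimate measures oscillation about the mean over the doubled ball,
        whereas \<open>J\<close> uses the mean over the ball itself. The two means differ by at most
        \<open>2 ^ n * N\<close>.\<close>
      define c where "c = ball_avg \<phi> x (2 * r)"
      define c' where "c' = ball_avg \<phi> x r"
      have "ball x r \<subseteq> ball x (2 * r)" using z by (intro subset_ball) auto
      then have "\<bar>c' - c\<bar> \<le> (2 * r / r) ^ DIM('a) * N"
        unfolding c_def c'_def by (intro mean_osc_avg_diff bb N z)
      also have "2 * r / r = 2" using z by simp
      finally have d: "\<bar>c' - c\<bar> \<le> 2 ^ n * N" by (simp add: n_def)
      have pt: "\<bar>\<phi> y - c'\<bar> ^ m \<le> 2 ^ m * (\<bar>\<phi> y - c\<bar> ^ m + (2 ^ n) ^ m * N ^ m)" for y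
      proof -
        have "\<bar>\<phi> y - c'\<bar> ^ m \<le> (\<bar>\<phi> y - c\<bar> + 2 ^ n * N) ^ m"
          using d by (intro power_mono) linarith+
        also have "\<dots> \<le> 2 ^ m * (\<bar>\<phi> y - c\<bar> ^ m + (2 ^ n * N) ^ m)"
          using N by (intro power_add_le) auto
        finally show ?thesis by (simp add: power_mult_distrib)
      qed
      have "J z = ball_avg (\<lambda>y. \<bar>\<phi> y - c'\<bar> ^ m) x r" by (simp add: J_def z c'_def)
      also have "\<dots> \<le> ball_avg (\<lambda>y. 2 ^ m * (\<bar>\<phi> y - c\<bar> ^ m + (2 ^ n) ^ m * N ^ m)) x r"
        by (intro ball_avg_mono pt bounded_borel_intros bb)
      also have "\<dots> = 2 ^ m * (ball_avg (\<lambda>y. \<bar>\<phi> y - c\<bar> ^ m) x r + (2 ^ n) ^ m * N ^ m)"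
        using z by (subst ball_avg_cmult, subst ball_avg_add) (auto intro!: bounded_borel_intros bb)
      also have "\<dots> \<le> 2 ^ m * ((\<Lambda> ^ m * N ^ m + 2 ^ m * 12 ^ n / \<Lambda> * (S + (3 ^ n + \<Lambda>) ^ m * N ^ m)) + (2 ^ n) ^ m * N ^ m)"
        unfolding c_def n_def
        by (intro mult_left_mono add_right_mono john_nirenberg_step cont bb N S0 z)
           (use up[unfolded J_def] \<Lambda> in \<open>auto simp: I_def n_def\<close>)
      also have "\<dots> = c1 * N ^ m + (2 ^ m * (2 ^ m * 12 ^ n / \<Lambda>)) * S"
        by (simp add: c1_def algebra_simps add_divide_distrib)
      finally show ?thesis unfolding eps by simp
    qed
    then have "S \<le> c1 * N ^ m + S / 2" unfolding S_def
      by (intro cSUP_least) (auto simp: I_def intro: exI[of _ 1])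
    moreover have "J (x0, r0) \<le> S" using \<open>0 < r0\<close> by (intro up) (auto simp: I_def)
    ultimately show "ball_avg (\<lambda>y. \<bar>\<phi> y - ball_avg \<phi> x0 r0\<bar> ^ m) x0 r0 \<le> 2 * c1 * N ^ m"
      by (simp add: J_def)
  qed (use c10 in simp)
qed

section \<open>Hoelder's inequality and the maximal function\<close>

lemma nn_integral_powr_from_0:
  fixes a \<alpha> :: real
  assumes "-1 < \<alpha>" "0 \<le> a"
  shows "(\<integral>\<^sup>+x. ennreal (x powr \<alpha>) * indicator {0<..<a} x \<partial>lborel) = ennreal (a powr (\<alpha> + 1) / (\<alpha> + 1))"
proof -
  have "(\<integral>\<^sup>+x. ennreal (x powr \<alpha>) * indicator {0<..<a} x \<partial>lborel)
      = (\<integral>\<^sup>+x. ennreal (indicator {0..a} x * x powr \<alpha>) \<partial>lborel)"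
    by (rule nn_integral_cong_AE, rule AE_mp[OF AE_lborel_singleton[of 0]], rule AE_mp[OF AE_lborel_singleton[of a]])
       (auto simp: indicator_def)
  also have "\<dots> = ennreal (a powr (\<alpha> + 1) / (\<alpha> + 1))"
    by (rule nn_integral_has_integral_lebesgue) (auto intro: has_integral_powr_from_0 assms)
  finally show ?thesis .
qed

lemma nn_integral_powr_to_inf:
  fixes a \<alpha> :: real
  assumes "\<alpha> < -1" "0 < a"
  shows "(\<integral>\<^sup>+x. ennreal (x powr \<alpha>) * indicator {a<..} x \<partial>lborel) = ennreal (a powr (\<alpha> + 1) / - (\<alpha> + 1))"
proof -
  have "(\<integral>\<^sup>+x. ennreal (x powr \<alpha>) * indicator {a<..} x \<partial>lborel)
      = (\<integral>\<^sup>+x. ennreal (indicator {a..} x * x powr \<alpha>) \<partial>lborel)"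
    by (rule nn_integral_cong_AE, rule AE_mp[OF AE_lborel_singleton[of a]]) (auto simp: indicator_def)
  also have "\<dots> = ennreal (- (a powr (\<alpha> + 1)) / (\<alpha> + 1))"
    by (rule nn_integral_has_integral_lebesgue[OF _ has_integral_powr_to_inf[OF assms]]) auto
  also have "- (a powr (\<alpha> + 1)) / (\<alpha> + 1) = a powr (\<alpha> + 1) / - (\<alpha> + 1)"
    by (metis minus_divide_left minus_divide_right)
  finally show ?thesis .
qed

text \<open>Stated with upper bounds \<open>a\<close>, \<open>b\<close> of the norms, which may be
  0. Young's inequality is applied after dividing by them, so both are first enlarged by
  \<open>e\<close>, which tends to 0 at the end.\<close>

lemma Holder_nn_integral:
  fixes u v :: "'b \<Rightarrow> real"
  assumes [measurable]: "u \<in> borel_measurable M" "v \<in> borel_measurable M"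
    and nn: "\<And>x. 0 \<le> u x" "\<And>x. 0 \<le> v x"
    and pq: "1 < p" "1 < q" "1 / p + 1 / q = 1" and ab: "0 \<le> a" "0 \<le> b"
    and u: "(\<integral>\<^sup>+x. ennreal (u x powr p) \<partial>M) \<le> ennreal (a powr p)"
    and v: "(\<integral>\<^sup>+x. ennreal (v x powr q) \<partial>M) \<le> ennreal (b powr q)"
  shows "(\<integral>\<^sup>+x. ennreal (u x * v x) \<partial>M) \<le> ennreal (a * b)"
proof -
  have step: "(\<integral>\<^sup>+x. ennreal (u x * v x) \<partial>M) \<le> ennreal ((a + e) * (b + e))" if e: "0 < e" for e
  proof -
    define a' b' where "a' = a + e" and "b' = b + e"
    have pos: "0 < a'" "0 < b'" using ab e by (auto simp: a'_def b'_def)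
    \<comment> \<open>Young's inequality scaled back: with these weights the two integrals
      contribute \<open>a' * b' / p\<close> and \<open>a' * b' / q\<close>, which add up to
      \<open>a' * b'\<close>.\<close>
    define k l where "k = a' * b' / p / a' powr p" and "l = a' * b' / q / b' powr q"
    have kl: "0 \<le> k" "0 \<le> l" using pos pq by (auto simp: k_def l_def)
    have "u x * v x \<le> k * u x powr p + l * v x powr q" for x
    proof -
      have "(u x / a') * (v x / b') \<le> (u x / a') powr p / p + (v x / b') powr q / q"
        using pos nn by (intro Youngs_inequality pq) auto
      then have "a' * b' * ((u x / a') * (v x / b')) \<le> a' * b' * ((u x / a') powr p / p + (v x / b') powr q / q)"
        using pos by (intro mult_left_mono) auto
      then show ?thesis using pos nn by (simp add: powr_divide k_def l_def field_simps)
    qed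
    then have "(\<integral>\<^sup>+x. ennreal (u x * v x) \<partial>M)
        \<le> (\<integral>\<^sup>+x. ennreal k * ennreal (u x powr p) + ennreal l * ennreal (v x powr q) \<partial>M)"
      using kl by (intro nn_integral_mono) (simp add: ennreal_mult[symmetric] ennreal_plus[symmetric] ennreal_leI del: ennreal_plus)
    also have "\<dots> = ennreal k * (\<integral>\<^sup>+x. ennreal (u x powr p) \<partial>M) + ennreal l * (\<integral>\<^sup>+x. ennreal (v x powr q) \<partial>M)"
      by (subst nn_integral_add) (auto simp: nn_integral_cmult)
    also have "\<dots> \<le> ennreal k * ennreal (a' powr p) + ennreal l * ennreal (b' powr q)"
      using u v ab pq e
      by (intro add_mono mult_left_mono order_trans[OF u] order_trans[OF v] ennreal_leI powr_mono2)
         (auto simp: a'_def b'_def)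
    also have "\<dots> = ennreal (a' * b' / p + a' * b' / q)"
      using kl pos pq by (simp add: ennreal_mult[symmetric] ennreal_plus[symmetric] k_def l_def del: ennreal_plus)
    also have "a' * b' / p + a' * b' / q = a' * b' * (1 / p + 1 / q)" by (simp add: algebra_simps)
    finally show ?thesis using pq by (simp add: a'_def b'_def)
  qed
  have "((\<lambda>e. ennreal ((a + e) * (b + e))) \<longlongrightarrow> ennreal ((a + 0) * (b + 0))) (at_right 0)"
    by (intro tendsto_ennrealI tendsto_intros)
  then show ?thesis
    using step by (intro tendsto_lowerbound[where F="at_right (0::real)"])
      (auto simp: eventually_at_right_field intro: exI[of _ 1])
qed

lemma measure_ball_eq:
  "measure lborel (ball (x::'a::euclidean_space) r) = (if 0 \<le> r then unit_ball_vol (real DIM('a)) * r ^ DIM('a) else 0)"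
  by (auto simp: content_ball ball_empty)

text \<open>The moving ball is encoded by the comparison \<open>dist (f w) y < g w\<close> and its
  volume by the explicit formula, so that centre and radius enter as measurable parameters of one
  integral.\<close>

lemma ball_avg_measurable:
  fixes h :: "'a::euclidean_space \<Rightarrow> real"
  assumes [measurable]: "h \<in> borel_measurable borel" "f \<in> measurable M borel" "g \<in> borel_measurable M"
  shows "(\<lambda>w. ball_avg h (f w) (g w)) \<in> borel_measurable M"
proof -
  have "(\<lambda>w. (LINT y|lborel. (if dist (f w) y < g w then h y else 0)) / 
     (if 0 \<le> g w then unit_ball_vol (real DIM('a)) * g w ^ DIM('a) else 0)) \<in> borel_measurable M"
    by measurable
  also have "(\<lambda>w. (LINT y|lborel. (if dist (f w) y < g w then h y else 0)) / 
     (if 0 \<le> g w then unit_ball_vol (real DIM('a)) * g w ^ DIM('a) else 0)) = (\<lambda>w. ball_avg h (f w) (g w))"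
    unfolding ball_avg_def set_lebesgue_integral_def measure_ball_eq
    by (intro ext arg_cong2[where f="(/)"] Bochner_Integration.integral_cong) (auto simp: indicator_def)
  finally show ?thesis .
qed

lemma ball_Holder:
  fixes u v :: "'a::euclidean_space \<Rightarrow> real"
  assumes bb: "bounded_borel u" "bounded_borel v" and nn: "\<And>x. 0 \<le> u x" "\<And>x. 0 \<le> v x"
    and pq: "1 < p" "1 < q" "1 / p + 1 / q = 1" and r: "0 < r"
  shows "ball_avg (\<lambda>y. u y * v y) x r
    \<le> ball_avg (\<lambda>y. u y powr p) x r powr (1 / p) * ball_avg (\<lambda>y. v y powr q) x r powr (1 / q)"
proof -
  define V where "V = measure lborel (ball x r)"
  have V: "0 < V" using r by (simp add: V_def)
  have [measurable]: "u \<in> borel_measurable borel" "v \<in> borel_measurable borel"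
    using bb by (auto simp: bounded_borel_measurable)
  have pw: "bounded_borel (\<lambda>y. u y powr t)" "bounded_borel (\<lambda>y. v y powr t)" if "0 \<le> t" for t
    using bounded_borel_powr[OF bb(1) that] bounded_borel_powr[OF bb(2) that] nn by simp_all
  have u0: "0 \<le> ball_avg (\<lambda>y. u y powr p) x r" "0 \<le> ball_avg (\<lambda>y. v y powr q) x r"
    by (auto intro: ball_avg_nonneg)
  have "ennreal (V * ball_avg (\<lambda>y. u y * v y) x r) = (\<integral>\<^sup>+y. ennreal (u y * v y) * indicator (ball x r) y \<partial>lborel)"
    unfolding V_def using nn by (intro nn_integral_ball[symmetric] bounded_borel_mult bb r) auto
  also have "\<dots> = (\<integral>\<^sup>+y. ennreal ((u y * indicator (ball x r) y) * (v y * indicator (ball x r) y)) \<partial>lborel)"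
    by (intro nn_integral_cong) (auto simp: indicator_def)
  also have "\<dots> \<le> ennreal ((V * ball_avg (\<lambda>y. u y powr p) x r) powr (1 / p) * (V * ball_avg (\<lambda>y. v y powr q) x r) powr (1 / q))"
  proof (rule Holder_nn_integral[OF _ _ _ _ pq])
    have "(\<integral>\<^sup>+y. ennreal ((u y * indicator (ball x r) y) powr p) \<partial>lborel)
        = (\<integral>\<^sup>+y. ennreal (u y powr p) * indicator (ball x r) y \<partial>lborel)"
      by (intro nn_integral_cong) (auto simp: indicator_def)
    also have "\<dots> = ennreal (V * ball_avg (\<lambda>y. u y powr p) x r)"
      unfolding V_def using pq by (intro nn_integral_ball pw r) auto
    finally show "(\<integral>\<^sup>+y. ennreal ((u y * indicator (ball x r) y) powr p) \<partial>lborel)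
        \<le> ennreal (((V * ball_avg (\<lambda>y. u y powr p) x r) powr (1 / p)) powr p)"
      using V u0 pq by (simp add: powr_powr)
    have "(\<integral>\<^sup>+y. ennreal ((v y * indicator (ball x r) y) powr q) \<partial>lborel)
        = (\<integral>\<^sup>+y. ennreal (v y powr q) * indicator (ball x r) y \<partial>lborel)"
      by (intro nn_integral_cong) (auto simp: indicator_def)
    also have "\<dots> = ennreal (V * ball_avg (\<lambda>y. v y powr q) x r)"
      unfolding V_def using pq by (intro nn_integral_ball pw r) auto
    finally show "(\<integral>\<^sup>+y. ennreal ((v y * indicator (ball x r) y) powr q) \<partial>lborel)
        \<le> ennreal (((V * ball_avg (\<lambda>y. v y powr q) x r) powr (1 / q)) powr q)"
      using V u0 pq by (simp add: powr_powr)
  qed (use nn in \<open>auto intro!: borel_measurable_times borel_measurable_indicator\<close>)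
  finally have "V * ball_avg (\<lambda>y. u y * v y) x r
     \<le> (V * ball_avg (\<lambda>y. u y powr p) x r) powr (1 / p) * (V * ball_avg (\<lambda>y. v y powr q) x r) powr (1 / q)"
    by (subst (asm) ennreal_le_iff) auto
  also have "\<dots> = (V powr (1 / p) * V powr (1 / q)) * (ball_avg (\<lambda>y. u y powr p) x r powr (1 / p) * ball_avg (\<lambda>y. v y powr q) x r powr (1 / q))"
    using V u0 by (simp add: powr_mult)
  also have "V powr (1 / p) * V powr (1 / q) = V"
    using V pq by (simp add: powr_add[symmetric])
  finally show ?thesis using V by simp
qed

text \<open>Hoelder's inequality against the constant function 1.\<close>

lemma ball_Jensen:
  fixes v :: "'a::euclidean_space \<Rightarrow> real"
  assumes "bounded_borel v" "\<And>x. 0 \<le> v x" "1 < q" "0 < r"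
  shows "ball_avg v x r \<le> ball_avg (\<lambda>y. v y powr q) x r powr (1 / q)"
proof -
  have "1 < q / (q - 1)" "1 / (q / (q - 1)) + 1 / q = 1" using assms(3) by (auto simp: field_simps)
  from ball_Holder[OF bounded_borel_const[of 1] assms(1) _ assms(2) this(1) assms(3) this(2) assms(4), of x]
  show ?thesis using assms(4) by simp
qed

lemma ball_power_mean_mono:
  fixes v :: "'a::euclidean_space \<Rightarrow> real"
  assumes "bounded_borel v" "\<And>x. 0 \<le> v x" "0 < t" "t < p" "0 < r"
  shows "ball_avg (\<lambda>y. v y powr t) x r powr (1 / t) \<le> ball_avg (\<lambda>y. v y powr p) x r powr (1 / p)"
proof -
  have "bounded_borel (\<lambda>y. v y powr t)" using bounded_borel_powr[OF assms(1), of t] assms by simp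
  from ball_Jensen[OF this, of "p / t" r x] assms
  have "ball_avg (\<lambda>y. v y powr t) x r \<le> ball_avg (\<lambda>y. v y powr p) x r powr (t / p)"
    by (simp add: powr_powr)
  then have "ball_avg (\<lambda>y. v y powr t) x r powr (1 / t) \<le> (ball_avg (\<lambda>y. v y powr p) x r powr (t / p)) powr (1 / t)"
    using assms by (intro powr_mono2) (auto intro: ball_avg_nonneg)
  then show ?thesis using assms by (simp add: powr_powr)
qed

section \<open>The centred maximal function\<close>

definition maximal :: "('a::euclidean_space \<Rightarrow> real) \<Rightarrow> 'a \<Rightarrow> real" where
  "maximal h z = (SUP \<rho>\<in>{\<rho>. \<rho> \<in> \<rat> \<and> 0 < \<rho>}. ball_avg h z \<rho>)"

lemma maximal_bdd:
  fixes h :: "'a::euclidean_space \<Rightarrow> real"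
  assumes "bounded_borel h"
  shows "bdd_above ((\<lambda>\<rho>. ball_avg h z \<rho>) ` {\<rho>. \<rho> \<in> \<rat> \<and> 0 < \<rho>})"
proof -
  obtain K where K: "\<And>x. h x \<le> K" using assms unfolding bounded_borel_def by (meson abs_le_D1)
  show ?thesis by (intro bdd_aboveI[of _ K]) (auto intro!: ball_avg_le assms K)
qed

lemma maximal_index_nonempty: "{\<rho>::real. \<rho> \<in> \<rat> \<and> 0 < \<rho>} \<noteq> {}"
  by (auto intro: exI[of _ 1])

text \<open>The supremum in \<open>maximal\<close> runs over rational radii, hence is countable and
  measurable. An arbitrary radius \<rho> is served by a rational one between \<rho> and
  \<open>2 * \<rho>\<close>, at the price of the volume factor.\<close>

lemma ball_avg_le_maximal:
  fixes h :: "'a::euclidean_space \<Rightarrow> real"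
  assumes "bounded_borel h" "\<And>x. 0 \<le> h x" "0 < \<rho>"
  shows "ball_avg h z \<rho> \<le> 2 ^ DIM('a) * maximal h z"
proof -
  obtain t where t: "t \<in> \<rat>" "\<rho> < t" "t < 2 * \<rho>" using Rats_dense_in_real[of \<rho> "2 * \<rho>"] assms(3) by auto
  have "ball_avg h z \<rho> \<le> (t / \<rho>) ^ DIM('a) * ball_avg h z t"
    using t by (intro ball_avg_enlarge assms subset_ball) auto
  also have "\<dots> \<le> 2 ^ DIM('a) * maximal h z"
    unfolding maximal_def using t assms(3)
    by (intro mult_mono power_mono cSUP_upper maximal_bdd assms ball_avg_nonneg) (auto simp: field_simps)
  finally show ?thesis .
qed

lemma maximal_nonneg:
  fixes h :: "'a::euclidean_space \<Rightarrow> real"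
  assumes "bounded_borel h" "\<And>x. 0 \<le> h x"
  shows "0 \<le> maximal h z"
proof -
  have "0 \<le> ball_avg h z 1" by (intro ball_avg_nonneg assms)
  also have "\<dots> \<le> maximal h z" unfolding maximal_def by (intro cSUP_upper maximal_bdd assms) auto
  finally show ?thesis .
qed

lemma maximal_measurable:
  fixes h :: "'a::euclidean_space \<Rightarrow> real"
  assumes "bounded_borel h" shows "maximal h \<in> borel_measurable borel"
proof -
  have "countable {\<rho>::real. \<rho> \<in> \<rat> \<and> 0 < \<rho>}"
    using countable_subset[OF _ countable_rat, of "{\<rho>::real. \<rho> \<in> \<rat> \<and> 0 < \<rho>}"] by auto
  then have "(\<lambda>z. SUP \<rho>\<in>{\<rho>. \<rho> \<in> \<rat> \<and> 0 < \<rho>}. ball_avg h z \<rho>) \<in> borel_measurable borel"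
    using maximal_bdd[OF assms] bounded_borel_measurable[OF assms]
    by (intro borel_measurable_cSUP ball_avg_measurable) auto
  then show ?thesis by (simp add: maximal_def[abs_def])
qed

text \<open>Every point of the level set is the centre of a ball with mean above \<open>l\<close>,
  and the covering estimate is applied to these balls. Its demand for bounded radii is met because
  such a ball has measure at most \<open>T / l\<close>, with \<open>T\<close> the total integral; an
  infinite total makes the claim trivial.\<close>

lemma maximal_weak_type:
  fixes h :: "'a::euclidean_space \<Rightarrow> real"
  assumes bb: "bounded_borel h" and nn: "\<And>x. 0 \<le> h x" and l: "0 < l"
  shows "ennreal l * emeasure lborel {z. l < maximal h z} \<le> 6 ^ DIM('a) * (\<integral>\<^sup>+x. ennreal (h x) \<partial>lborel)"
proof (cases "(\<integral>\<^sup>+x. ennreal (h x) \<partial>lborel) = \<infinity>")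
  case True
  then show ?thesis by (simp add: ennreal_mult_top)
next
  case False
  then obtain T where T: "0 \<le> T" "(\<integral>\<^sup>+x. ennreal (h x) \<partial>lborel) = ennreal T"
    by (metis ennreal_cases infinity_ennreal_def)
  have [measurable]: "h \<in> borel_measurable borel" using bb by (rule bounded_borel_measurable)
  have [measurable]: "maximal h \<in> borel_measurable borel" using bb by (rule maximal_measurable)
  define S where "S = {z. l < maximal h z}"
  have "\<exists>\<rho>. 0 < \<rho> \<and> l < ball_avg h z \<rho>" if "z \<in> S" for z
    using that maximal_bdd[OF bb] unfolding S_def maximal_def
    by (subst (asm) mem_Collect_eq, subst (asm) less_cSUP_iff[OF maximal_index_nonempty]) auto
  then obtain \<rho> where \<rho>: "\<And>z. z \<in> S \<Longrightarrow> 0 < \<rho> z \<and> l < ball_avg h z (\<rho> z)" by metis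
  define U where "U = unit_ball_vol (real DIM('a))"
  have U: "0 < U" by (simp add: U_def)
  have le: "l * measure lborel (ball z (\<rho> z)) \<le> measure lborel (ball z (\<rho> z)) * ball_avg h z (\<rho> z)" if "z \<in> S" for z
    using \<rho>[OF that] by simp
  have "\<rho> z \<le> max 1 (T / (l * U))" if z: "z \<in> S" for z
  proof (cases "\<rho> z \<le> 1")
    case False
    have "ennreal (measure lborel (ball z (\<rho> z)) * ball_avg h z (\<rho> z)) = (\<integral>\<^sup>+y. ennreal (h y) * indicator (ball z (\<rho> z)) y \<partial>lborel)"
      using \<rho>[OF z] by (intro nn_integral_ball[symmetric] bb nn) auto
    also have "\<dots> \<le> (\<integral>\<^sup>+x. ennreal (h x) \<partial>lborel)" by (intro nn_integral_mono) (auto simp: indicator_def)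
    finally have "measure lborel (ball z (\<rho> z)) * ball_avg h z (\<rho> z) \<le> T" using T by simp
    then have "l * measure lborel (ball z (\<rho> z)) \<le> T" using le[OF z] by linarith
    then have "l * (U * \<rho> z ^ DIM('a)) \<le> T" using \<rho>[OF z] by (simp add: content_ball U_def)
    then have "\<rho> z ^ DIM('a) \<le> T / (l * U)" using l U by (simp add: field_simps)
    \<comment> \<open>Replaces taking a root of the volume bound; it needs a radius above 1, hence
      the maximum with 1 in the bound.\<close>
    moreover have "\<rho> z \<le> \<rho> z ^ DIM('a)" using False by (intro self_le_power) auto
    ultimately show ?thesis by linarith
  qed auto
  then have bd: "0 < \<rho> z \<and> \<rho> z \<le> max 1 (T / (l * U))" if "z \<in> S" for z using \<rho> that by blast
  have "(\<integral>\<^sup>+y. ennreal l * indicator S y \<partial>lborel) \<le> (\<integral>\<^sup>+y. 6 ^ DIM('a) * ennreal (h y) \<partial>lborel)"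
  proof (rule vitali_nn_integral[OF _ _ bd])
    fix z assume z: "z \<in> S"
    define W where "W = measure lborel (ball z (\<rho> z))"
    have "(\<integral>\<^sup>+y. ennreal l * indicator (ball z (6 * \<rho> z)) y \<partial>lborel) = ennreal (measure lborel (ball z (6 * \<rho> z)) * l)"
      using nn_integral_ball[of "\<lambda>y. l" "6 * \<rho> z" z] l \<rho>[OF z] by simp
    also have "\<dots> = ennreal (6 ^ DIM('a) * W * l)"
      unfolding W_def using \<rho>[OF z] by (subst content_ball_scale[of _ _ _ z]) auto
    also have "\<dots> \<le> ennreal (6 ^ DIM('a) * (W * ball_avg h z (\<rho> z)))"
      using mult_left_mono[OF le[OF z], of "6 ^ DIM('a)"] by (intro ennreal_leI) (simp add: W_def algebra_simps)
    also have "\<dots> = 6 ^ DIM('a) * (\<integral>\<^sup>+y. ennreal (h y) * indicator (ball z (\<rho> z)) y \<partial>lborel)"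
      unfolding W_def using \<rho>[OF z] ball_avg_nonneg[of h z "\<rho> z"] nn
      by (subst nn_integral_ball) (auto simp: bb ennreal_mult ennreal_power[symmetric])
    also have "\<dots> = (\<integral>\<^sup>+y. 6 ^ DIM('a) * ennreal (h y) * indicator (ball z (\<rho> z)) y \<partial>lborel)"
      by (subst nn_integral_cmult[symmetric])
         (auto simp: mult.assoc intro!: borel_measurable_times_ennreal borel_measurable_indicator)
    finally show "(\<integral>\<^sup>+y. ennreal l * indicator (ball z (6 * \<rho> z)) y \<partial>lborel)
        \<le> (\<integral>\<^sup>+y. 6 ^ DIM('a) * ennreal (h y) * indicator (ball z (\<rho> z)) y \<partial>lborel)" .
  qed auto
  then show ?thesis by (simp add: nn_integral_cmult_indicator nn_integral_cmult S_def)
qed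

text \<open>Marcinkiewicz interpolation between the weak type bound and the trivial bound for
  bounded functions: at level \<open>l\<close> only the part of \<open>h\<close> above
  \<open>l / 2\<close> counts, since the remainder adds at most \<open>l / 2\<close> to any mean.
  The weak type bound for that part is then integrated in \<open>l\<close>.\<close>

lemma maximal_strong_type:
  fixes h :: "'a::euclidean_space \<Rightarrow> real"
  assumes bb: "bounded_borel h" and nn: "\<And>x. 0 \<le> h x" and t: "1 < t"
  shows "(\<integral>\<^sup>+z. ennreal (maximal h z powr t) \<partial>lborel)
    \<le> ennreal (6 ^ DIM('a) * 2 powr t * t / (t - 1)) * (\<integral>\<^sup>+x. ennreal (h x powr t) \<partial>lborel)"
proof -
  have [measurable]: "h \<in> borel_measurable borel" using bb by (rule bounded_borel_measurable)
  have [measurable]: "maximal h \<in> borel_measurable borel" using bb by (rule maximal_measurable)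
  define n where "n = DIM('a)"
  have M0: "0 \<le> maximal h z" for z by (intro maximal_nonneg bb nn)
  have level: "emeasure lborel {z. l < maximal h z}
      \<le> ennreal (2 * 6 ^ n / l) * (\<integral>\<^sup>+x. ennreal (h x) * indicator {l<..} (2 * h x) \<partial>lborel)" if l: "0 < l" for l
  proof -
    define h1 where "h1 x = h x * indicator {l<..} (2 * h x)" for x
    have bb1: "bounded_borel h1"
    proof -
      obtain K where "\<And>x. \<bar>h x\<bar> \<le> K" using bb by (auto simp: bounded_borel_def)
      then have "\<bar>h1 x\<bar> \<le> K" for x by (auto simp: h1_def indicator_def intro: order_trans[OF abs_ge_zero])
      moreover have "h1 \<in> borel_measurable borel" unfolding h1_def by measurable
      ultimately show ?thesis by (intro bounded_borelI)
    qed
    have nn1: "0 \<le> h1 x" for x using nn by (simp add: h1_def)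
    have pt: "maximal h z \<le> maximal h1 z + l / 2" for z
    proof -
      have "ball_avg h z \<rho> \<le> maximal h1 z + l / 2" if \<rho>: "\<rho> \<in> \<rat> \<and> 0 < \<rho>" for \<rho>
      proof -
        have "ball_avg h z \<rho> \<le> ball_avg (\<lambda>y. h1 y + l / 2) z \<rho>"
          by (intro ball_avg_mono bounded_borel_add bb bb1 bounded_borel_const)
             (use l in \<open>auto simp: h1_def indicator_def\<close>)
        also have "\<dots> = ball_avg h1 z \<rho> + l / 2" using \<rho> by (subst ball_avg_add) (auto simp: bb1)
        also have "ball_avg h1 z \<rho> \<le> maximal h1 z" unfolding maximal_def using \<rho>
          by (intro cSUP_upper maximal_bdd bb1) auto
        finally show ?thesis by simp
      qed
      then show ?thesis unfolding maximal_def[of h] by (intro cSUP_least maximal_index_nonempty) auto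
    qed
    have [measurable]: "maximal h1 \<in> borel_measurable borel" using bb1 by (rule maximal_measurable)
    have "emeasure lborel {z. l < maximal h z} \<le> emeasure lborel {z. l / 2 < maximal h1 z}"
    proof (intro emeasure_mono subsetI)
      fix z assume "z \<in> {z. l < maximal h z}"
      then show "z \<in> {z. l / 2 < maximal h1 z}" using pt[of z] by auto
    qed auto
    also have "\<dots> = ennreal (2 / l) * (ennreal (l / 2) * emeasure lborel {z. l / 2 < maximal h1 z})"
      using l by (simp add: mult.assoc[symmetric] ennreal_mult[symmetric])
    also have "\<dots> \<le> ennreal (2 / l) * (6 ^ n * (\<integral>\<^sup>+x. ennreal (h1 x) \<partial>lborel))"
      unfolding n_def using l by (intro mult_left_mono maximal_weak_type bb1 nn1) auto
    also have "\<dots> = ennreal (2 * 6 ^ n / l) * (\<integral>\<^sup>+x. ennreal (h1 x) \<partial>lborel)"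
    proof -
      have "ennreal (2 * 6 ^ n / l) = ennreal (2 / l) * 6 ^ n"
        using l by (simp add: ennreal_mult[symmetric] ennreal_power flip: ennreal_numeral)
      then show ?thesis by (simp add: mult.assoc)
    qed
    also have "(\<integral>\<^sup>+x. ennreal (h1 x) \<partial>lborel) = (\<integral>\<^sup>+x. ennreal (h x) * indicator {l<..} (2 * h x) \<partial>lborel)"
      unfolding h1_def using nn by (intro nn_integral_cong) (auto simp: indicator_def)
    finally show ?thesis .
  qed
  \<comment> \<open>Layer cake: the power \<open>t\<close> of a nonnegative number is the integral
    of \<open>t * l powr (t - 1)\<close> over all \<open>l\<close> between 0 and that
    number.\<close>
  have "(\<integral>\<^sup>+z. ennreal (maximal h z powr t) \<partial>lborel)
      = (\<integral>\<^sup>+z. \<integral>\<^sup>+l. ennreal t * (ennreal (l powr (t - 1)) * indicator {0<..<maximal h z} l) \<partial>lborel \<partial>lborel)"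
  proof (intro nn_integral_cong)
    fix z
    have "(\<integral>\<^sup>+l. ennreal t * (ennreal (l powr (t - 1)) * indicator {0<..<maximal h z} l) \<partial>lborel)
       = ennreal t * ennreal (maximal h z powr (t - 1 + 1) / (t - 1 + 1))"
      using t M0 by (subst nn_integral_cmult) (auto simp: nn_integral_powr_from_0)
    then show "ennreal (maximal h z powr t)
        = (\<integral>\<^sup>+l. ennreal t * (ennreal (l powr (t - 1)) * indicator {0<..<maximal h z} l) \<partial>lborel)"
      using t by (simp add: ennreal_mult[symmetric])
  qed
  also have "\<dots> = (\<integral>\<^sup>+z. \<integral>\<^sup>+l. ennreal (t * l powr (t - 1)) * indicator {0<..} l * indicator {l<..} (maximal h z) \<partial>lborel \<partial>lborel)"
    using t by (intro nn_integral_cong) (auto simp: indicator_def ennreal_mult)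
  also have "\<dots> = (\<integral>\<^sup>+l. \<integral>\<^sup>+z. ennreal (t * l powr (t - 1)) * indicator {0<..} l * indicator {l<..} (maximal h z) \<partial>lborel \<partial>lborel)"
    by (rule lborel_pair.Fubini') (simp only: indicator_def of_bool_def greaterThan_iff, measurable)
  also have "\<dots> \<le> (\<integral>\<^sup>+l. \<integral>\<^sup>+x. ennreal (2 * 6 ^ n * t) * (ennreal (l powr (t - 2)) * ennreal (h x) * indicator {0<..<2 * h x} l) \<partial>lborel \<partial>lborel)"
  proof (rule nn_integral_mono)
    fix l :: real
    show "(\<integral>\<^sup>+z. ennreal (t * l powr (t - 1)) * indicator {0<..} l * indicator {l<..} (maximal h z) \<partial>lborel)
       \<le> (\<integral>\<^sup>+x. ennreal (2 * 6 ^ n * t) * (ennreal (l powr (t - 2)) * ennreal (h x) * indicator {0<..<2 * h x} l) \<partial>lborel)"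
    proof (cases "0 < l")
      case True
      have "(\<integral>\<^sup>+z. ennreal (t * l powr (t - 1)) * indicator {0<..} l * indicator {l<..} (maximal h z) \<partial>lborel)
         = (\<integral>\<^sup>+z. ennreal (t * l powr (t - 1)) * indicator {z. l < maximal h z} z \<partial>lborel)"
        using True by (intro nn_integral_cong) (auto simp: indicator_def)
      also have "\<dots> = ennreal (t * l powr (t - 1)) * emeasure lborel {z. l < maximal h z}"
        by (rule nn_integral_cmult_indicator) measurable
      also have "\<dots> \<le> ennreal (t * l powr (t - 1)) * (ennreal (2 * 6 ^ n / l) * (\<integral>\<^sup>+x. ennreal (h x) * indicator {l<..} (2 * h x) \<partial>lborel))"
        by (intro mult_left_mono level True) auto
      also have "\<dots> = ennreal (2 * 6 ^ n * t * l powr (t - 2)) * (\<integral>\<^sup>+x. ennreal (h x) * indicator {l<..} (2 * h x) \<partial>lborel)"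
      proof -
        have "l powr (t - 2) = l powr (t - 1) / l" using True powr_diff[of l "t - 1" 1] by simp
        then have "t * l powr (t - 1) * (2 * 6 ^ n / l) = 2 * 6 ^ n * t * l powr (t - 2)" by simp
        then show ?thesis using t True by (simp add: mult.assoc[symmetric] ennreal_mult[symmetric])
      qed
      also have "\<dots> = (\<integral>\<^sup>+x. ennreal (2 * 6 ^ n * t * l powr (t - 2)) * (ennreal (h x) * indicator {l<..} (2 * h x)) \<partial>lborel)"
        by (rule nn_integral_cmult[symmetric]) measurable
      also have "\<dots> = (\<integral>\<^sup>+x. ennreal (2 * 6 ^ n * t) * (ennreal (l powr (t - 2)) * ennreal (h x) * indicator {0<..<2 * h x} l) \<partial>lborel)"
        using True t by (intro nn_integral_cong) (auto simp: indicator_def ennreal_mult mult.assoc)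
      finally show ?thesis by simp
    qed simp
  qed
  also have "\<dots> = (\<integral>\<^sup>+x. \<integral>\<^sup>+l. ennreal (2 * 6 ^ n * t) * (ennreal (l powr (t - 2)) * ennreal (h x) * indicator {0<..<2 * h x} l) \<partial>lborel \<partial>lborel)"
  proof (rule lborel_pair.Fubini'[symmetric])
    have "(\<lambda>(l, x). ennreal (2 * 6 ^ n * t) * (ennreal (l powr (t - 2)) * ennreal (h x) * (indicator {0<..} l * indicator {l<..} (2 * h x))))
       \<in> borel_measurable (lborel \<Otimes>\<^sub>M lborel)"
      by (simp only: indicator_def of_bool_def greaterThan_iff, measurable)
    also have "(\<lambda>(l, x). ennreal (2 * 6 ^ n * t) * (ennreal (l powr (t - 2)) * ennreal (h x) * (indicator {0<..} l * indicator {l<..} (2 * h x))))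
      = (\<lambda>(l, x). ennreal (2 * 6 ^ n * t) * (ennreal (l powr (t - 2)) * ennreal (h x) * indicator {0<..<2 * h x} l))"
      by (auto simp: indicator_def fun_eq_iff)
    finally show "\<dots> \<in> borel_measurable (lborel \<Otimes>\<^sub>M lborel)" .
  qed
  \<comment> \<open>The inner integral over \<open>0 < l < 2 * h x\<close> converges at 0 because
    \<open>t > 1\<close> puts \<open>t - 2\<close> above -1; its value carries the factor
    \<open>1 / (t - 1)\<close>.\<close>
  also have "\<dots> = (\<integral>\<^sup>+x. ennreal (6 ^ n * 2 powr t * t / (t - 1)) * ennreal (h x powr t) \<partial>lborel)"
  proof (intro nn_integral_cong)
    fix x
    have "(\<integral>\<^sup>+l. ennreal (2 * 6 ^ n * t) * (ennreal (l powr (t - 2)) * ennreal (h x) * indicator {0<..<2 * h x} l) \<partial>lborel)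
       = (\<integral>\<^sup>+l. (ennreal (2 * 6 ^ n * t) * ennreal (h x)) * (ennreal (l powr (t - 2)) * indicator {0<..<2 * h x} l) \<partial>lborel)"
      by (intro nn_integral_cong) (simp add: mult_ac)
    also have "\<dots> = (ennreal (2 * 6 ^ n * t) * ennreal (h x)) * ennreal ((2 * h x) powr (t - 2 + 1) / (t - 2 + 1))"
      using t nn by (subst nn_integral_cmult) (auto simp: nn_integral_powr_from_0)
    also have "\<dots> = ennreal (2 * 6 ^ n * t * h x * ((2 * h x) powr (t - 1) / (t - 1)))"
      using t nn by (simp add: ennreal_mult[symmetric])
    also have "2 * 6 ^ n * t * h x * ((2 * h x) powr (t - 1) / (t - 1)) = 6 ^ n * 2 powr t * t / (t - 1) * h x powr t"
    proof (cases "h x = 0")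
      case False
      then have e: "h x powr t = h x * h x powr (t - 1)" "(2::real) powr t = 2 * 2 powr (t - 1)"
        using nn[of x] by (auto simp: powr_mult_base)
      show ?thesis unfolding e using nn[of x] by (simp add: powr_mult field_simps)
    qed simp
    finally show "(\<integral>\<^sup>+l. ennreal (2 * 6 ^ n * t) * (ennreal (l powr (t - 2)) * ennreal (h x) * indicator {0<..<2 * h x} l) \<partial>lborel)
      = ennreal (6 ^ n * 2 powr t * t / (t - 1)) * ennreal (h x powr t)"
      using t by (simp add: ennreal_mult[symmetric])
  qed
  also have "\<dots> = ennreal (6 ^ n * 2 powr t * t / (t - 1)) * (\<integral>\<^sup>+x. ennreal (h x powr t) \<partial>lborel)"
    by (rule nn_integral_cmult) measurable
  finally show ?thesis by (simp add: n_def)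
qed

section \<open>The commutator form with Riesz kernel\<close>

text \<open>The bound \<open>a\<close> serves small \<rho> and the decaying bound large \<rho>;
  \<open>0 < s\<close> gives convergence at 0 and \<open>s < \<nu>\<close> at infinity. Splitting at
  the radius \<open>R\<close> where the two bounds agree makes both halves multiples of the same
  product.\<close>

lemma Hedberg_integral:
  fixes a b s \<nu> :: real
  assumes ab: "0 \<le> a" "0 \<le> b" and s: "0 < s" "s < \<nu>"
  shows "(\<integral>\<^sup>+\<rho>. ennreal (\<rho> powr (s - 1) * min a (b * \<rho> powr (- \<nu>))) * indicator {0<..} \<rho> \<partial>lborel)
    \<le> ennreal ((1 / s + 1 / (\<nu> - s)) * (a powr (1 - s / \<nu>) * b powr (s / \<nu>)))"
proof (cases "a = 0 \<or> b = 0")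
  case True
  have "(\<integral>\<^sup>+\<rho>. ennreal (\<rho> powr (s - 1) * min a (b * \<rho> powr (- \<nu>))) * indicator {0<..} \<rho> \<partial>lborel) = (\<integral>\<^sup>+_. 0 \<partial>(lborel :: real measure))"
    using True ab by (intro nn_integral_cong) (auto simp: indicator_def)
  then show ?thesis by simp
next
  case False
  then have pos: "0 < a" "0 < b" using ab by auto
  define R where "R = (b / a) powr (1 / \<nu>)"
  have R: "0 < R" using pos by (simp add: R_def)
  define X where "X = a powr (1 - s / \<nu>) * b powr (s / \<nu>)"
  have e1: "a * R powr s = X"
    using pos s by (simp add: R_def X_def powr_powr powr_divide powr_diff)
  have e2: "b * R powr (s - \<nu>) = X"
  proof -
    have "R powr (s - \<nu>) = (b / a) powr (s / \<nu> - 1)"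
      using s by (simp add: R_def powr_powr field_simps)
    then show ?thesis using pos by (simp add: X_def powr_divide powr_diff)
  qed
  have "(\<integral>\<^sup>+\<rho>. ennreal (\<rho> powr (s - 1) * min a (b * \<rho> powr (- \<nu>))) * indicator {0<..} \<rho> \<partial>lborel)
     \<le> (\<integral>\<^sup>+\<rho>. ennreal a * (ennreal (\<rho> powr (s - 1)) * indicator {0<..<R} \<rho>)
              + ennreal b * (ennreal (\<rho> powr (s - 1 - \<nu>)) * indicator {R<..} \<rho>) \<partial>lborel)"
  proof (rule nn_integral_mono_AE, rule AE_mp[OF AE_lborel_singleton[of R]], rule AE_I2, rule impI)
    fix \<rho> :: real assume "\<rho> \<noteq> R"
    then consider "\<rho> \<le> 0" | "0 < \<rho>" "\<rho> < R" | "0 < \<rho>" "R < \<rho>" using R by linarith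
    then show "ennreal (\<rho> powr (s - 1) * min a (b * \<rho> powr (- \<nu>))) * indicator {0<..} \<rho>
        \<le> ennreal a * (ennreal (\<rho> powr (s - 1)) * indicator {0<..<R} \<rho>)
              + ennreal b * (ennreal (\<rho> powr (s - 1 - \<nu>)) * indicator {R<..} \<rho>)"
    proof cases
      case 2
      have "\<rho> powr (s - 1) * min a (b * \<rho> powr (- \<nu>)) \<le> a * \<rho> powr (s - 1)"
        using mult_left_mono[of "min a (b * \<rho> powr (- \<nu>))" a "\<rho> powr (s - 1)"] by (simp add: mult.commute)
      then show ?thesis using 2 pos by (simp add: ennreal_mult[symmetric] ennreal_leI)
    next
      case 3
      have "\<rho> powr (s - 1) * min a (b * \<rho> powr (- \<nu>)) \<le> \<rho> powr (s - 1) * (b * \<rho> powr (- \<nu>))"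
        by (intro mult_left_mono) auto
      also have "\<dots> = b * \<rho> powr (s - 1 - \<nu>)" by (simp add: powr_add[symmetric])
      finally show ?thesis using 3 pos by (simp add: ennreal_mult[symmetric] ennreal_leI)
    qed simp
  qed
  also have "\<dots> = ennreal a * ennreal (R powr (s - 1 + 1) / (s - 1 + 1))
      + ennreal b * ennreal (R powr (s - 1 - \<nu> + 1) / - (s - 1 - \<nu> + 1))"
    using s R by (subst nn_integral_add)
      (auto simp: nn_integral_cmult nn_integral_powr_from_0 nn_integral_powr_to_inf simp del: minus_add_distrib minus_diff_eq)
  also have "\<dots> = ennreal (a * (R powr s / s) + b * (R powr (s - \<nu>) / (\<nu> - s)))"
    using s pos by (simp add: ennreal_mult[symmetric] ennreal_plus[symmetric] del: ennreal_plus)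
  also have "a * (R powr s / s) + b * (R powr (s - \<nu>) / (\<nu> - s)) = (1 / s + 1 / (\<nu> - s)) * X"
    by (simp add: e1[symmetric] distrib_right) (simp add: e1 e2)
  finally show ?thesis by (simp add: X_def)
qed

text \<open>Hoelder with exponents \<open>m\<close> and \<open>m / (m - 1)\<close>: the oscillation
  takes the integer moment that \<open>john_nirenberg\<close> controls, and a large \<open>m\<close>
  leaves on \<open>F\<close> a mean with exponent close to 1.\<close>

lemma osc_avg_bound:
  fixes m :: nat
  assumes m: "2 \<le> m"
  shows "\<exists>C>0. \<forall>(\<phi>::'a::euclidean_space \<Rightarrow> real) N F x r. continuous_on UNIV \<phi> \<longrightarrow> bounded_borel \<phi> \<longrightarrow>
    0 < N \<longrightarrow> mean_osc_le \<phi> N \<longrightarrow> bounded_borel F \<longrightarrow> (\<forall>y. 0 \<le> F y) \<longrightarrow> 0 < r \<longrightarrow>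
    ball_avg (\<lambda>y. \<bar>\<phi> y - ball_avg \<phi> x r\<bar> * F y) x r
      \<le> C * N * ball_avg (\<lambda>y. F y powr (real m / (real m - 1))) x r powr (1 / (real m / (real m - 1)))"
proof -
  obtain C where C: "0 < C" and JN: "\<And>(\<phi>::'a \<Rightarrow> real) N x r. continuous_on UNIV \<phi> \<Longrightarrow> bounded_borel \<phi> \<Longrightarrow>
    0 < N \<Longrightarrow> mean_osc_le \<phi> N \<Longrightarrow> 0 < r \<Longrightarrow> ball_avg (\<lambda>y. \<bar>\<phi> y - ball_avg \<phi> x r\<bar> ^ m) x r \<le> C * N ^ m"
    using john_nirenberg[of m, where 'a='a] by blast
  define k where "k = real m / (real m - 1)"
  have k: "1 < real m" "1 < k" "1 / real m + 1 / k = 1" using m by (auto simp: k_def field_simps)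
  show ?thesis
  proof (intro exI[of _ "C powr (1 / real m)"] conjI allI impI)
    fix \<phi> F :: "'a \<Rightarrow> real" and N x and r :: real
    assume \<phi>: "continuous_on UNIV \<phi>" "bounded_borel \<phi>" and N: "0 < N" "mean_osc_le \<phi> N"
      and F: "bounded_borel F" "\<forall>y. 0 \<le> F y" and r: "0 < r"
    define c where "c = ball_avg \<phi> x r"
    have "ball_avg (\<lambda>y. \<bar>\<phi> y - c\<bar> * F y) x r
      \<le> ball_avg (\<lambda>y. \<bar>\<phi> y - c\<bar> powr real m) x r powr (1 / real m) * ball_avg (\<lambda>y. F y powr k) x r powr (1 / k)"
      using F(2) by (intro ball_Holder bounded_borel_osc \<phi> F(1) k r) auto
    also have "(\<lambda>y. \<bar>\<phi> y - c\<bar> powr real m) = (\<lambda>y. \<bar>\<phi> y - c\<bar> ^ m)"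
      using m by (intro ext powr_realpow') auto
    also have "ball_avg (\<lambda>y. \<bar>\<phi> y - c\<bar> ^ m) x r powr (1 / real m) * ball_avg (\<lambda>y. F y powr k) x r powr (1 / k)
        \<le> (C * N ^ m) powr (1 / real m) * ball_avg (\<lambda>y. F y powr k) x r powr (1 / k)"
      unfolding c_def using \<phi> N r by (intro mult_right_mono powr_mono2 JN ball_avg_nonneg) auto
    also have "(C * N ^ m) powr (1 / real m) = C powr (1 / real m) * N"
      using C N m by (simp add: powr_mult powr_realpow[symmetric] powr_powr)
    finally show "ball_avg (\<lambda>y. \<bar>\<phi> y - ball_avg \<phi> x r\<bar> * F y) x r
      \<le> C powr (1 / real m) * N * ball_avg (\<lambda>y. F y powr (real m / (real m - 1))) x r powr (1 / (real m / (real m - 1)))"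
      by (simp add: c_def k_def)
  qed (use C in simp)
qed

text \<open>Inserting the average \<open>c\<close> by the triangle inequality splits the double
  integral into two products of single integrals, each with the oscillation on only one of the two
  factors.\<close>

lemma ball_double_osc_bound:
  fixes \<phi> F G :: "'a::euclidean_space \<Rightarrow> real"
  assumes \<phi>: "bounded_borel \<phi>" and F: "bounded_borel F" "\<And>y. 0 \<le> F y" and G: "bounded_borel G" "\<And>y. 0 \<le> G y"
    and r: "0 < r"
    and oF: "ball_avg F x r \<le> f1" "ball_avg (\<lambda>y. \<bar>\<phi> y - ball_avg \<phi> x r\<bar> * F y) x r \<le> f2"
    and oG: "ball_avg G x r \<le> g1" "ball_avg (\<lambda>y. \<bar>\<phi> y - ball_avg \<phi> x r\<bar> * G y) x r \<le> g2"
  shows "(\<integral>\<^sup>+(u, v). ennreal (\<bar>\<phi> u - \<phi> v\<bar> * F v * G u) * (indicator (ball x r) u * indicator (ball x r) v) \<partial>(lborel \<Otimes>\<^sub>M lborel))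
    \<le> ennreal ((measure lborel (ball x r))\<^sup>2 * (g2 * f1 + g1 * f2))"
proof -
  define c where "c = ball_avg \<phi> x r"
  define V where "V = measure lborel (ball x r)"
  have V: "0 < V" using r by (simp add: V_def)
  define H where "H h = (\<integral>\<^sup>+y. ennreal (h y) * indicator (ball x r) y \<partial>lborel)" for h :: "'a \<Rightarrow> real"
  have [measurable]: "\<phi> \<in> borel_measurable borel" "F \<in> borel_measurable borel" "G \<in> borel_measurable borel"
    using \<phi> F G by (auto simp: bounded_borel_measurable)
  have [measurable]: "ball x r \<in> sets borel" by simp
  have Hle: "H h \<le> ennreal (V * t)" if "bounded_borel h" "\<And>y. 0 \<le> h y" "ball_avg h x r \<le> t" for h t
    unfolding H_def V_def using that r by (subst nn_integral_ball) (auto intro!: ennreal_leI mult_left_mono)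
  have pt: "\<bar>\<phi> u - \<phi> v\<bar> * F v * G u \<le> \<bar>\<phi> u - c\<bar> * G u * F v + G u * (\<bar>\<phi> v - c\<bar> * F v)" for u v
  proof -
    have "\<bar>\<phi> u - \<phi> v\<bar> * (F v * G u) \<le> (\<bar>\<phi> u - c\<bar> + \<bar>\<phi> v - c\<bar>) * (F v * G u)"
      using F G by (intro mult_right_mono) auto
    then show ?thesis by (simp add: algebra_simps)
  qed
  have "(\<integral>\<^sup>+(u, v). ennreal (\<bar>\<phi> u - \<phi> v\<bar> * F v * G u) * (indicator (ball x r) u * indicator (ball x r) v) \<partial>(lborel \<Otimes>\<^sub>M lborel))
     = (\<integral>\<^sup>+u. \<integral>\<^sup>+v. ennreal (\<bar>\<phi> u - \<phi> v\<bar> * F v * G u) * (indicator (ball x r) u * indicator (ball x r) v) \<partial>lborel \<partial>lborel)"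
  proof -
    have "(\<lambda>(u, v). ennreal (\<bar>\<phi> u - \<phi> v\<bar> * F v * G u) * (indicator (ball x r) u * indicator (ball x r) v))
        \<in> borel_measurable (lborel \<Otimes>\<^sub>M lborel)"
      by (simp only: indicator_def of_bool_def mem_ball split_def, measurable)
    from lborel.nn_integral_fst[OF this] show ?thesis by simp
  qed
  also have "\<dots> \<le> (\<integral>\<^sup>+u. \<integral>\<^sup>+v. 
     (ennreal (\<bar>\<phi> u - c\<bar> * G u) * indicator (ball x r) u) * (ennreal (F v) * indicator (ball x r) v)
     + (ennreal (G u) * indicator (ball x r) u) * (ennreal (\<bar>\<phi> v - c\<bar> * F v) * indicator (ball x r) v) \<partial>lborel \<partial>lborel)"
  proof (intro nn_integral_mono)
    fix u v
    show "ennreal (\<bar>\<phi> u - \<phi> v\<bar> * F v * G u) * (indicator (ball x r) u * indicator (ball x r) v)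
      \<le> (ennreal (\<bar>\<phi> u - c\<bar> * G u) * indicator (ball x r) u) * (ennreal (F v) * indicator (ball x r) v)
     + (ennreal (G u) * indicator (ball x r) u) * (ennreal (\<bar>\<phi> v - c\<bar> * F v) * indicator (ball x r) v)"
      using pt[of u v] F G
      by (auto simp: indicator_def ennreal_mult[symmetric] ennreal_plus[symmetric] simp del: ennreal_plus intro!: ennreal_leI)
  qed
  also have "\<dots> = (\<integral>\<^sup>+u. (ennreal (\<bar>\<phi> u - c\<bar> * G u) * indicator (ball x r) u) * H F
     + (ennreal (G u) * indicator (ball x r) u) * H (\<lambda>v. \<bar>\<phi> v - c\<bar> * F v) \<partial>lborel)"
    unfolding H_def by (subst nn_integral_add) (auto simp: nn_integral_cmult)
  also have "\<dots> = H (\<lambda>u. \<bar>\<phi> u - c\<bar> * G u) * H F + H G * H (\<lambda>v. \<bar>\<phi> v - c\<bar> * F v)"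
    by (subst nn_integral_add) (auto simp: nn_integral_multc H_def)
  also have "\<dots> \<le> ennreal (V * g2) * ennreal (V * f1) + ennreal (V * g1) * ennreal (V * f2)"
    using F G oF oG by (intro add_mono mult_mono Hle bounded_borel_intros \<phi>) (auto simp: c_def)
  also have "\<dots> = ennreal (V\<^sup>2 * (g2 * f1 + g1 * f2))"
  proof -
    have "0 \<le> f1" "0 \<le> f2" "0 \<le> g1" "0 \<le> g2"
      using F G oF oG ball_avg_nonneg[of F x r] ball_avg_nonneg[of G x r] 
       ball_avg_nonneg[of "\<lambda>y. \<bar>\<phi> y - ball_avg \<phi> x r\<bar> * F y" x r] ball_avg_nonneg[of "\<lambda>y. \<bar>\<phi> y - ball_avg \<phi> x r\<bar> * G y" x r]
      by auto
    then show ?thesis using V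
      by (simp add: ennreal_mult[symmetric] ennreal_plus[symmetric] power2_eq_square algebra_simps del: ennreal_plus)
  qed
  finally show ?thesis by (simp add: V_def)
qed

text \<open>A continuous substitute for dyadic cubes: the kernel is dominated by an average over all balls that
  contain both points.\<close>

lemma riesz_kernel_le_balls:
  fixes x y :: "'a::euclidean_space"
  assumes s: "s < real DIM('a)"
  shows "ennreal (norm (x - y) powr (s - real DIM('a)))
    \<le> (\<integral>\<^sup>+(z, \<rho>). ennreal ((real DIM('a) - s) / unit_ball_vol (real DIM('a)) * \<rho> powr (s - 2 * real DIM('a) - 1)) * indicator {0<..} \<rho>
          * (indicator (ball z (2 * \<rho>)) x * indicator (ball z (2 * \<rho>)) y) \<partial>(lborel \<Otimes>\<^sub>M lborel))"
\<comment> \<open>On the diagonal the left side is 0, because \<open>0 powr a = 0\<close>. The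
  singularity is lost there without harm, as the factor \<open>\<phi> u - \<phi> v\<close> of the
  form vanishes too.\<close>
proof (cases "x = y")
  case False
  define n where "n = real DIM('a)"
  define U where "U = unit_ball_vol (real DIM('a))"
  define d where "d = norm (x - y)"
  have d: "0 < d" using False by (simp add: d_def)
  have U: "0 < U" by (simp add: U_def)
  have ns: "s < n" using s by (simp add: n_def)
  \<comment> \<open>\<open>d powr (s - n)\<close> is \<open>n - s\<close> times the integral of
    \<open>\<rho> powr (s - n - 1)\<close> over \<rho> above \<open>d\<close>. For such \<rho> every
    centre \<open>z\<close> in \<open>ball x \<rho>\<close> has both points within
    \<open>2 * \<rho>\<close>; dividing by the volume of this set of centres produces the exponent
    \<open>s - 2 * n - 1\<close> and the constant \<open>U\<close>.\<close>
  have "ennreal (d powr (s - n)) = ennreal (n - s) * ennreal (d powr (s - n - 1 + 1) / - (s - n - 1 + 1))"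
    using ns by (subst ennreal_mult[symmetric]) auto
  also have "\<dots> = ennreal (n - s) * (\<integral>\<^sup>+\<rho>. ennreal (\<rho> powr (s - n - 1)) * indicator {d<..} \<rho> \<partial>lborel)"
    using ns d by (subst nn_integral_powr_to_inf) auto
  also have "\<dots> = (\<integral>\<^sup>+\<rho>. ennreal (n - s) * (ennreal (\<rho> powr (s - n - 1)) * indicator {d<..} \<rho>) \<partial>lborel)"
    by (rule nn_integral_cmult[symmetric]) measurable
  also have "\<dots> \<le> (\<integral>\<^sup>+\<rho>. \<integral>\<^sup>+z. ennreal ((n - s) / U * \<rho> powr (s - 2 * n - 1)) * indicator {0<..} \<rho>
          * (indicator (ball z (2 * \<rho>)) x * indicator (ball z (2 * \<rho>)) y) \<partial>lborel \<partial>lborel)"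
  proof (rule nn_integral_mono)
    fix \<rho> :: real
    show "ennreal (n - s) * (ennreal (\<rho> powr (s - n - 1)) * indicator {d<..} \<rho>)
      \<le> (\<integral>\<^sup>+z. ennreal ((n - s) / U * \<rho> powr (s - 2 * n - 1)) * indicator {0<..} \<rho>
          * (indicator (ball z (2 * \<rho>)) x * indicator (ball z (2 * \<rho>)) y) \<partial>lborel)"
    proof (cases "d < \<rho>")
      case True
      then have \<rho>: "0 < \<rho>" using d by simp
      have "\<rho> powr (s - n - 1) = \<rho> powr (s - 2 * n - 1) * \<rho> powr n"
        by (subst powr_add[symmetric]) (simp add: algebra_simps)
      also have "\<rho> powr n = \<rho> ^ DIM('a)" using \<rho> by (simp add: n_def powr_realpow)
      finally have e: "\<rho> powr (s - n - 1) = \<rho> powr (s - 2 * n - 1) * \<rho> ^ DIM('a)" .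
      have "(n - s) * \<rho> powr (s - n - 1) = (n - s) / U * \<rho> powr (s - 2 * n - 1) * (U * \<rho> ^ DIM('a))"
        unfolding e using U by simp
      then have "ennreal (n - s) * (ennreal (\<rho> powr (s - n - 1)) * indicator {d<..} \<rho>)
         = ennreal ((n - s) / U * \<rho> powr (s - 2 * n - 1)) * ennreal (U * \<rho> ^ DIM('a))"
        using True ns U \<rho> by (simp add: ennreal_mult[symmetric])
      also have "ennreal (U * \<rho> ^ DIM('a)) = emeasure lborel (ball x \<rho>)"
        using \<rho> by (simp add: emeasure_ball U_def)
      also have "ennreal ((n - s) / U * \<rho> powr (s - 2 * n - 1)) * emeasure lborel (ball x \<rho>)
         = (\<integral>\<^sup>+z. ennreal ((n - s) / U * \<rho> powr (s - 2 * n - 1)) * indicator (ball x \<rho>) z \<partial>lborel)"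
        by (rule nn_integral_cmult_indicator[symmetric]) simp
      also have "\<dots> \<le> (\<integral>\<^sup>+z. ennreal ((n - s) / U * \<rho> powr (s - 2 * n - 1)) * indicator {0<..} \<rho>
          * (indicator (ball z (2 * \<rho>)) x * indicator (ball z (2 * \<rho>)) y) \<partial>lborel)"
      proof (rule nn_integral_mono)
        fix z :: 'a
        have "z \<in> ball x \<rho> \<Longrightarrow> x \<in> ball z (2 * \<rho>) \<and> y \<in> ball z (2 * \<rho>)"
          using True \<rho> dist_triangle[of z y x] by (auto simp: d_def dist_commute dist_norm[of x y, symmetric])
        then show "ennreal ((n - s) / U * \<rho> powr (s - 2 * n - 1)) * indicator (ball x \<rho>) z
           \<le> ennreal ((n - s) / U * \<rho> powr (s - 2 * n - 1)) * indicator {0<..} \<rho>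
          * (indicator (ball z (2 * \<rho>)) x * indicator (ball z (2 * \<rho>)) y)"
          using \<rho> by (cases "z \<in> ball x \<rho>") (simp_all del: mem_ball)
      qed
      finally show ?thesis .
    qed simp
  qed
  also have "\<dots> = (\<integral>\<^sup>+(z, \<rho>). ennreal ((n - s) / U * \<rho> powr (s - 2 * n - 1)) * indicator {0<..} \<rho>
          * (indicator (ball z (2 * \<rho>)) x * indicator (ball z (2 * \<rho>)) y) \<partial>(lborel \<Otimes>\<^sub>M lborel))"
  proof -
    have "(\<lambda>(z, \<rho>). ennreal ((n - s) / U * \<rho> powr (s - 2 * n - 1)) * indicator {0<..} \<rho>
          * (indicator (ball z (2 * \<rho>)) x * indicator (ball z (2 * \<rho>)) y)) \<in> borel_measurable (lborel \<Otimes>\<^sub>M lborel)"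
      by (simp only: indicator_def of_bool_def mem_ball greaterThan_iff split_def, measurable)
    from lborel_pair.nn_integral_snd[OF this] show ?thesis by simp
  qed
  finally show ?thesis by (simp add: n_def U_def d_def)
qed simp

text \<open>The mean with exponent \<open>t\<close> is at most the one with exponent
  \<open>p\<close>, whose integral may be extended to the whole space; the volume in the denominator
  gives the decay. This is the bound for large radii in Hedberg's argument.\<close>

lemma ball_power_mean_le:
  fixes F :: "'a::euclidean_space \<Rightarrow> real"
  assumes F: "bounded_borel F" "\<And>y. 0 \<le> F y" and a: "0 \<le> a"
    and le: "(\<integral>\<^sup>+y. ennreal (F y powr p) \<partial>lborel) \<le> ennreal (a powr p)"
    and t: "0 < t" "t < p" and \<rho>: "0 < \<rho>"
  shows "ball_avg (\<lambda>y. F y powr t) z \<rho> powr (1 / t)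
     \<le> a * unit_ball_vol (real DIM('a)) powr (- (1 / p)) * \<rho> powr (- (real DIM('a) / p))"
proof -
  define U where "U = unit_ball_vol (real DIM('a))"
  have U: "0 < U" by (simp add: U_def)
  have p: "0 < p" using t by simp
  have bb: "bounded_borel (\<lambda>y. F y powr p)" using bounded_borel_powr[OF F(1), of p] F p by simp
  have "ennreal (measure lborel (ball z \<rho>) * ball_avg (\<lambda>y. F y powr p) z \<rho>)
      = (\<integral>\<^sup>+y. ennreal (F y powr p) * indicator (ball z \<rho>) y \<partial>lborel)"
    by (intro nn_integral_ball[symmetric] bb \<rho>) auto
  also have "\<dots> \<le> (\<integral>\<^sup>+y. ennreal (F y powr p) \<partial>lborel)"
    by (intro nn_integral_mono) (auto simp: indicator_def)
  also note le
  finally have "U * \<rho> ^ DIM('a) * ball_avg (\<lambda>y. F y powr p) z \<rho> \<le> a powr p"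
    using \<rho> by (simp add: content_ball U_def)
  then have "ball_avg (\<lambda>y. F y powr p) z \<rho> \<le> a powr p / (U * \<rho> powr real DIM('a))"
    using U \<rho> by (simp add: powr_realpow field_simps)
  then have "ball_avg (\<lambda>y. F y powr p) z \<rho> powr (1 / p) \<le> (a powr p / (U * \<rho> powr real DIM('a))) powr (1 / p)"
    using p by (intro powr_mono2 ball_avg_nonneg) auto
  also have "\<dots> = a * U powr (- (1 / p)) * \<rho> powr (- (real DIM('a) / p))"
    using U \<rho> a p by (simp add: powr_divide powr_mult powr_powr powr_minus field_simps)
  finally show ?thesis using ball_power_mean_mono[OF F t \<rho>, of z] by (simp add: U_def)
qed

text \<open>The maximal theorem for \<open>F powr t\<close> at the exponent \<open>p / t\<close>,
  which exceeds 1 since \<open>t < p\<close>. The factor \<open>2 ^ DIM('a)\<close> is included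
  because it appears when means over arbitrary radii are bounded by \<open>maximal\<close>.\<close>

lemma maximal_power_mean_bound:
  fixes t p :: real
  assumes t: "0 < t" "t < p"
  shows "\<exists>D>0. \<forall>(F::'a::euclidean_space \<Rightarrow> real) a. bounded_borel F \<longrightarrow> (\<forall>y. 0 \<le> F y) \<longrightarrow> 0 \<le> a \<longrightarrow>
    (\<integral>\<^sup>+y. ennreal (F y powr p) \<partial>lborel) \<le> ennreal (a powr p) \<longrightarrow>
    (\<integral>\<^sup>+z. ennreal (((2 ^ DIM('a) * maximal (\<lambda>y. F y powr t) z) powr (1 / t)) powr p) \<partial>lborel) \<le> ennreal ((D * a) powr p)"
proof -
  define \<tau> where "\<tau> = p / t"
  have \<tau>: "1 < \<tau>" using t by (simp add: \<tau>_def)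
  define K where "K = 6 ^ DIM('a) * 2 powr \<tau> * \<tau> / (\<tau> - 1)"
  have K: "0 < K" using \<tau> by (simp add: K_def)
  define B where "B = (2 ^ DIM('a)) powr \<tau> * K"
  have B: "0 < B" using K by (simp add: B_def)
  have p: "0 < p" using t by simp
  show ?thesis
  proof (intro exI[of _ "B powr (1 / p)"] conjI allI impI)
    fix F :: "'a \<Rightarrow> real" and a :: real
    assume F: "bounded_borel F" "\<forall>y. 0 \<le> F y" and a: "0 \<le> a"
      and le: "(\<integral>\<^sup>+y. ennreal (F y powr p) \<partial>lborel) \<le> ennreal (a powr p)"
    have bb: "bounded_borel (\<lambda>y. F y powr t)" using bounded_borel_powr[OF F(1), of t] F t by simp
    have M0: "0 \<le> maximal (\<lambda>y. F y powr t) z" for z by (intro maximal_nonneg bb) auto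
    have [measurable]: "maximal (\<lambda>y. F y powr t) \<in> borel_measurable borel" by (intro maximal_measurable bb)
    have "(\<integral>\<^sup>+z. ennreal (((2 ^ DIM('a) * maximal (\<lambda>y. F y powr t) z) powr (1 / t)) powr p) \<partial>lborel)
       = (\<integral>\<^sup>+z. ennreal ((2 ^ DIM('a)) powr \<tau>) * ennreal (maximal (\<lambda>y. F y powr t) z powr \<tau>) \<partial>lborel)"
      using M0 by (intro nn_integral_cong) (simp add: powr_powr powr_mult ennreal_mult[symmetric] \<tau>_def)
    also have "\<dots> = ennreal ((2 ^ DIM('a)) powr \<tau>) * (\<integral>\<^sup>+z. ennreal (maximal (\<lambda>y. F y powr t) z powr \<tau>) \<partial>lborel)"
      by (rule nn_integral_cmult) measurable
    also have "\<dots> \<le> ennreal ((2 ^ DIM('a)) powr \<tau>) * (ennreal K * (\<integral>\<^sup>+x. ennreal ((F x powr t) powr \<tau>) \<partial>lborel))"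
      unfolding K_def by (intro mult_left_mono maximal_strong_type bb \<tau>) auto
    also have "(\<integral>\<^sup>+x. ennreal ((F x powr t) powr \<tau>) \<partial>lborel) = (\<integral>\<^sup>+y. ennreal (F y powr p) \<partial>lborel)"
      using t by (simp add: powr_powr \<tau>_def)
    also have "ennreal ((2 ^ DIM('a)) powr \<tau>) * (ennreal K * (\<integral>\<^sup>+y. ennreal (F y powr p) \<partial>lborel))
       \<le> ennreal ((2 ^ DIM('a)) powr \<tau>) * (ennreal K * ennreal (a powr p))"
      by (intro mult_left_mono le) auto
    also have "\<dots> = ennreal ((B powr (1 / p) * a) powr p)"
      using K B p a by (simp add: ennreal_mult[symmetric] powr_mult powr_powr B_def)
    finally show "(\<integral>\<^sup>+z. ennreal (((2 ^ DIM('a) * maximal (\<lambda>y. F y powr t) z) powr (1 / t)) powr p) \<partial>lborel)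
      \<le> ennreal ((B powr (1 / p) * a) powr p)" .
  qed (use B in simp)
qed

text \<open>The conjugate exponent \<open>m / (m - 1)\<close> tends to 1, so a sufficiently high
  moment brings it below any \<open>w > 1\<close>; it is applied with
  \<open>w = min p q'\<close>.\<close>

lemma exists_conjugate_below:
  fixes w :: real
  assumes "1 < w"
  obtains m :: nat where "2 \<le> m" "real m / (real m - 1) < w"
proof -
  obtain m :: nat where m: "w / (w - 1) < real m" using reals_Archimedean2 by blast
  have "1 < w / (w - 1)" using assms by (simp add: field_simps)
  then have "1 < real m" using m by linarith
  then have "2 \<le> m" by simp
  moreover have "real m / (real m - 1) < w" using m assms \<open>1 < real m\<close> by (simp add: field_simps)
  ultimately show thesis by (rule that)
qed

lemma sobolev_exponents_gt_1:
  fixes s p q q' n :: real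
  assumes "0 < s" "0 < n" "1 < p" "p < n / s" "1 / q = 1 / p - s / n" "1 / q' + 1 / q = 1"
  shows "1 < q" "1 < q'"
proof -
  have "s * p < n" using assms(1,4) by (simp add: field_simps)
  then have "s / n < 1 / p" using assms(2,3) by (simp add: field_simps)
  then have q0: "0 < 1 / q" unfolding assms(5) by linarith
  have "1 / p < 1" using assms(3) by simp
  then have q1: "1 / q < 1" using assms(5) divide_pos_pos[OF assms(1,2)] by linarith
  show "1 < q" using q0 q1 by (simp add: field_simps split: if_splits)
  have "0 < 1 / q'" "1 / q' < 1" using assms(6) q0 q1 by linarith+
  then show "1 < q'" by (simp add: field_simps split: if_splits)
qed

text \<open>The two factors are treated asymmetrically: the means of \<open>G\<close> are bounded by
  a maximal function alone, those of \<open>F\<close> also by the decay in \<rho> that the L^p bound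
  forces. Hedberg's integral then leaves \<open>g1 z * f1 z powr (p / q)\<close>; as
  \<open>f1\<close> lies in L^p, its power lies in L^q, the dual of the space L^q' that contains
  \<open>g1\<close>.\<close>

lemma commutator_form_bound:
  fixes s p q q' :: real
  assumes s: "0 < s" "s < real DIM('a::euclidean_space)"
    and p: "1 < p" "p < real DIM('a) / s"
    and q: "1 / q = 1 / p - s / real DIM('a)" "1 / q' + 1 / q = 1"
  shows "\<exists>C>0. \<forall>(\<phi>::'a \<Rightarrow> real) N F G a b. continuous_on UNIV \<phi> \<longrightarrow> bounded_borel \<phi> \<longrightarrow>
    0 < N \<longrightarrow> mean_osc_le \<phi> N \<longrightarrow> bounded_borel F \<longrightarrow> (\<forall>y. 0 \<le> F y) \<longrightarrow> bounded_borel G \<longrightarrow> (\<forall>y. 0 \<le> G y) \<longrightarrow>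
    0 \<le> a \<longrightarrow> 0 \<le> b \<longrightarrow> (\<integral>\<^sup>+y. ennreal (F y powr p) \<partial>lborel) \<le> ennreal (a powr p) \<longrightarrow>
    (\<integral>\<^sup>+y. ennreal (G y powr q') \<partial>lborel) \<le> ennreal (b powr q') \<longrightarrow>
    (\<integral>\<^sup>+(u, v). ennreal (\<bar>\<phi> u - \<phi> v\<bar> * norm (u - v) powr (s - real DIM('a)) * F v * G u) \<partial>(lborel \<Otimes>\<^sub>M lborel))
      \<le> ennreal (C * N * a * b)"
proof -
  define n where "n = real DIM('a)"
  define U where "U = unit_ball_vol (real DIM('a))"
  have U: "0 < U" by (simp add: U_def)
  have n: "0 < n" by (simp add: n_def)
  have ns: "s < n" using s by (simp add: n_def)
  have sp: "s * p < n" using p s by (simp add: n_def field_simps)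
  note q1 = sobolev_exponents_gt_1(1)[OF s(1) n[unfolded n_def] p q]
  note q'1 = sobolev_exponents_gt_1(2)[OF s(1) n[unfolded n_def] p q]
  define \<nu> where "\<nu> = n / p"
  have \<nu>: "s < \<nu>" using sp p by (simp add: \<nu>_def field_simps)
  \<comment> \<open>The relation between \<open>p\<close> and \<open>q\<close> in the shape in which
    Hedberg's exponent fits Hoelder's inequality.\<close>
  have \<theta>: "1 - s / \<nu> = p / q"
  proof -
    have "p / q = p * (1 / q)" by simp
    also have "\<dots> = 1 - s / \<nu>" unfolding q(1) using p n by (simp add: \<nu>_def n_def[symmetric] field_simps)
    finally show ?thesis by simp
  qed
  obtain m :: nat where m: "2 \<le> m" "real m / (real m - 1) < min p q'"
    using exists_conjugate_below[of "min p q'"] p q'1 by auto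
  define k where "k = real m / (real m - 1)"
  have k: "1 < k" "k < p" "k < q'" using m by (auto simp: k_def field_simps)
  obtain C1 where C1: "0 < C1" and osc: "\<And>(\<phi>::'a \<Rightarrow> real) N F x r. continuous_on UNIV \<phi> \<Longrightarrow> bounded_borel \<phi> \<Longrightarrow>
    0 < N \<Longrightarrow> mean_osc_le \<phi> N \<Longrightarrow> bounded_borel F \<Longrightarrow> (\<forall>y. 0 \<le> F y) \<Longrightarrow> 0 < r \<Longrightarrow>
    ball_avg (\<lambda>y. \<bar>\<phi> y - ball_avg \<phi> x r\<bar> * F y) x r \<le> C1 * N * ball_avg (\<lambda>y. F y powr k) x r powr (1 / k)"
    using osc_avg_bound[OF m(1), where 'a='a] unfolding k_def[symmetric] by blast
  obtain D1 where D1: "0 < D1" and MF: "\<And>(F::'a \<Rightarrow> real) a. bounded_borel F \<Longrightarrow> (\<forall>y. 0 \<le> F y) \<Longrightarrow> 0 \<le> a \<Longrightarrow>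
    (\<integral>\<^sup>+y. ennreal (F y powr p) \<partial>lborel) \<le> ennreal (a powr p) \<Longrightarrow>
    (\<integral>\<^sup>+z. ennreal (((2 ^ DIM('a) * maximal (\<lambda>y. F y powr k) z) powr (1 / k)) powr p) \<partial>lborel) \<le> ennreal ((D1 * a) powr p)"
    using maximal_power_mean_bound[of k p, where 'a='a] k by auto
  obtain D2 where D2: "0 < D2" and MG: "\<And>(F::'a \<Rightarrow> real) a. bounded_borel F \<Longrightarrow> (\<forall>y. 0 \<le> F y) \<Longrightarrow> 0 \<le> a \<Longrightarrow>
    (\<integral>\<^sup>+y. ennreal (F y powr q') \<partial>lborel) \<le> ennreal (a powr q') \<Longrightarrow>
    (\<integral>\<^sup>+z. ennreal (((2 ^ DIM('a) * maximal (\<lambda>y. F y powr k) z) powr (1 / k)) powr q') \<partial>lborel) \<le> ennreal ((D2 * a) powr q')"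
    using maximal_power_mean_bound[of k q', where 'a='a] k by auto
  \<comment> \<open>The kernel constant, the squared volume constant of balls of radius
    \<open>2 * \<rho>\<close>, and the two oscillation terms with constant \<open>C1\<close>
    each.\<close>
  define c0 where "c0 = (n - s) / U * (U * 2 ^ DIM('a))\<^sup>2 * (2 * C1)"
  have c0: "0 < c0" using ns U C1 by (simp add: c0_def)
  define c2 where "c2 = 1 / s + 1 / (\<nu> - s)"
  have c2: "0 < c2" using s \<nu> by (simp add: c2_def add_pos_pos)
  define u0 where "u0 = U powr (- (1 / p))"
  have u0: "0 < u0" using U by (simp add: u0_def)
  define C where "C = c0 * c2 * u0 powr (s / \<nu>) * D2 * D1 powr (p / q)"
  have C: "0 < C" using c0 c2 u0 D1 D2 by (simp add: C_def)
  show ?thesis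
  proof (intro exI[of _ C] conjI allI impI)
    fix \<phi> F G :: "'a \<Rightarrow> real" and N a b :: real
    assume \<phi>: "continuous_on UNIV \<phi>" "bounded_borel \<phi>" and N: "0 < N" "mean_osc_le \<phi> N"
      and F: "bounded_borel F" "\<forall>y. 0 \<le> F y" and G: "bounded_borel G" "\<forall>y. 0 \<le> G y"
      and ab: "0 \<le> a" "0 \<le> b"
      and Fa: "(\<integral>\<^sup>+y. ennreal (F y powr p) \<partial>lborel) \<le> ennreal (a powr p)"
      and Gb: "(\<integral>\<^sup>+y. ennreal (G y powr q') \<partial>lborel) \<le> ennreal (b powr q')"
    have [measurable]: "\<phi> \<in> borel_measurable borel" "F \<in> borel_measurable borel" "G \<in> borel_measurable borel"
      using \<phi> F G by (auto simp: bounded_borel_measurable)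
    have F0: "0 \<le> F y" and G0: "0 \<le> G y" for y using F G by auto
    have bbk: "bounded_borel (\<lambda>y. F y powr k)" "bounded_borel (\<lambda>y. G y powr k)"
      using bounded_borel_powr[OF F(1), of k] bounded_borel_powr[OF G(1), of k] F G k by simp_all
    define AF where "AF z \<rho> = ball_avg (\<lambda>y. F y powr k) z \<rho> powr (1 / k)" for z \<rho>
    define AG where "AG z \<rho> = ball_avg (\<lambda>y. G y powr k) z \<rho> powr (1 / k)" for z \<rho>
    define f1 where "f1 z = (2 ^ DIM('a) * maximal (\<lambda>y. F y powr k) z) powr (1 / k)" for z
    define g1 where "g1 z = (2 ^ DIM('a) * maximal (\<lambda>y. G y powr k) z) powr (1 / k)" for z
    have [measurable]: "maximal (\<lambda>y. F y powr k) \<in> borel_measurable borel" "maximal (\<lambda>y. G y powr k) \<in> borel_measurable borel"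
      by (intro maximal_measurable bbk)+
    have [measurable]: "f1 \<in> borel_measurable borel" "g1 \<in> borel_measurable borel"
      unfolding f1_def g1_def by measurable
    have fg0: "0 \<le> f1 z" "0 \<le> g1 z" "0 \<le> AF z \<rho>" "0 \<le> AG z \<rho>" for z \<rho> by (auto simp: f1_def g1_def AF_def AG_def)
    define a' where "a' = a * u0"
    have a': "0 \<le> a'" using ab u0 by (simp add: a'_def)
    have AF1: "AF z \<rho> \<le> f1 z" and AG1: "AG z \<rho> \<le> g1 z" if "0 < \<rho>" for z \<rho>
      unfolding AF_def AG_def f1_def g1_def using k that
      by (auto intro!: powr_mono2 ball_avg_le_maximal bbk ball_avg_nonneg)
    have AF2: "AF z (2 * \<rho>) \<le> a' * \<rho> powr (- \<nu>)" if \<rho>: "0 < \<rho>" for z \<rho>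
    proof -
      have "AF z (2 * \<rho>) \<le> a * u0 * (2 * \<rho>) powr (- (real DIM('a) / p))"
        unfolding AF_def u0_def U_def using k \<rho> F by (intro ball_power_mean_le ab Fa) auto
      also have "\<dots> \<le> a' * \<rho> powr (- \<nu>)"
        unfolding a'_def \<nu>_def n_def using ab u0 \<rho> p by (intro mult_left_mono powr_mono2') auto
      finally show ?thesis .
    qed
    define \<Phi> where "\<Phi> = (\<lambda>(u, v). ennreal (\<bar>\<phi> u - \<phi> v\<bar> * F v * G u))"
    define co where "co \<rho> = ennreal ((n - s) / U * \<rho> powr (s - 2 * n - 1)) * indicator {0<..} \<rho>" for \<rho> :: real
    \<comment> \<open>The indicators of \<open>ball z (2 * \<rho>)\<close> as comparisons: the ball
      moves with the integration variables, and exchanging integrals requires measurability in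
      \<open>u\<close>, \<open>v\<close>, \<open>z\<close> and \<rho> jointly.\<close>
    define I where "I = (\<lambda>(u::'a, v) (z::'a, \<rho>). (if dist z u < 2 * \<rho> then 1 else 0) * (if dist z v < 2 * \<rho> then 1 else 0) :: ennreal)"
    have I_eq: "I (u, v) (z, \<rho>) = indicator (ball z (2 * \<rho>)) u * indicator (ball z (2 * \<rho>)) v" for u v z \<rho>
      by (simp add: I_def indicator_def)
    have [measurable]: "\<Phi> \<in> borel_measurable (borel \<Otimes>\<^sub>M borel)"
      unfolding \<Phi>_def by measurable
    have [measurable]: "co \<in> borel_measurable borel" unfolding co_def by measurable
    have Im: "(\<lambda>(e, w). \<Phi> e * (co (snd w) * I e w)) \<in> borel_measurable (borel \<Otimes>\<^sub>M borel)"
      unfolding I_def split_def borel_prod[symmetric] by measurable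
    have inner: "(\<integral>\<^sup>+e. \<Phi> e * (co \<rho> * I e (z, \<rho>)) \<partial>lborel)
        \<le> ennreal (c0 * N * g1 z) * (ennreal (\<rho> powr (s - 1) * min (f1 z) (a' * \<rho> powr (- \<nu>))) * indicator {0<..} \<rho>)" for z \<rho>
    proof (cases "0 < \<rho>")
      case True
      define V where "V = measure lborel (ball z (2 * \<rho>))"
      have V: "V = U * 2 ^ DIM('a) * \<rho> ^ DIM('a)"
        unfolding V_def U_def using True by (simp add: content_ball power_mult_distrib)
      have "(\<integral>\<^sup>+e. \<Phi> e * (co \<rho> * I e (z, \<rho>)) \<partial>lborel) = (\<integral>\<^sup>+e. co \<rho> * (\<Phi> e * I e (z, \<rho>)) \<partial>lborel)"
        by (simp add: mult_ac)
      also have "\<dots> = co \<rho> * (\<integral>\<^sup>+e. \<Phi> e * I e (z, \<rho>) \<partial>lborel)"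
        by (rule nn_integral_cmult) (simp add: I_def split_def borel_prod[symmetric], measurable)
      also have "(\<integral>\<^sup>+e. \<Phi> e * I e (z, \<rho>) \<partial>lborel)
         = (\<integral>\<^sup>+(u, v). ennreal (\<bar>\<phi> u - \<phi> v\<bar> * F v * G u) * (indicator (ball z (2 * \<rho>)) u * indicator (ball z (2 * \<rho>)) v) \<partial>(lborel \<Otimes>\<^sub>M lborel))"
        unfolding lborel_prod by (intro nn_integral_cong) (simp add: \<Phi>_def split_def I_eq[symmetric])
      also have "\<dots> \<le> ennreal (V\<^sup>2 * ((C1 * N * AG z (2 * \<rho>)) * AF z (2 * \<rho>) + AG z (2 * \<rho>) * (C1 * N * AF z (2 * \<rho>))))"
        unfolding V_def AF_def AG_def using True k
        by (intro ball_double_osc_bound osc ball_Jensen \<phi> N F G F0 G0) auto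
      also have "co \<rho> * ennreal (V\<^sup>2 * ((C1 * N * AG z (2 * \<rho>)) * AF z (2 * \<rho>) + AG z (2 * \<rho>) * (C1 * N * AF z (2 * \<rho>))))
          = ennreal (c0 * N * AG z (2 * \<rho>) * (\<rho> powr (s - 1) * AF z (2 * \<rho>)))"
      proof -
        \<comment> \<open>The two ball volumes cancel the power \<open>- 2 * n\<close> of the kernel
          decomposition, leaving exactly the weight of Hedberg's integral.\<close>
        have e: "\<rho> powr (s - 2 * n - 1) * (\<rho> ^ DIM('a))\<^sup>2 = \<rho> powr (s - 1)"
        proof -
          have "(\<rho> ^ DIM('a))\<^sup>2 = \<rho> powr (2 * n)"
            using True by (simp add: n_def powr_realpow[symmetric] powr_powr power2_eq_square powr_add[symmetric])
          then show ?thesis by (simp add: powr_add[symmetric])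
        qed
        have "co \<rho> * ennreal (V\<^sup>2 * ((C1 * N * AG z (2 * \<rho>)) * AF z (2 * \<rho>) + AG z (2 * \<rho>) * (C1 * N * AF z (2 * \<rho>))))
          = ennreal ((n - s) / U * \<rho> powr (s - 2 * n - 1) * (V\<^sup>2 * ((C1 * N * AG z (2 * \<rho>)) * AF z (2 * \<rho>) + AG z (2 * \<rho>) * (C1 * N * AF z (2 * \<rho>)))))"
          unfolding co_def using True U ns C1 N fg0 by (simp add: ennreal_mult[symmetric])
        also have "(n - s) / U * \<rho> powr (s - 2 * n - 1) * (V\<^sup>2 * ((C1 * N * AG z (2 * \<rho>)) * AF z (2 * \<rho>) + AG z (2 * \<rho>) * (C1 * N * AF z (2 * \<rho>))))
          = c0 * N * AG z (2 * \<rho>) * ((\<rho> powr (s - 2 * n - 1) * (\<rho> ^ DIM('a))\<^sup>2) * AF z (2 * \<rho>))"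
          by (simp add: V c0_def power_mult_distrib algebra_simps)
        finally show ?thesis by (simp only: e)
      qed
      also have "\<dots> \<le> ennreal (c0 * N * g1 z * (\<rho> powr (s - 1) * min (f1 z) (a' * \<rho> powr (- \<nu>))))"
        using AF1[of "2 * \<rho>" z] AF2[OF True, of z] AG1[of "2 * \<rho>" z] True fg0 c0 N a'
        by (intro ennreal_leI mult_mono) auto
      also have "\<dots> = ennreal (c0 * N * g1 z) * (ennreal (\<rho> powr (s - 1) * min (f1 z) (a' * \<rho> powr (- \<nu>))) * indicator {0<..} \<rho>)"
        using True fg0[of z] c0 N a' by (simp add: ennreal_mult[symmetric])
      finally show ?thesis by (simp add: mult_left_mono)
    qed (simp add: co_def)
    have "(\<integral>\<^sup>+(u, v). ennreal (\<bar>\<phi> u - \<phi> v\<bar> * norm (u - v) powr (s - real DIM('a)) * F v * G u) \<partial>(lborel \<Otimes>\<^sub>M lborel))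
       \<le> (\<integral>\<^sup>+e. \<integral>\<^sup>+w. \<Phi> e * (co (snd w) * I e w) \<partial>lborel \<partial>lborel)"
      unfolding lborel_prod
    proof (rule nn_integral_mono)
      fix e :: "'a \<times> 'a"
      obtain u v where e: "e = (u, v)" by (cases e)
      have "ennreal (norm (u - v) powr (s - real DIM('a))) \<le> (\<integral>\<^sup>+w. co (snd w) * I e w \<partial>lborel)"
        using riesz_kernel_le_balls[OF s(2), of u v] unfolding lborel_prod
        by (simp add: co_def I_eq e n_def U_def split_def I_def indicator_def of_bool_def)
      then have "\<Phi> e * ennreal (norm (u - v) powr (s - real DIM('a))) \<le> \<Phi> e * (\<integral>\<^sup>+w. co (snd w) * I e w \<partial>lborel)"
        by (rule mult_left_mono) simp
      also have "\<dots> = (\<integral>\<^sup>+w. \<Phi> e * (co (snd w) * I e w) \<partial>lborel)"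
        by (rule nn_integral_cmult[symmetric]) (simp add: I_def split_def borel_prod[symmetric], measurable)
      also have "\<Phi> e * ennreal (norm (u - v) powr (s - real DIM('a)))
          = ennreal (\<bar>\<phi> u - \<phi> v\<bar> * norm (u - v) powr (s - real DIM('a)) * F v * G u)"
        using F0 G0 by (simp add: \<Phi>_def e ennreal_mult[symmetric] mult_ac)
      finally show "(case e of (u, v) \<Rightarrow> ennreal (\<bar>\<phi> u - \<phi> v\<bar> * norm (u - v) powr (s - real DIM('a)) * F v * G u))
         \<le> (\<integral>\<^sup>+w. \<Phi> e * (co (snd w) * I e w) \<partial>lborel)" by (simp add: e)
    qed
    \<comment> \<open>Pairs of points and balls are exchanged, so that \<open>inner\<close> can be
      applied on one ball at a time.\<close>
    also have "\<dots> = (\<integral>\<^sup>+w. \<integral>\<^sup>+e. \<Phi> e * (co (snd w) * I e w) \<partial>lborel \<partial>lborel)"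
      by (rule lborel_pair.Fubini'[symmetric]) (use Im in simp)
    also have "\<dots> \<le> (\<integral>\<^sup>+(z, \<rho>). ennreal (c0 * N * g1 z) * (ennreal (\<rho> powr (s - 1) * min (f1 z) (a' * \<rho> powr (- \<nu>))) * indicator {0<..} \<rho>) \<partial>(lborel \<Otimes>\<^sub>M lborel))"
      unfolding lborel_prod using inner by (intro nn_integral_mono) (auto simp: split_def)
    also have "\<dots> = (\<integral>\<^sup>+z. \<integral>\<^sup>+\<rho>. ennreal (c0 * N * g1 z) * (ennreal (\<rho> powr (s - 1) * min (f1 z) (a' * \<rho> powr (- \<nu>))) * indicator {0<..} \<rho>) \<partial>lborel \<partial>lborel)"
    proof -
      have "(\<lambda>(z, \<rho>). ennreal (c0 * N * g1 z) * (ennreal (\<rho> powr (s - 1) * min (f1 z) (a' * \<rho> powr (- \<nu>))) * indicator {0<..} \<rho>)) \<in> borel_measurable (lborel \<Otimes>\<^sub>M lborel)"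
        by measurable
      from lborel.nn_integral_fst[OF this] show ?thesis by simp
    qed
    also have "\<dots> \<le> (\<integral>\<^sup>+z. ennreal (c0 * N * c2 * a' powr (s / \<nu>)) * ennreal (g1 z * f1 z powr (p / q)) \<partial>lborel)"
    proof (rule nn_integral_mono)
      fix z
      have "(\<integral>\<^sup>+\<rho>. ennreal (c0 * N * g1 z) * (ennreal (\<rho> powr (s - 1) * min (f1 z) (a' * \<rho> powr (- \<nu>))) * indicator {0<..} \<rho>) \<partial>lborel)
         = ennreal (c0 * N * g1 z) * (\<integral>\<^sup>+\<rho>. (ennreal (\<rho> powr (s - 1) * min (f1 z) (a' * \<rho> powr (- \<nu>))) * indicator {0<..} \<rho>) \<partial>lborel)"
        by (rule nn_integral_cmult) measurable
      also have "\<dots> \<le> ennreal (c0 * N * g1 z) * ennreal (c2 * (f1 z powr (1 - s / \<nu>) * a' powr (s / \<nu>)))"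
        unfolding c2_def by (intro mult_left_mono Hedberg_integral fg0 a' s \<nu>) auto
      also have "\<dots> = ennreal (c0 * N * c2 * a' powr (s / \<nu>)) * ennreal (g1 z * f1 z powr (p / q))"
        unfolding \<theta> using c0 c2 N fg0[of z] by (simp add: ennreal_mult[symmetric] mult_ac)
      finally show "(\<integral>\<^sup>+\<rho>. ennreal (c0 * N * g1 z) * (ennreal (\<rho> powr (s - 1) * min (f1 z) (a' * \<rho> powr (- \<nu>))) * indicator {0<..} \<rho>) \<partial>lborel)
        \<le> ennreal (c0 * N * c2 * a' powr (s / \<nu>)) * ennreal (g1 z * f1 z powr (p / q))" .
    qed
    also have "\<dots> = ennreal (c0 * N * c2 * a' powr (s / \<nu>)) * (\<integral>\<^sup>+z. ennreal (g1 z * f1 z powr (p / q)) \<partial>lborel)"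
      by (rule nn_integral_cmult) measurable
    also have "\<dots> \<le> ennreal (c0 * N * c2 * a' powr (s / \<nu>)) * ennreal ((D2 * b) * (D1 * a) powr (p / q))"
    proof (intro mult_left_mono Holder_nn_integral[OF _ _ _ _ q'1 q1 q(2)])
      show "(\<integral>\<^sup>+z. ennreal (g1 z powr q') \<partial>lborel) \<le> ennreal ((D2 * b) powr q')"
        unfolding g1_def by (intro MG G ab Gb)
      have "(\<integral>\<^sup>+z. ennreal ((f1 z powr (p / q)) powr q) \<partial>lborel) = (\<integral>\<^sup>+z. ennreal (f1 z powr p) \<partial>lborel)"
        using q1 by (simp add: powr_powr)
      also have "\<dots> \<le> ennreal ((D1 * a) powr p)" unfolding f1_def by (intro MF F ab Fa)
      also have "\<dots> = ennreal (((D1 * a) powr (p / q)) powr q)" using q1 by (simp add: powr_powr)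
      finally show "(\<integral>\<^sup>+z. ennreal ((f1 z powr (p / q)) powr q) \<partial>lborel) \<le> ennreal (((D1 * a) powr (p / q)) powr q)" .
    qed (use fg0 D1 D2 ab in auto)
    also have "\<dots> = ennreal (C * N * a * b)"
    proof -
      \<comment> \<open>The power of \<open>a\<close> from the decay bound and the one from the
        maximal function recombine to the first power, because
        \<open>s / \<nu> + p / q = 1\<close>.\<close>
      have e1: "a powr (s / \<nu>) * a powr (p / q) = a" using ab \<theta> by (simp add: powr_add[symmetric] flip: \<theta>)
      have e2: "c0 * N * c2 * a' powr (s / \<nu>) * ((D2 * b) * (D1 * a) powr (p / q)) = C * N * (a powr (s / \<nu>) * a powr (p / q)) * b"
        using ab u0 D1 by (simp add: C_def a'_def powr_mult mult_ac)
      show ?thesis unfolding e2[unfolded e1, symmetric] using c0 N c2 D2 ab by (intro ennreal_mult[symmetric]) auto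
    qed
    finally show "(\<integral>\<^sup>+(u, v). ennreal (\<bar>\<phi> u - \<phi> v\<bar> * norm (u - v) powr (s - real DIM('a)) * F v * G u) \<partial>(lborel \<Otimes>\<^sub>M lborel))
      \<le> ennreal (C * N * a * b)" .
  qed (rule C)
qed

section \<open>Fourier transforms of test functions\<close>

definition dir_deriv :: "'a::euclidean_space \<Rightarrow> ('a \<Rightarrow> real) \<Rightarrow> 'a \<Rightarrow> real" where
  "dir_deriv v f x = frechet_derivative f (at x) v"

lemma smooth_fun_differentiable: "smooth_fun f \<Longrightarrow> f differentiable at x"
  by (auto simp: smooth_fun_def)

lemma smooth_fun_dir_deriv: "smooth_fun f \<Longrightarrow> smooth_fun (dir_deriv v f)"
  unfolding smooth_fun_def dir_deriv_def[abs_def] by blast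

text \<open>By the Leibniz rule the sums of products of two derivative-closed classes form a derivative-closed
  class, which is what \<^const>\<open>smooth_fun\<close> asks for.\<close>

inductive_set sums_of_products :: "('a::euclidean_space \<Rightarrow> real) set \<Rightarrow> ('a \<Rightarrow> real) set \<Rightarrow> ('a \<Rightarrow> real) set"
  for A B where
  prod: "f \<in> A \<Longrightarrow> g \<in> B \<Longrightarrow> (\<lambda>x. f x * g x) \<in> sums_of_products A B"
| add: "f \<in> sums_of_products A B \<Longrightarrow> g \<in> sums_of_products A B \<Longrightarrow> (\<lambda>x. f x + g x) \<in> sums_of_products A B"

lemma smooth_fun_mult:
  fixes f g :: "'a::euclidean_space \<Rightarrow> real"
  assumes "smooth_fun f" "smooth_fun g" shows "smooth_fun (\<lambda>x. f x * g x)"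
proof -
  obtain A where A: "f \<in> A" "\<And>h x. h \<in> A \<Longrightarrow> h differentiable at x"
      "\<And>h v. h \<in> A \<Longrightarrow> (\<lambda>x. frechet_derivative h (at x) v) \<in> A"
    using assms(1) unfolding smooth_fun_def by blast
  obtain B where B: "g \<in> B" "\<And>h x. h \<in> B \<Longrightarrow> h differentiable at x"
      "\<And>h v. h \<in> B \<Longrightarrow> (\<lambda>x. frechet_derivative h (at x) v) \<in> B"
    using assms(2) unfolding smooth_fun_def by blast
  have "(\<forall>x. h differentiable at x) \<and> (\<forall>v. (\<lambda>x. frechet_derivative h (at x) v) \<in> sums_of_products A B)"
    if "h \<in> sums_of_products A B" for h
    using that
  proof induction
    case (prod f g)
    have d: "((\<lambda>x. f x * g x) has_derivative
        (\<lambda>v. f x * frechet_derivative g (at x) v + frechet_derivative f (at x) v * g x)) (at x)" for x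
      using A(2)[OF prod(1)] B(2)[OF prod(2)] by (intro has_derivative_mult) (auto simp: frechet_derivative_works)
    have "frechet_derivative (\<lambda>x. f x * g x) (at x)
        = (\<lambda>v. f x * frechet_derivative g (at x) v + frechet_derivative f (at x) v * g x)" for x
      using frechet_derivative_at[OF d] by simp
    then show ?case using d prod A(3) B(3)
      by (auto simp: differentiable_def intro!: sums_of_products.intros)
  next
    case (add f g)
    have d: "((\<lambda>x. f x + g x) has_derivative
        (\<lambda>v. frechet_derivative f (at x) v + frechet_derivative g (at x) v)) (at x)" for x
      using add.IH by (intro has_derivative_add) (auto simp: frechet_derivative_works)
    have "frechet_derivative (\<lambda>x. f x + g x) (at x)
        = (\<lambda>v. frechet_derivative f (at x) v + frechet_derivative g (at x) v)" for x
      using frechet_derivative_at[OF d] by simp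
    then show ?case using d add.IH by (auto simp: differentiable_def intro!: sums_of_products.add)
  qed
  then show ?thesis unfolding smooth_fun_def
    using A(1) B(1) by (intro exI[of _ "sums_of_products A B"]) (auto intro: sums_of_products.prod)
qed

lemma Cc_inf_mult:
  assumes "f \<in> Cc_inf" "g \<in> Cc_inf" shows "(\<lambda>x. f x * g x) \<in> Cc_inf"
proof -
  have "bounded {x. f x \<noteq> 0}" using assms by (auto simp: Cc_inf_def compact_support_def compact_closure)
  then have "bounded {x. f x * g x \<noteq> 0}" by (rule bounded_subset) auto
  then show ?thesis using assms by (auto simp: Cc_inf_def compact_support_def compact_closure smooth_fun_mult)
qed

lemma Cc_inf_dir_deriv:
  assumes "f \<in> Cc_inf" shows "dir_deriv v f \<in> Cc_inf"
proof -
  have "dir_deriv v f x = 0" if "x \<notin> closure {x. f x \<noteq> 0}" for x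
  proof -
    have "open (- closure {x. f x \<noteq> 0})" by (intro open_Compl closed_closure)
    then have "(f has_derivative (\<lambda>_. 0)) (at x)"
      using that closure_subset[of "{x. f x \<noteq> 0}"]
      by (intro has_derivative_transform_within_open[OF has_derivative_const[of 0]]) auto
    then have "frechet_derivative f (at x) = (\<lambda>_. 0)" by (rule frechet_derivative_at[symmetric])
    then show ?thesis by (simp add: dir_deriv_def)
  qed
  then have "{x. dir_deriv v f x \<noteq> 0} \<subseteq> closure {x. f x \<noteq> 0}" by auto
  moreover have "bounded (closure {x. f x \<noteq> 0})"
    using assms by (auto simp: Cc_inf_def compact_support_def compact_imp_bounded)
  ultimately have "bounded {x. dir_deriv v f x \<noteq> 0}" by (metis bounded_subset)
  then show ?thesis using assms by (auto simp: Cc_inf_def compact_support_def compact_closure smooth_fun_dir_deriv)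
qed

lemma Cc_inf_continuous: "f \<in> Cc_inf \<Longrightarrow> continuous_on A f"
  by (auto simp: Cc_inf_def smooth_fun_differentiable differentiable_imp_continuous_within
      intro!: continuous_at_imp_continuous_on)

lemma Cc_inf_measurable: "f \<in> Cc_inf \<Longrightarrow> f \<in> borel_measurable borel"
  by (intro borel_measurable_continuous_onI Cc_inf_continuous)

lemma Cc_inf_support:
  fixes f :: "'a::euclidean_space \<Rightarrow> real"
  assumes "f \<in> Cc_inf" obtains R where "0 < R" "\<And>x. R \<le> norm x \<Longrightarrow> f x = 0"
proof -
  have "bounded {x. f x \<noteq> 0}" using assms by (auto simp: Cc_inf_def compact_support_def compact_closure)
  then obtain R where R: "0 < R" "\<And>x. f x \<noteq> 0 \<Longrightarrow> norm x < R" unfolding bounded_pos_less by auto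
  then show thesis by (intro that[of R]) (auto simp: not_less[symmetric])
qed

lemma Cc_inf_bounded_borel:
  fixes f :: "'a::euclidean_space \<Rightarrow> real"
  assumes "f \<in> Cc_inf" shows "bounded_borel f"
proof -
  obtain R where R: "0 < R" "\<And>x. R \<le> norm x \<Longrightarrow> f x = 0" using Cc_inf_support[OF assms] by blast
  have "compact (f ` cball 0 R)" by (intro compact_continuous_image Cc_inf_continuous assms compact_cball)
  then have "bounded (f ` cball 0 R)" by (rule compact_imp_bounded)
  then obtain K where K0: "0 < K" and K: "\<forall>y\<in>f ` cball 0 R. norm y \<le> K" unfolding bounded_pos by blast
  have "\<bar>f x\<bar> \<le> K" for x
  proof (cases "norm x \<le> R")
    case True
    then have "f x \<in> f ` cball 0 R" by simp
    then show ?thesis using K by fastforce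
  qed (use R(2)[of x] K0 in simp)
  then show ?thesis using assms by (intro bounded_borelI Cc_inf_measurable)
qed

lemma Cc_inf_integrable:
  fixes f :: "'a::euclidean_space \<Rightarrow> real"
  assumes "f \<in> Cc_inf" shows "integrable lborel f"
proof -
  obtain R where R: "0 < R" "\<And>x. R \<le> norm x \<Longrightarrow> f x = 0" using Cc_inf_support[OF assms] by blast
  have "integrable lborel (\<lambda>x. indicator (cball 0 R) x *\<^sub>R f x)"
    by (intro borel_integrable_compact Cc_inf_continuous assms compact_cball)
  also have "(\<lambda>x. indicator (cball 0 R) x *\<^sub>R f x) = f" using R by (auto simp: indicator_def fun_eq_iff)
  finally show ?thesis .
qed

text \<open>Directional derivatives are again test functions and hence bounded. The sum of these
  bounds over the basis bounds the operator norm of the derivative, and the mean value inequality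
  applies.\<close>

lemma Cc_inf_Lipschitz:
  fixes f :: "'a::euclidean_space \<Rightarrow> real"
  assumes f: "f \<in> Cc_inf" obtains L where "0 \<le> L" "\<And>x y. \<bar>f x - f y\<bar> \<le> L * norm (x - y)"
proof -
  have "\<exists>K. \<forall>x. \<bar>dir_deriv b f x\<bar> \<le> K" for b
    using Cc_inf_bounded_borel[OF Cc_inf_dir_deriv[OF f]] by (auto simp: bounded_borel_def)
  then obtain K where K: "\<And>b x. \<bar>dir_deriv b f x\<bar> \<le> K b" by metis
  define L where "L = (\<Sum>b\<in>Basis. K b)"
  have K0: "0 \<le> K b" for b using K[of b 0] by (rule order_trans[OF abs_ge_zero])
  have L0: "0 \<le> L" unfolding L_def by (intro sum_nonneg K0)
  have d: "(f has_derivative frechet_derivative f (at x)) (at x)" for x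
    using f by (auto simp: Cc_inf_def smooth_fun_differentiable frechet_derivative_works[symmetric])
  have on: "onorm (frechet_derivative f (at x)) \<le> L" for x
  proof (rule onorm_le)
    fix v
    have lin: "linear (frechet_derivative f (at x))" using d by (intro has_derivative_linear)
    have "norm (frechet_derivative f (at x) v) = norm (\<Sum>b\<in>Basis. (v \<bullet> b) * dir_deriv b f x)"
      unfolding dir_deriv_def
      by (subst euclidean_representation[of v, symmetric], subst linear_sum[OF lin])
         (simp add: linear_cmul[OF lin])
    also have "\<dots> \<le> (\<Sum>b\<in>Basis. norm v * K b)"
      by (intro order_trans[OF norm_sum] sum_mono)
         (auto simp: abs_mult intro!: mult_mono K Basis_le_norm)
    finally show "norm (frechet_derivative f (at x) v) \<le> L * norm v"
      by (simp add: L_def sum_distrib_left mult.commute)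
  qed
  have "norm (f x - f y) \<le> L * norm (x - y)" for x y
    using d on by (intro differentiable_bound[of UNIV f "\<lambda>x. frechet_derivative f (at x)"]) auto
  then show thesis using L0 by (intro that) auto
qed

section \<open>Translation and reflection of integrals\<close>

lemma lborel_integral_translate:
  fixes g :: "'a::euclidean_space \<Rightarrow> 'b::{banach,second_countable_topology}"
  assumes [measurable]: "g \<in> borel_measurable borel"
  shows "(\<integral>x. g (x + c) \<partial>lborel) = (\<integral>x. g x \<partial>lborel)"
  by (subst (2) lborel_distr_plus[of c, symmetric]) (simp add: integral_distr add.commute)

lemma lborel_nn_integral_affine:
  fixes g :: "'a::euclidean_space \<Rightarrow> ennreal"
  assumes [measurable]: "g \<in> borel_measurable borel"
  shows "(\<integral>\<^sup>+x. g (c - x) \<partial>lborel) = (\<integral>\<^sup>+x. g x \<partial>lborel)" "(\<integral>\<^sup>+x. g (x - c) \<partial>lborel) = (\<integral>\<^sup>+x. g x \<partial>lborel)"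
proof -
  show "(\<integral>\<^sup>+x. g (c - x) \<partial>lborel) = (\<integral>\<^sup>+x. g x \<partial>lborel)"
    by (subst (2) lborel_affine[of "-1" c]) (auto simp: nn_integral_density nn_integral_distr)
  show "(\<integral>\<^sup>+x. g (x - c) \<partial>lborel) = (\<integral>\<^sup>+x. g x \<partial>lborel)"
    by (subst (2) lborel_affine[of "1" "- c"]) (auto simp: nn_integral_density nn_integral_distr)
qed

lemma lborel_integral_reflect:
  fixes g :: "'a::euclidean_space \<Rightarrow> 'b::{banach,second_countable_topology}"
  assumes [measurable]: "g \<in> borel_measurable borel"
  shows "(\<integral>x. g (c - x) \<partial>lborel) = (\<integral>x. g x \<partial>lborel)"
  by (subst (2) lborel_affine[of "-1" c]) (auto simp: density_1 integral_distr)

text \<open>The difference is at most \<open>L * norm z\<close> and vanishes outside two balls of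
  fixed radius \<open>R\<close>, one of them translated by \<open>z\<close>; the measure of their
  union is bounded independently of \<open>z\<close>.\<close>

lemma Cc_inf_L1_translate:
  fixes f :: "'a::euclidean_space \<Rightarrow> real"
  assumes f: "f \<in> Cc_inf"
  obtains C where "0 \<le> C" "\<And>z. (\<integral>\<^sup>+x. ennreal \<bar>f (x - z) - f x\<bar> \<partial>lborel) \<le> ennreal (C * norm z)"
proof -
  have [measurable]: "f \<in> borel_measurable borel" using f by (rule Cc_inf_measurable)
  obtain R where R: "0 < R" "\<And>x. R \<le> norm x \<Longrightarrow> f x = 0" using Cc_inf_support[OF f] by blast
  obtain L where L: "0 \<le> L" "\<And>x y. \<bar>f x - f y\<bar> \<le> L * norm (x - y)" using Cc_inf_Lipschitz[OF f] by blast
  define V where "V = measure lborel (ball (0::'a) R)"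
  have V0: "0 \<le> V" by (simp add: V_def)
  have em: "emeasure lborel (ball (0::'a) R) = ennreal V"
    unfolding V_def using emeasure_bounded_finite[OF bounded_ball, of 0 R]
    by (intro emeasure_eq_ennreal_measure) (auto simp: less_top)
  show thesis
  proof (rule that[of "L * (2 * V)"])
    fix z :: 'a
    have "(\<integral>\<^sup>+x. ennreal \<bar>f (x - z) - f x\<bar> \<partial>lborel)
       \<le> (\<integral>\<^sup>+x. ennreal (L * norm z) * (indicator (ball 0 R) (x - z) + indicator (ball 0 R) x) \<partial>lborel)"
    proof (rule nn_integral_mono)
      fix x :: 'a
      have le: "\<bar>f (x - z) - f x\<bar> \<le> L * norm z" using L(2)[of "x - z" x] by simp
      consider "norm (x - z) < R" | "norm x < R" | "R \<le> norm (x - z)" "R \<le> norm x" by linarith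
      then show "ennreal \<bar>f (x - z) - f x\<bar> \<le> ennreal (L * norm z) * (indicator (ball 0 R) (x - z) + indicator (ball 0 R) x)"
      proof cases
        case 1
        have "ennreal (L * norm z) * 1 \<le> ennreal (L * norm z) * (indicator (ball 0 R) (x - z) + indicator (ball 0 R) x)"
          using 1 by (intro mult_left_mono) (auto simp: indicator_def)
        then show ?thesis using le by (auto intro: order_trans[OF ennreal_leI])
      next
        case 2
        have "ennreal (L * norm z) * 1 \<le> ennreal (L * norm z) * (indicator (ball 0 R) (x - z) + indicator (ball 0 R) x)"
          using 2 by (intro mult_left_mono) (auto simp: indicator_def)
        then show ?thesis using le by (auto intro: order_trans[OF ennreal_leI])
      qed (use R in auto)
    qed
    also have "\<dots> = ennreal (L * norm z) * ((\<integral>\<^sup>+x. indicator (ball 0 R) (x - z) \<partial>lborel) + (\<integral>\<^sup>+x. indicator (ball 0 R) (x::'a) \<partial>lborel))"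
    proof -
      have [measurable]: "(\<lambda>x. indicator (ball 0 R) (x - z) :: ennreal) \<in> borel_measurable borel"
        by (simp only: indicator_def of_bool_def mem_ball) measurable
      have m2 [measurable]: "(indicator (ball 0 R) :: 'a \<Rightarrow> ennreal) \<in> borel_measurable borel"
        by (intro borel_measurable_indicator) simp
      have "(\<lambda>x. indicator (ball 0 R) (x - z) + indicator (ball 0 R) x :: ennreal) \<in> borel_measurable borel"
        by measurable
      then show ?thesis by (subst nn_integral_cmult) (simp_all add: nn_integral_add)
    qed
    also have "(\<integral>\<^sup>+x. indicator (ball 0 R) (x - z) \<partial>lborel) = ennreal V"
      using lborel_nn_integral_affine(2)[OF borel_measurable_indicator, of "ball 0 R" z] em by simp
    also have "(\<integral>\<^sup>+x. indicator (ball 0 R) (x::'a) \<partial>lborel) = ennreal V" using em by simp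
    also have "ennreal (L * norm z) * (ennreal V + ennreal V) = ennreal (L * (2 * V) * norm z)"
      using L V0 by (simp add: ennreal_mult[symmetric] ennreal_plus[symmetric] algebra_simps del: ennreal_plus)
    finally show "(\<integral>\<^sup>+x. ennreal \<bar>f (x - z) - f x\<bar> \<partial>lborel) \<le> ennreal (L * (2 * V) * norm z)" .
  qed (use L V0 in auto)
qed

section \<open>Fourier transform of derivatives, and decay\<close>

abbreviation (input) rfourier :: "('a::euclidean_space \<Rightarrow> real) \<Rightarrow> 'a \<Rightarrow> complex" where
  "rfourier f \<equiv> fourier (\<lambda>x. complex_of_real (f x))"

lemma cis_measurable [measurable (raw)]:
  "f \<in> borel_measurable M \<Longrightarrow> (\<lambda>x. cis (f x)) \<in> borel_measurable M"
  by (rule measurable_compose[of f M borel]) (auto intro!: borel_measurable_continuous_onI continuous_intros)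

lemma cis_mult_integrable:
  fixes g :: "'a::euclidean_space \<Rightarrow> complex"
  assumes "integrable lborel g" and [measurable]: "h \<in> borel_measurable borel"
  shows "integrable lborel (\<lambda>x. g x * cis (h x))"
proof -
  have [measurable]: "g \<in> borel_measurable borel" using borel_measurable_integrable[OF assms(1)] by simp
  show ?thesis using assms(1) by (rule Bochner_Integration.integrable_bound) (auto simp: norm_mult)
qed

lemma fourier_measurable:
  fixes g :: "'a::euclidean_space \<Rightarrow> complex"
  assumes [measurable]: "g \<in> borel_measurable borel"
  shows "fourier g \<in> borel_measurable borel"
  unfolding fourier_def[abs_def] by measurable

lemma cmod_fourier_le:
  fixes g :: "'a::euclidean_space \<Rightarrow> complex"
  shows "cmod (fourier g \<xi>) \<le> (\<integral>x. cmod (g x) \<partial>lborel)"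
  unfolding fourier_def by (rule order_trans[OF integral_norm_bound]) (simp add: norm_mult)

lemma cis_difference_quotient:
  "(\<lambda>k. of_nat (Suc k) * (cis (a / real (Suc k)) - 1)) \<longlonglongrightarrow> \<i> * complex_of_real a"
proof -
  have "((\<lambda>z. exp (\<i> * of_real a * z)) has_field_derivative \<i> * of_real a) (at 0)"
    by (auto intro!: derivative_eq_intros)
  then have "((\<lambda>h. (exp (\<i> * of_real a * (0 + h)) - exp (\<i> * of_real a * 0)) / h) \<longlongrightarrow> \<i> * of_real a) (at 0)"
    by (simp only: DERIV_def)
  moreover have "filterlim (\<lambda>k. complex_of_real (inverse (real (Suc k)))) (at 0) sequentially"
    using tendsto_of_real[OF LIMSEQ_inverse_real_of_nat, where 'a=complex]
    by (auto simp: filterlim_at simp del: of_nat_Suc)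
  ultimately have "(\<lambda>k. (exp (\<i> * of_real a * (0 + complex_of_real (inverse (real (Suc k))))) - exp (\<i> * of_real a * 0))
      / complex_of_real (inverse (real (Suc k)))) \<longlonglongrightarrow> \<i> * of_real a"
    by (rule filterlim_compose)
  then show ?thesis by (simp add: cis_conv_exp field_simps del: of_nat_Suc)
qed


lemma rfourier_translate:
  fixes f :: "'a::euclidean_space \<Rightarrow> real"
  assumes [measurable]: "f \<in> borel_measurable borel"
  shows "rfourier (\<lambda>x. f (x + c)) \<xi> = cis (2 * pi * (c \<bullet> \<xi>)) * rfourier f \<xi>"
proof -
  have "rfourier (\<lambda>x. f (x + c)) \<xi>
      = (\<integral>x. (\<lambda>y. cis (2 * pi * (c \<bullet> \<xi>)) * (complex_of_real (f y) * cis (- 2 * pi * (y \<bullet> \<xi>)))) (x + c) \<partial>lborel)"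
    unfolding fourier_def
    by (intro Bochner_Integration.integral_cong) (auto simp: cis_mult algebra_simps inner_add_left)
  also have "\<dots> = (\<integral>y. cis (2 * pi * (c \<bullet> \<xi>)) * (complex_of_real (f y) * cis (- 2 * pi * (y \<bullet> \<xi>))) \<partial>lborel)"
    by (rule lborel_integral_translate) measurable
  finally show ?thesis by (simp add: fourier_def)
qed

text \<open>Translation invariance applied to difference quotients replaces integration by parts.\<close>

lemma rfourier_dir_deriv:
  fixes f :: "'a::euclidean_space \<Rightarrow> real"
  assumes f: "f \<in> Cc_inf"
  shows "rfourier (dir_deriv v f) \<xi> = \<i> * complex_of_real (2 * pi * (v \<bullet> \<xi>)) * rfourier f \<xi>"
proof -
  have [measurable]: "f \<in> borel_measurable borel" "dir_deriv v f \<in> borel_measurable borel"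
    using f by (auto intro: Cc_inf_measurable Cc_inf_dir_deriv)
  obtain R where R: "0 < R" "\<And>x. R \<le> norm x \<Longrightarrow> f x = 0" using Cc_inf_support[OF f] by blast
  obtain L where L: "0 \<le> L" "\<And>x y. \<bar>f x - f y\<bar> \<le> L * norm (x - y)" using Cc_inf_Lipschitz[OF f] by blast
  define t where "t k = inverse (real (Suc k))" for k
  have t: "0 < t k" "t k \<le> 1" for k by (auto simp: t_def inverse_le_1_iff)
  have t0: "t \<longlonglongrightarrow> 0" unfolding t_def by (rule LIMSEQ_inverse_real_of_nat)
  define d where "d k x = (f (x + t k *\<^sub>R v) - f x) / t k" for k x
  have [measurable]: "d k \<in> borel_measurable borel" for k unfolding d_def by measurable
  have lim: "(\<lambda>k. d k x) \<longlonglongrightarrow> dir_deriv v f x" for x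
  proof (cases "v = 0")
    case True
    then show ?thesis using linear_0[OF has_derivative_linear[of f "frechet_derivative f (at x)" "at x"]] f
      by (simp add: d_def dir_deriv_def Cc_inf_def smooth_fun_differentiable frechet_derivative_works[symmetric])
  next
    case False
    have "(f has_derivative frechet_derivative f (at x)) (at x)"
      using f by (auto simp: Cc_inf_def smooth_fun_differentiable frechet_derivative_works[symmetric])
    then have "((\<lambda>s. f (x + s *\<^sub>R v)) has_derivative (\<lambda>s. frechet_derivative f (at x) (s *\<^sub>R v))) (at 0)"
      by (intro has_derivative_compose[where f="\<lambda>s. x + s *\<^sub>R v" and g=f and f'="\<lambda>s. s *\<^sub>R v", simplified])
         (auto intro!: derivative_eq_intros)
    then have "((\<lambda>s. f (x + s *\<^sub>R v)) has_field_derivative dir_deriv v f x) (at 0)"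
      using linear_cmul[OF has_derivative_linear[OF \<open>(f has_derivative frechet_derivative f (at x)) (at x)\<close>]]
      by (simp add: has_field_derivative_def dir_deriv_def mult.commute[of _ "frechet_derivative f (at x) v"] fun_eq_iff)
    then have "((\<lambda>h. (f (x + (0 + h) *\<^sub>R v) - f (x + 0 *\<^sub>R v)) / h) \<longlongrightarrow> dir_deriv v f x) (at 0)"
      by (simp only: DERIV_def)
    moreover have "filterlim t (at 0) sequentially" using t0 t by (auto simp: filterlim_at less_imp_neq[OF t(1), symmetric])
    ultimately have "(\<lambda>k. (f (x + (0 + t k) *\<^sub>R v) - f (x + 0 *\<^sub>R v)) / t k) \<longlonglongrightarrow> dir_deriv v f x"
      by (rule filterlim_compose)
    then show ?thesis by (simp add: d_def)
  qed
  \<comment> \<open>Since \<open>t k \<le> 1\<close>, all the shifted supports stay in one fixed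
    ball, so a single dominating function serves every \<open>k\<close>.\<close>
  have bound: "\<bar>d k x\<bar> \<le> L * norm v * indicator (cball 0 (R + norm v)) x" for k x
  proof -
    have "\<bar>d k x\<bar> \<le> L * norm v"
      using L(2)[of "x + t k *\<^sub>R v" x] t(1)[of k] by (simp add: d_def field_simps)
    moreover have "d k x = 0" if "R + norm v < norm x"
    proof -
      have "norm x \<le> norm (x + t k *\<^sub>R v) + norm (t k *\<^sub>R v)"
        using norm_triangle_ineq4[of "x + t k *\<^sub>R v" "t k *\<^sub>R v"] by simp
      moreover have "norm (t k *\<^sub>R v) \<le> norm v" using t[of k] mult_right_mono[of "t k" 1 "norm v"] by simp
      moreover have "0 \<le> norm v" by simp
      ultimately have "R \<le> norm (x + t k *\<^sub>R v)" "R \<le> norm x" using that by linarith+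
      then show ?thesis using R(2) by (simp add: d_def)
    qed
    ultimately show ?thesis by (auto simp: indicator_def)
  qed
  have "(\<lambda>k. rfourier (d k) \<xi>) \<longlonglongrightarrow> rfourier (dir_deriv v f) \<xi>"
    unfolding fourier_def
  proof (rule integral_dominated_convergence[where w="\<lambda>x. L * norm v * indicator (cball 0 (R + norm v)) x"])
    show "integrable lborel (\<lambda>x. L * norm v * indicator (cball (0::'a) (R + norm v)) x)"
      using emeasure_bounded_finite[OF bounded_cball, of "0::'a" "R + norm v"] by simp
    show "AE x in lborel. (\<lambda>k. complex_of_real (d k x) * cis (- 2 * pi * (x \<bullet> \<xi>)))
        \<longlonglongrightarrow> complex_of_real (dir_deriv v f x) * cis (- 2 * pi * (x \<bullet> \<xi>))"
      using lim by (intro AE_I2 tendsto_intros)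
    show "AE x in lborel. norm (complex_of_real (d k x) * cis (- 2 * pi * (x \<bullet> \<xi>))) \<le> L * norm v * indicator (cball 0 (R + norm v)) x" for k
      using bound by (intro AE_I2) (simp add: norm_mult)
  qed measurable
  moreover have "rfourier (d k) \<xi> = of_nat (Suc k) * (cis (2 * pi * (v \<bullet> \<xi>) / real (Suc k)) - 1) * rfourier f \<xi>" for k
  proof -
    have i1: "integrable lborel (\<lambda>x. complex_of_real (f x) * cis (- 2 * pi * (x \<bullet> \<xi>)))"
      by (intro cis_mult_integrable integrable_of_real Cc_inf_integrable f) measurable
    have "integrable lborel (\<lambda>x. f (x + t k *\<^sub>R v))"
      using Cc_inf_integrable[OF f] by (subst (asm) lborel_distr_plus[of "t k *\<^sub>R v", symmetric])
        (simp add: integrable_distr_eq add.commute)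
    then have i2: "integrable lborel (\<lambda>x. complex_of_real (f (x + t k *\<^sub>R v)) * cis (- 2 * pi * (x \<bullet> \<xi>)))"
      by (intro cis_mult_integrable integrable_of_real) measurable
    have "rfourier (d k) \<xi> = (\<integral>x. of_nat (Suc k) * (complex_of_real (f (x + t k *\<^sub>R v)) * cis (- 2 * pi * (x \<bullet> \<xi>))
        - complex_of_real (f x) * cis (- 2 * pi * (x \<bullet> \<xi>))) \<partial>lborel)"
      unfolding fourier_def d_def t_def
      by (intro Bochner_Integration.integral_cong) (auto simp: field_simps simp del: of_nat_Suc)
    also have "\<dots> = of_nat (Suc k) * (rfourier (\<lambda>x. f (x + t k *\<^sub>R v)) \<xi> - rfourier f \<xi>)"
      unfolding fourier_def using i1 i2 by (subst integral_mult_right_zero) (simp add: Bochner_Integration.integral_diff)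
    finally show ?thesis
      by (subst (asm) rfourier_translate) (simp_all add: t_def field_simps del: of_nat_Suc)
  qed
  ultimately have "(\<lambda>k. of_nat (Suc k) * (cis (2 * pi * (v \<bullet> \<xi>) / real (Suc k)) - 1) * rfourier f \<xi>) \<longlonglongrightarrow> rfourier (dir_deriv v f) \<xi>"
    by simp
  moreover have "(\<lambda>k. of_nat (Suc k) * (cis (2 * pi * (v \<bullet> \<xi>) / real (Suc k)) - 1) * rfourier f \<xi>)
     \<longlonglongrightarrow> \<i> * complex_of_real (2 * pi * (v \<bullet> \<xi>)) * rfourier f \<xi>"
    by (intro tendsto_mult cis_difference_quotient tendsto_const)
  ultimately show ?thesis by (rule LIMSEQ_unique)
qed

text \<open>A derivative along \<open>b\<close> multiplies the transform by
  \<open>2 * pi * (b \<bullet> \<xi>)\<close> up to a unit, and it is again a test function; so one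
  more derivative buys one more power.\<close>

lemma rfourier_decay_direction:
  fixes f :: "'a::euclidean_space \<Rightarrow> real"
  assumes "f \<in> Cc_inf"
  shows "\<exists>C. \<forall>\<xi>. \<bar>b \<bullet> \<xi>\<bar> ^ N * cmod (rfourier f \<xi>) \<le> C"
  using assms
proof (induction N arbitrary: f)
  case 0
  then show ?case using cmod_fourier_le[of "\<lambda>x. complex_of_real (f x)"] by auto
next
  case (Suc N)
  obtain C where C: "\<And>\<xi>. \<bar>b \<bullet> \<xi>\<bar> ^ N * cmod (rfourier (dir_deriv b f) \<xi>) \<le> C"
    using Suc.IH[OF Cc_inf_dir_deriv[OF Suc.prems]] by blast
  have "\<bar>b \<bullet> \<xi>\<bar> ^ Suc N * cmod (rfourier f \<xi>) \<le> C / (2 * pi)" for \<xi>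
    using C[of \<xi>] by (simp add: rfourier_dir_deriv[OF Suc.prems] norm_mult abs_mult field_simps)
  then show ?case by blast
qed

lemma norm_power_le_sum_Basis:
  fixes \<xi> :: "'a::euclidean_space"
  shows "norm \<xi> ^ M \<le> real DIM('a) ^ M * (\<Sum>b\<in>Basis. \<bar>b \<bullet> \<xi>\<bar> ^ M)"
proof -
  define m where "m = Max ((\<lambda>b. \<bar>b \<bullet> \<xi>\<bar>) ` Basis)"
  have "m \<in> (\<lambda>b. \<bar>b \<bullet> \<xi>\<bar>) ` Basis" unfolding m_def by (intro Max_in) auto
  then obtain b where b: "b \<in> Basis" "m = \<bar>b \<bullet> \<xi>\<bar>" by auto
  have "norm \<xi> \<le> (\<Sum>b\<in>Basis. \<bar>\<xi> \<bullet> b\<bar>)" by (rule norm_le_l1)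
  also have "\<dots> \<le> (\<Sum>b\<in>(Basis::'a set). m)"
    unfolding m_def by (intro sum_mono Max_ge) (auto simp: inner_commute)
  finally have "norm \<xi> ^ M \<le> (real DIM('a) * m) ^ M" by (intro power_mono) auto
  also have "\<dots> = real DIM('a) ^ M * \<bar>b \<bullet> \<xi>\<bar> ^ M" by (simp add: b power_mult_distrib)
  also have "\<dots> \<le> real DIM('a) ^ M * (\<Sum>b\<in>Basis. \<bar>b \<bullet> \<xi>\<bar> ^ M)"
    by (intro mult_left_mono member_le_sum[OF b(1)]) auto
  finally show ?thesis .
qed

text \<open>The majorant is a product over coordinates, so that its integral factors into
  one-dimensional arctangent integrals. The weight \<open>1 + norm \<xi>\<close> is there to absorb
  the multiplier \<open>norm \<xi> powr s\<close> for \<open>s\<close> at most 1.\<close>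

lemma rfourier_decay:
  fixes f :: "'a::euclidean_space \<Rightarrow> real"
  assumes f: "f \<in> Cc_inf"
  obtains C where "0 \<le> C" "\<And>\<xi>. (1 + norm \<xi>) * cmod (rfourier f \<xi>) \<le> C * (\<Prod>b\<in>Basis. 1 / (1 + (\<xi> \<bullet> b)\<^sup>2))"
proof -
  \<comment> \<open>Two powers for each coordinate factor of the majorant, and one for the
    weight.\<close>
  define M where "M = Suc (2 * DIM('a))"
  have "\<exists>C. \<forall>\<xi>. \<bar>b \<bullet> \<xi>\<bar> ^ M * cmod (rfourier f \<xi>) \<le> C" for b by (rule rfourier_decay_direction[OF f])
  then obtain K where K: "\<And>b \<xi>. \<bar>b \<bullet> \<xi>\<bar> ^ M * cmod (rfourier f \<xi>) \<le> K b" by metis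
  obtain K0 where K0: "\<And>\<xi>. cmod (rfourier f \<xi>) \<le> K0" using cmod_fourier_le by blast
  define C where "C = 2 ^ M * (K0 + real DIM('a) ^ M * (\<Sum>b\<in>Basis. K b))"
  have main: "(1 + norm \<xi>) ^ M * cmod (rfourier f \<xi>) \<le> C" for \<xi>
  proof -
    have "(1 + norm \<xi>) ^ M \<le> 2 ^ M * (1 ^ M + norm \<xi> ^ M)" by (intro power_add_le) auto
    then have "(1 + norm \<xi>) ^ M * cmod (rfourier f \<xi>) \<le> 2 ^ M * (1 + norm \<xi> ^ M) * cmod (rfourier f \<xi>)"
      by (intro mult_right_mono) auto
    also have "\<dots> = 2 ^ M * (cmod (rfourier f \<xi>) + norm \<xi> ^ M * cmod (rfourier f \<xi>))" by (simp add: algebra_simps)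
    also have "\<dots> \<le> C" unfolding C_def
    proof (intro mult_left_mono add_mono K0)
      have "norm \<xi> ^ M * cmod (rfourier f \<xi>) \<le> (real DIM('a) ^ M * (\<Sum>b\<in>Basis. \<bar>b \<bullet> \<xi>\<bar> ^ M)) * cmod (rfourier f \<xi>)"
        by (intro mult_right_mono norm_power_le_sum_Basis) auto
      also have "\<dots> = real DIM('a) ^ M * (\<Sum>b\<in>Basis. \<bar>b \<bullet> \<xi>\<bar> ^ M * cmod (rfourier f \<xi>))"
        by (simp add: sum_distrib_right)
      also have "\<dots> \<le> real DIM('a) ^ M * (\<Sum>b\<in>Basis. K b)" by (intro mult_left_mono sum_mono K) auto
      finally show "norm \<xi> ^ M * cmod (rfourier f \<xi>) \<le> real DIM('a) ^ M * (\<Sum>b\<in>Basis. K b)" .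
    qed auto
    finally show ?thesis .
  qed
  have C0: "0 \<le> C" using main[of 0] by (rule order_trans[rotated]) simp
  have "(1 + norm \<xi>) * cmod (rfourier f \<xi>) \<le> C * (\<Prod>b\<in>Basis. 1 / (1 + (\<xi> \<bullet> b)\<^sup>2))" for \<xi>
  proof -
    define P where "P = (\<Prod>b\<in>Basis. 1 + (\<xi> \<bullet> b)\<^sup>2)"
    have P0: "0 < P" unfolding P_def by (intro prod_pos) (auto intro: add_pos_nonneg)
    have "P \<le> (\<Prod>b\<in>(Basis::'a set). (1 + norm \<xi>)\<^sup>2)"
      unfolding P_def
    proof (intro prod_mono conjI)
      fix b :: 'a assume b: "b \<in> Basis"
      have "(\<xi> \<bullet> b)\<^sup>2 \<le> (norm \<xi>)\<^sup>2" using Basis_le_norm[OF b, of \<xi>] by (simp add: abs_le_square_iff[symmetric])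
      moreover have "(1 + norm \<xi>)\<^sup>2 = 1 + 2 * norm \<xi> + (norm \<xi>)\<^sup>2" by (simp add: power2_eq_square algebra_simps)
      ultimately show "1 + (\<xi> \<bullet> b)\<^sup>2 \<le> (1 + norm \<xi>)\<^sup>2" using norm_ge_zero[of \<xi>] by linarith
    qed (auto intro: add_nonneg_nonneg)
    also have "\<dots> = (1 + norm \<xi>) ^ (2 * DIM('a))" by (simp add: power_mult)
    finally have "(1 + norm \<xi>) * P \<le> (1 + norm \<xi>) * (1 + norm \<xi>) ^ (2 * DIM('a))"
      by (intro mult_left_mono) auto
    then have "(1 + norm \<xi>) * P * cmod (rfourier f \<xi>) \<le> (1 + norm \<xi>) ^ M * cmod (rfourier f \<xi>)"
      unfolding M_def by (intro mult_right_mono) auto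
    then have "(1 + norm \<xi>) * P * cmod (rfourier f \<xi>) \<le> C" using main[of \<xi>] by linarith
    then have "(1 + norm \<xi>) * cmod (rfourier f \<xi>) \<le> C / P" using P0 by (simp add: field_simps)
    then show ?thesis by (simp add: P_def prod_dividef)
  qed
  then show thesis using C0 by (intro that) auto
qed

lemma nn_integral_cauchy_finite: "(\<integral>\<^sup>+x. ennreal (1 / (1 + x\<^sup>2)) \<partial>(lborel :: real measure)) < \<infinity>"
proof -
  let ?f = "\<lambda>x::real. 1 / (1 + x\<^sup>2)"
  have I: "(\<integral>\<^sup>+x. ennreal (?f x) * indicator {0..} x \<partial>lborel) = ennreal (pi / 2 - arctan 0)"
    by (intro nn_integral_FTC_atLeast tendsto_arctan_at_top)
       (auto intro!: derivative_eq_intros simp: inverse_eq_divide add_nonneg_nonneg)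
  have "(\<integral>\<^sup>+x. ennreal (?f x) \<partial>lborel)
     \<le> (\<integral>\<^sup>+x. ennreal (?f x) * indicator {0..} x + ennreal (?f x) * indicator {0..} (- x) \<partial>lborel)"
    by (intro nn_integral_mono) (auto simp: indicator_def)
  also have "\<dots> = (\<integral>\<^sup>+x. ennreal (?f x) * indicator {0..} x \<partial>lborel) + (\<integral>\<^sup>+x. ennreal (?f x) * indicator {0..} (- x) \<partial>lborel)"
    by (rule nn_integral_add) measurable
  also have "(\<integral>\<^sup>+x. ennreal (?f x) * indicator {0..} (- x) \<partial>lborel) = (\<integral>\<^sup>+x. ennreal (?f x) * indicator {0..} x \<partial>lborel)"
    using nn_integral_real_affine[of "\<lambda>x. ennreal (?f x) * indicator {0..} x" "-1" 0] by simp
  finally show ?thesis unfolding I by (simp add: ennreal_plus[symmetric] less_top[symmetric] del: ennreal_plus)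
      (metis ennreal_neq_top infinity_ennreal_def less_top order_le_less_trans)
qed

lemma cauchy_product_integrable:
  "integrable lborel (\<lambda>\<xi>::'a::euclidean_space. \<Prod>b\<in>Basis. 1 / (1 + (\<xi> \<bullet> b)\<^sup>2))"
proof (rule integrableI_nonneg)
  have "(\<integral>\<^sup>+\<xi>. ennreal (\<Prod>b\<in>Basis. 1 / (1 + (\<xi> \<bullet> b)\<^sup>2)) \<partial>(lborel :: 'a measure))
      = (\<integral>\<^sup>+\<xi>. (\<Prod>b\<in>Basis. ennreal (1 / (1 + (\<xi> \<bullet> b)\<^sup>2))) \<partial>(lborel :: 'a measure))"
    by (intro nn_integral_cong prod_ennreal[symmetric]) (auto intro: add_nonneg_nonneg)
  also have "\<dots> = (\<Prod>b\<in>(Basis::'a set). (\<integral>\<^sup>+x. ennreal (1 / (1 + x\<^sup>2)) \<partial>(lborel :: real measure)))"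
    by (rule nn_integral_lborel_prod) auto
  also have "\<dots> < \<infinity>" using nn_integral_cauchy_finite by (simp add: power_less_top_ennreal)
  finally show "(\<integral>\<^sup>+\<xi>. ennreal (\<Prod>b\<in>Basis. 1 / (1 + (\<xi> \<bullet> b)\<^sup>2)) \<partial>(lborel :: 'a measure)) < \<infinity>" .
qed (auto intro!: AE_I2 prod_nonneg add_nonneg_nonneg)

lemma weighted_rfourier_integrable:
  fixes f :: "'a::euclidean_space \<Rightarrow> real"
  assumes f: "f \<in> Cc_inf" and s: "0 \<le> s" "s \<le> 1"
  shows "integrable lborel (\<lambda>\<xi>. complex_of_real ((2 * pi * norm \<xi>) powr s) * rfourier f \<xi>)"
    and "integrable lborel (rfourier f)"
proof -
  obtain C where C: "0 \<le> C" "\<And>\<xi>. (1 + norm \<xi>) * cmod (rfourier f \<xi>) \<le> C * (\<Prod>b\<in>Basis. 1 / (1 + (\<xi> \<bullet> b)\<^sup>2))"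
    using rfourier_decay[OF f] by blast
  have [measurable]: "rfourier f \<in> borel_measurable borel"
    using Cc_inf_measurable[OF f] by (intro fourier_measurable) measurable
  have int: "integrable lborel (\<lambda>\<xi>::'a. (2 * pi) powr s * (C * (\<Prod>b\<in>Basis. 1 / (1 + (\<xi> \<bullet> b)\<^sup>2))))"
      "integrable lborel (\<lambda>\<xi>::'a. C * (\<Prod>b\<in>Basis. 1 / (1 + (\<xi> \<bullet> b)\<^sup>2)))"
    by (intro integrable_mult_right cauchy_product_integrable)+
  have "norm \<xi> powr s \<le> 1 + norm \<xi>" for \<xi> :: 'a
  proof -
    have "norm \<xi> powr s \<le> (1 + norm \<xi>) powr s" using s by (intro powr_mono2) auto
    also have "\<dots> \<le> (1 + norm \<xi>) powr 1" using s by (intro powr_mono) auto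
    finally show ?thesis by simp
  qed
  then have b1: "norm (complex_of_real ((2 * pi * norm \<xi>) powr s) * rfourier f \<xi>)
       \<le> norm ((2 * pi) powr s * (C * (\<Prod>b\<in>Basis. 1 / (1 + (\<xi> \<bullet> b)\<^sup>2))))" for \<xi>
  proof -
    have "norm (complex_of_real ((2 * pi * norm \<xi>) powr s) * rfourier f \<xi>) = (2 * pi) powr s * (norm \<xi> powr s * cmod (rfourier f \<xi>))"
      by (simp add: norm_mult powr_mult)
    also have "\<dots> \<le> (2 * pi) powr s * ((1 + norm \<xi>) * cmod (rfourier f \<xi>))"
      using \<open>\<And>\<xi>. norm \<xi> powr s \<le> 1 + norm \<xi>\<close> by (intro mult_left_mono mult_right_mono) auto
    also have "\<dots> \<le> (2 * pi) powr s * (C * (\<Prod>b\<in>Basis. 1 / (1 + (\<xi> \<bullet> b)\<^sup>2)))"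
      by (intro mult_left_mono C) auto
    finally show ?thesis by simp
  qed
  have b2: "norm (rfourier f \<xi>) \<le> norm (C * (\<Prod>b\<in>Basis. 1 / (1 + (\<xi> \<bullet> b)\<^sup>2)))" for \<xi>
  proof -
    have "norm (rfourier f \<xi>) \<le> (1 + norm \<xi>) * cmod (rfourier f \<xi>)"
      using mult_right_mono[of 1 "1 + norm \<xi>" "cmod (rfourier f \<xi>)"] by simp
    then show ?thesis using C(2)[of \<xi>] by simp
  qed
  show "integrable lborel (\<lambda>\<xi>. complex_of_real ((2 * pi * norm \<xi>) powr s) * rfourier f \<xi>)"
    by (rule Bochner_Integration.integrable_bound[OF int(1)]) (use b1 in \<open>auto intro!: AE_I2\<close>)
  show "integrable lborel (rfourier f)"
    by (rule Bochner_Integration.integrable_bound[OF int(2)]) (use b2 in \<open>auto intro!: AE_I2\<close>)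
qed

section \<open>Gaussians and the heat kernel\<close>

lemma gaussian_fourier_real:
  fixes \<sigma> w :: real
  assumes \<sigma>: "0 < \<sigma>"
  shows "integrable lborel (\<lambda>x. complex_of_real (exp (- x\<^sup>2 / (2 * \<sigma>\<^sup>2))) * cis (x * w))" (is ?int)
    and "(\<integral>x. complex_of_real (exp (- x\<^sup>2 / (2 * \<sigma>\<^sup>2))) * cis (x * w) \<partial>lborel)
       = complex_of_real (\<sigma> * sqrt (2 * pi) * exp (- (\<sigma> * w)\<^sup>2 / 2))" (is ?eq)
proof -
  let ?g = "\<lambda>y. complex_of_real (exp (- y\<^sup>2 / 2)) * cis (y * (\<sigma> * w))"
  have dens: "complex_of_real (exp (- y\<^sup>2 / 2)) = complex_of_real (sqrt (2 * pi)) * complex_of_real (std_normal_density y)" for y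
    by (simp add: std_normal_density_def)
  have "integrable lborel (\<lambda>y. complex_of_real (exp (- y\<^sup>2 / 2)))"
    unfolding dens using integrable_normal_density[of 1 0] by (intro integrable_mult_right integrable_of_real) auto
  then have int0: "integrable lborel ?g" by (rule cis_mult_integrable) measurable
  \<comment> \<open>The analytic input is the characteristic function of the standard normal law;
    the general \<sigma> follows by rescaling the variable.\<close>
  have "char std_normal_distribution (\<sigma> * w) = (\<integral>y. std_normal_density y *\<^sub>R iexp (\<sigma> * w * y) \<partial>lborel)"
    unfolding char_def by (subst integral_density) (auto simp: normal_density_nonneg)
  then have "complex_of_real (exp (- (\<sigma> * w)\<^sup>2 / 2)) = (\<integral>y. std_normal_density y *\<^sub>R iexp (\<sigma> * w * y) \<partial>lborel)"
    by (simp add: char_std_normal_distribution)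
  then have "complex_of_real (sqrt (2 * pi)) * complex_of_real (exp (- (\<sigma> * w)\<^sup>2 / 2))
      = (\<integral>y. complex_of_real (sqrt (2 * pi)) * (std_normal_density y *\<^sub>R iexp (\<sigma> * w * y)) \<partial>lborel)"
    by (simp only: integral_mult_right_zero)
  also have "\<dots> = (\<integral>y. ?g y \<partial>lborel)"
    unfolding dens by (intro Bochner_Integration.integral_cong) (auto simp: cis_conv_exp scaleR_conv_of_real mult_ac)
  finally have eq0: "(\<integral>y. ?g y \<partial>lborel) = complex_of_real (sqrt (2 * pi) * exp (- (\<sigma> * w)\<^sup>2 / 2))" by simp
  have sub: "?g (0 + (1 / \<sigma>) * x) = complex_of_real (exp (- x\<^sup>2 / (2 * \<sigma>\<^sup>2))) * cis (x * w)" for x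
    using \<sigma> by (simp add: power_divide field_simps)
  show ?int using lborel_integrable_real_affine[OF int0, of "1 / \<sigma>" 0] \<sigma> unfolding sub by simp
  have "(\<integral>y. ?g y \<partial>lborel) = \<bar>1 / \<sigma>\<bar> *\<^sub>R (\<integral>x. ?g (0 + (1 / \<sigma>) * x) \<partial>lborel)"
    using \<sigma> by (intro lborel_integral_real_affine) auto
  then have "(\<integral>x. ?g (0 + (1 / \<sigma>) * x) \<partial>lborel) = complex_of_real \<sigma> * (\<integral>y. ?g y \<partial>lborel)"
    using \<sigma> by (simp add: scaleR_conv_of_real field_simps)
  then show ?eq unfolding sub eq0 by simp
qed

text \<open>Lebesgue measure on the Euclidean space is the image of a product of real Lebesgue
  measures under \<open>?T\<close>, so a product of coordinate functions integrates factor by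
  factor.\<close>

lemma lborel_integral_prod_Basis:
  fixes h :: "'a::euclidean_space \<Rightarrow> real \<Rightarrow> complex"
  assumes "\<And>b. b \<in> Basis \<Longrightarrow> integrable lborel (h b)"
  shows "integrable lborel (\<lambda>x::'a. \<Prod>b\<in>Basis. h b (x \<bullet> b))"
    and "(\<integral>x. (\<Prod>b\<in>Basis. h b (x \<bullet> b)) \<partial>(lborel :: 'a measure)) = (\<Prod>b\<in>Basis. \<integral>x. h b x \<partial>lborel)"
proof -
  interpret product_sigma_finite "\<lambda>b::'a. lborel :: real measure" by standard
  have [measurable]: "h b \<in> borel_measurable borel" if "b \<in> Basis" for b
    using borel_measurable_integrable[OF assms[OF that]] by simp
  let ?T = "\<lambda>y::'a \<Rightarrow> real. \<Sum>b\<in>Basis. y b *\<^sub>R b"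
  have eq: "(\<Prod>b\<in>Basis. h b (?T y \<bullet> b)) = (\<Prod>b\<in>Basis. h b (y b))" for y
    by (intro prod.cong) auto
  have mT: "?T \<in> (\<Pi>\<^sub>M b\<in>Basis. lborel) \<rightarrow>\<^sub>M borel" by measurable
  have mh: "(\<lambda>x::'a. \<Prod>b\<in>Basis. h b (x \<bullet> b)) \<in> borel_measurable borel" by measurable
  show "integrable lborel (\<lambda>x::'a. \<Prod>b\<in>Basis. h b (x \<bullet> b))"
    unfolding lborel_eq[where 'a='a] integrable_distr_eq[OF mT mh] eq
    by (intro product_integrable_prod assms) auto
  show "(\<integral>x. (\<Prod>b\<in>Basis. h b (x \<bullet> b)) \<partial>(lborel :: 'a measure)) = (\<Prod>b\<in>Basis. \<integral>x. h b x \<partial>lborel)"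
    unfolding lborel_eq[where 'a='a] integral_distr[OF mT mh] eq
    by (intro product_integral_prod assms) auto
qed

lemma gaussian_fourier:
  fixes w :: "'a::euclidean_space"
  assumes \<sigma>: "0 < \<sigma>"
  shows "integrable lborel (\<lambda>x::'a. complex_of_real (exp (- (norm x)\<^sup>2 / (2 * \<sigma>\<^sup>2))) * cis (x \<bullet> w))"
    and "(\<integral>x. complex_of_real (exp (- (norm x)\<^sup>2 / (2 * \<sigma>\<^sup>2))) * cis (x \<bullet> w) \<partial>lborel)
       = complex_of_real ((\<sigma> * sqrt (2 * pi)) ^ DIM('a) * exp (- (\<sigma> * norm w)\<^sup>2 / 2))"
proof -
  have sq: "(norm x)\<^sup>2 = (\<Sum>b\<in>Basis. (x \<bullet> b)\<^sup>2)" for x :: 'a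
    unfolding power2_norm_eq_inner by (subst euclidean_inner) (simp add: power2_eq_square)
  have e: "complex_of_real (exp (- (norm x)\<^sup>2 / (2 * \<sigma>\<^sup>2))) * cis (x \<bullet> w)
      = (\<Prod>b\<in>Basis. complex_of_real (exp (- (x \<bullet> b)\<^sup>2 / (2 * \<sigma>\<^sup>2))) * cis ((x \<bullet> b) * (w \<bullet> b)))" for x :: 'a
  proof -
    have "exp (- (norm x)\<^sup>2 / (2 * \<sigma>\<^sup>2)) = (\<Prod>b\<in>Basis. exp (- (x \<bullet> b)\<^sup>2 / (2 * \<sigma>\<^sup>2)))"
      by (simp add: sq exp_sum[symmetric] sum_negf[symmetric] sum_divide_distrib)
    moreover have "cis (x \<bullet> w) = (\<Prod>b\<in>Basis. cis ((x \<bullet> b) * (w \<bullet> b)))"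
      by (simp add: euclidean_inner[of x w] cis_conv_exp exp_sum[symmetric] sum_distrib_left)
    ultimately show ?thesis by (simp add: prod.distrib)
  qed
  show "integrable lborel (\<lambda>x::'a. complex_of_real (exp (- (norm x)\<^sup>2 / (2 * \<sigma>\<^sup>2))) * cis (x \<bullet> w))"
    unfolding e by (rule lborel_integral_prod_Basis) (rule gaussian_fourier_real[OF \<sigma>])
  have "(\<integral>x. complex_of_real (exp (- (norm x)\<^sup>2 / (2 * \<sigma>\<^sup>2))) * cis (x \<bullet> w) \<partial>(lborel :: 'a measure))
      = (\<Prod>b\<in>Basis. complex_of_real (\<sigma> * sqrt (2 * pi) * exp (- (\<sigma> * (w \<bullet> b))\<^sup>2 / 2)))"
    unfolding e
    by (subst lborel_integral_prod_Basis(2)) (simp_all only: gaussian_fourier_real[OF \<sigma>])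
  also have "\<dots> = complex_of_real (\<Prod>b\<in>(Basis::'a set). \<sigma> * sqrt (2 * pi) * exp (- (\<sigma> * (w \<bullet> b))\<^sup>2 / 2))"
    by simp
  also have "(\<Prod>b\<in>(Basis::'a set). \<sigma> * sqrt (2 * pi) * exp (- (\<sigma> * (w \<bullet> b))\<^sup>2 / 2))
      = (\<sigma> * sqrt (2 * pi)) ^ DIM('a) * exp (- (\<sigma> * norm w)\<^sup>2 / 2)"
    by (simp add: prod.distrib exp_sum[symmetric] power_mult_distrib sq sum_negf[symmetric] sum_divide_distrib sum_distrib_left)
  finally show "(\<integral>x. complex_of_real (exp (- (norm x)\<^sup>2 / (2 * \<sigma>\<^sup>2))) * cis (x \<bullet> w) \<partial>lborel)
       = complex_of_real ((\<sigma> * sqrt (2 * pi)) ^ DIM('a) * exp (- (\<sigma> * norm w)\<^sup>2 / 2))" .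
qed

text \<open>The Gauss--Weierstrass kernel, a Gaussian density of variance \<open>2 * t\<close> in
  each coordinate. It is meaningful for \<open>t > 0\<close> only, hence the indicators of
  \<open>{0<..}\<close> in integrals over \<open>t\<close>.\<close>

definition heat :: "real \<Rightarrow> 'a::euclidean_space \<Rightarrow> real" where
  "heat t z = exp (- (norm z)\<^sup>2 / (4 * t)) / (4 * pi * t) powr (real DIM('a) / 2)"

lemma heat_measurable [measurable (raw)]:
  assumes [measurable]: "f \<in> borel_measurable M" "g \<in> measurable M (borel :: 'a::euclidean_space measure)"
  shows "(\<lambda>w. heat (f w) (g w)) \<in> borel_measurable M"
  unfolding heat_def by measurable

lemma heat_nonneg [simp]: "0 \<le> heat t z"
  by (simp add: heat_def)

lemma heat_commute: "heat t (x - y) = heat t (y - x)"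
  by (simp add: heat_def norm_minus_commute)

lemma heat_fourier:
  fixes \<xi> :: "'a::euclidean_space"
  assumes t: "0 < t"
  shows "integrable lborel (\<lambda>z::'a. complex_of_real (heat t z) * cis (2 * pi * (z \<bullet> \<xi>)))"
    and "(\<integral>z. complex_of_real (heat t z) * cis (2 * pi * (z \<bullet> \<xi>)) \<partial>lborel) = complex_of_real (exp (- t * (2 * pi * norm \<xi>)\<^sup>2))"
proof -
  define \<sigma> where "\<sigma> = sqrt (2 * t)"
  have \<sigma>: "0 < \<sigma>" "\<sigma>\<^sup>2 = 2 * t" using t by (auto simp: \<sigma>_def)
  define c where "c = (4 * pi * t) powr (real DIM('a) / 2)"
  have c: "0 < c" using t by (simp add: c_def)
  have cc: "(\<sigma> * sqrt (2 * pi)) ^ DIM('a) = c"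
  proof -
    have "\<sigma> * sqrt (2 * pi) = (4 * pi * t) powr (1 / 2)"
      using t by (simp add: \<sigma>_def real_sqrt_mult[symmetric] powr_half_sqrt mult_ac)
    then show ?thesis using t by (simp add: c_def powr_realpow[symmetric] powr_powr)
  qed
  have e: "complex_of_real (heat t z) * cis (2 * pi * (z \<bullet> \<xi>))
      = complex_of_real (1 / c) * (complex_of_real (exp (- (norm z)\<^sup>2 / (2 * \<sigma>\<^sup>2))) * cis (z \<bullet> ((2 * pi) *\<^sub>R \<xi>)))" for z :: 'a
    using t by (simp add: heat_def c_def[symmetric] \<sigma>(2))
  show "integrable lborel (\<lambda>z::'a. complex_of_real (heat t z) * cis (2 * pi * (z \<bullet> \<xi>)))"
    unfolding e by (intro integrable_mult_right gaussian_fourier \<sigma>)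
  show "(\<integral>z. complex_of_real (heat t z) * cis (2 * pi * (z \<bullet> \<xi>)) \<partial>lborel) = complex_of_real (exp (- t * (2 * pi * norm \<xi>)\<^sup>2))"
    unfolding e integral_mult_right_zero gaussian_fourier(2)[OF \<sigma>(1)] cc
    using c by (simp add: power_mult_distrib \<sigma>(2))
qed

text \<open>Both directions are read off the explicit Gaussian integral, with
  \<open>\<sigma>\<^sup>2\<close> equal to \<open>2 * t\<close> in one and to
  \<open>1 / (8 * pi\<^sup>2 * t)\<close> in the other. Inversion for this kernel thus precedes
  \<open>rfourier_inversion\<close>, which rests on it.\<close>

lemma inverse_heat_fourier:
  fixes z :: "'a::euclidean_space"
  assumes t: "0 < t"
  shows "integrable lborel (\<lambda>\<xi>::'a. complex_of_real (exp (- t * (2 * pi * norm \<xi>)\<^sup>2)) * cis (2 * pi * (z \<bullet> \<xi>)))"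
    and "(\<integral>\<xi>. complex_of_real (exp (- t * (2 * pi * norm \<xi>)\<^sup>2)) * cis (2 * pi * (z \<bullet> \<xi>)) \<partial>lborel) = complex_of_real (heat t z)"
proof -
  define \<sigma> where "\<sigma> = 1 / (2 * pi * sqrt (2 * t))"
  have \<sigma>: "0 < \<sigma>" "\<sigma>\<^sup>2 = 1 / (8 * pi\<^sup>2 * t)" using t by (auto simp: \<sigma>_def power_divide power_mult_distrib)
  define c where "c = (4 * pi * t) powr (real DIM('a) / 2)"
  have c: "0 < c" using t by (simp add: c_def)
  have cc: "(\<sigma> * sqrt (2 * pi)) ^ DIM('a) = 1 / c"
  proof -
    have "(\<sigma> * sqrt (2 * pi))\<^sup>2 = \<sigma>\<^sup>2 * (2 * pi)" by (simp add: power_mult_distrib)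
    also have "\<dots> = 1 / (4 * pi * t)"
      unfolding \<sigma>(2) using t by (simp add: field_simps power2_eq_square)
    finally have "\<sigma> * sqrt (2 * pi) = sqrt (1 / (4 * pi * t))"
      using \<sigma>(1) by (metis less_eq_real_def mult_nonneg_nonneg pi_ge_zero real_sqrt_ge_zero real_sqrt_unique zero_le_numeral)
    also have "\<dots> = (4 * pi * t) powr (- (1 / 2))"
      using t by (simp add: powr_minus powr_half_sqrt real_sqrt_divide inverse_eq_divide)
    finally show ?thesis
      using t by (simp add: c_def powr_realpow[symmetric] powr_powr powr_minus powr_divide inverse_eq_divide)
  qed
  have e: "complex_of_real (exp (- t * (2 * pi * norm \<xi>)\<^sup>2)) * cis (2 * pi * (z \<bullet> \<xi>))
      = complex_of_real (exp (- (norm \<xi>)\<^sup>2 / (2 * \<sigma>\<^sup>2))) * cis (\<xi> \<bullet> ((2 * pi) *\<^sub>R z))" for \<xi> :: 'a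
    using t by (simp add: \<sigma>(2) field_simps power_mult_distrib inner_commute)
  show "integrable lborel (\<lambda>\<xi>::'a. complex_of_real (exp (- t * (2 * pi * norm \<xi>)\<^sup>2)) * cis (2 * pi * (z \<bullet> \<xi>)))"
    unfolding e by (intro gaussian_fourier \<sigma>)
  show "(\<integral>\<xi>. complex_of_real (exp (- t * (2 * pi * norm \<xi>)\<^sup>2)) * cis (2 * pi * (z \<bullet> \<xi>)) \<partial>lborel) = complex_of_real (heat t z)"
    unfolding e gaussian_fourier(2)[OF \<sigma>(1)] cc heat_def c_def[symmetric]
    using t by (simp add: power_mult_distrib \<sigma>(2) field_simps)
qed

section \<open>Heat kernel and Fourier inversion\<close>

lemma integrable_pair_product_bound:
  fixes h :: "'a::euclidean_space \<times> 'b::euclidean_space \<Rightarrow> complex" and a :: "'a \<Rightarrow> real" and b :: "'b \<Rightarrow> real"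
  assumes a: "integrable lborel a" and b: "integrable lborel b"
    and [measurable]: "h \<in> borel_measurable (lborel \<Otimes>\<^sub>M lborel)"
    and le: "\<And>x y. cmod (h (x, y)) \<le> a x * b y"
  shows "integrable (lborel \<Otimes>\<^sub>M lborel) h"
proof -
  have [measurable]: "a \<in> borel_measurable borel" "b \<in> borel_measurable borel"
    using borel_measurable_integrable[OF a] borel_measurable_integrable[OF b] by auto
  have "integrable (lborel \<Otimes>\<^sub>M lborel) (\<lambda>z. a (fst z) * b (snd z))"
    using a b by (intro lborel_pair.Fubini_integrable) (auto simp: abs_mult)
  then show ?thesis
  proof (rule Bochner_Integration.integrable_bound)
    show "AE z in lborel \<Otimes>\<^sub>M lborel. norm (h z) \<le> norm (a (fst z) * b (snd z))"
    proof (rule AE_I2)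
      fix z
      show "norm (h z) \<le> norm (a (fst z) * b (snd z))" using le[of "fst z" "snd z"] by simp
    qed
  qed measurable
qed

lemma heat_integral:
  assumes "0 < t"
  shows "integrable lborel (heat t :: 'a::euclidean_space \<Rightarrow> real)"
    and "(\<integral>z. heat t (z::'a) \<partial>lborel) = 1"
    and "(\<integral>\<^sup>+z. ennreal (heat t (z::'a)) \<partial>lborel) = 1"
proof -
  show i: "integrable lborel (heat t :: 'a \<Rightarrow> real)"
    using heat_fourier(1)[OF assms, of "0::'a"] by (simp add: complex_of_real_integrable_eq)
  have "complex_of_real (\<integral>z. heat t (z::'a) \<partial>lborel) = 1"
    using heat_fourier(2)[OF assms, of "0::'a"] by simp
  then show e: "(\<integral>z. heat t (z::'a) \<partial>lborel) = 1" using of_real_eq_1_iff by blast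
  show "(\<integral>\<^sup>+z. ennreal (heat t (z::'a)) \<partial>lborel) = 1"
    using nn_integral_eq_integral[OF i] e by simp
qed

lemma heat_integrable_translate:
  assumes "0 < t"
  shows "integrable lborel (\<lambda>y. heat t ((x::'a::euclidean_space) - y))"
    and "(\<integral>y. heat t (x - y) \<partial>lborel) = 1"
proof -
  have [measurable]: "(heat t :: 'a \<Rightarrow> real) \<in> borel_measurable borel" by measurable
  have "(\<integral>\<^sup>+y. ennreal (heat t (x - y)) \<partial>lborel) = 1"
    using lborel_nn_integral_affine(1)[of "\<lambda>z. ennreal (heat t z)" x] heat_integral(3)[OF assms, where 'a='a] by simp
  then show "integrable lborel (\<lambda>y. heat t (x - y))" by (intro integrableI_nonneg) auto
  show "(\<integral>y. heat t (x - y) \<partial>lborel) = 1"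
    using lborel_integral_reflect[of "heat t" x] heat_integral(2)[OF assms, where 'a='a] by simp
qed

text \<open>Half of the Gaussian exponent absorbs the factor \<open>norm z\<close>, which doubles
  the time: with \<open>u = norm z / sqrt t\<close>, the product
  \<open>u * exp (- (u\<^sup>2 / 4))\<close> is at most \<open>2 * exp (- (u\<^sup>2 / 8))\<close>.
  The kernel \<open>heat (2 * t)\<close> that remains has mass 1.\<close>

lemma heat_first_moment:
  assumes t: "0 < t"
  shows "(\<integral>\<^sup>+z. ennreal (norm z * heat t (z::'a::euclidean_space)) \<partial>lborel)
     \<le> ennreal (2 * 2 powr (real DIM('a) / 2) * sqrt t)"
proof -
  have pt: "norm z * heat t z \<le> 2 * 2 powr (real DIM('a) / 2) * sqrt t * heat (2 * t) z" for z :: 'a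
  proof -
    define u where "u = norm z / sqrt t"
    have u: "norm z = u * sqrt t" "(norm z)\<^sup>2 = u\<^sup>2 * t" using t by (auto simp: u_def power_divide)
    have "0 \<le> (u / 2 - 1)\<^sup>2" by simp
    then have "u \<le> 2 * (1 + u\<^sup>2 / 8)" by (simp add: power2_eq_square algebra_simps)
    also have "\<dots> \<le> 2 * exp (u\<^sup>2 / 8)" by (intro mult_left_mono exp_ge_add_one_self) auto
    finally have "u * exp (- (u\<^sup>2 / 4)) \<le> 2 * exp (u\<^sup>2 / 8) * exp (- (u\<^sup>2 / 4))" by (intro mult_right_mono) auto
    also have "\<dots> = 2 * exp (- (u\<^sup>2 / 8))" by (simp add: mult_exp_exp)
    finally have main: "u * exp (- (u\<^sup>2 / 4)) \<le> 2 * exp (- (u\<^sup>2 / 8))" .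
    define c where "c = (4 * pi * t) powr (real DIM('a) / 2)"
    have c: "0 < c" using t by (simp add: c_def)
    have c2: "(4 * pi * (2 * t)) powr (real DIM('a) / 2) = 2 powr (real DIM('a) / 2) * c"
      using t powr_mult[of 2 "4 * pi * t" "real DIM('a) / 2"] by (simp add: c_def mult_ac)
    have "norm z * heat t z = sqrt t / c * (u * exp (- (u\<^sup>2 / 4)))"
      using t unfolding heat_def c_def[symmetric] u(2) by (simp add: u(1))
    also have "\<dots> \<le> sqrt t / c * (2 * exp (- (u\<^sup>2 / 8)))"
      using t c main by (intro mult_left_mono) auto
    also have "\<dots> = 2 * 2 powr (real DIM('a) / 2) * sqrt t * heat (2 * t) z"
      using t c unfolding heat_def c2 u(2) by simp
    finally show ?thesis .
  qed
  have "(\<integral>\<^sup>+z. ennreal (norm z * heat t (z::'a)) \<partial>lborel)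
     \<le> (\<integral>\<^sup>+z. ennreal (2 * 2 powr (real DIM('a) / 2) * sqrt t) * ennreal (heat (2 * t) (z::'a)) \<partial>lborel)"
    using pt t by (intro nn_integral_mono) (simp add: ennreal_mult[symmetric] ennreal_leI)
  also have "\<dots> = ennreal (2 * 2 powr (real DIM('a) / 2) * sqrt t)"
    using t by (subst nn_integral_cmult) (auto simp: heat_integral(3))
  finally show ?thesis .
qed

text \<open>Formulated for the inverse transform of an arbitrary integrable \<open>M\<close>,
  because it will be applied to a fractional Laplacian, which is given as such a transform and need
  not be a test function.\<close>

lemma heat_conv_inverse_fourier:
  fixes M :: "'a::euclidean_space \<Rightarrow> complex"
  assumes M: "integrable lborel M" and t: "0 < t"
  shows "(\<integral>y. complex_of_real (heat t (x - y)) * (\<integral>\<xi>. M \<xi> * cis (2 * pi * (y \<bullet> \<xi>)) \<partial>lborel) \<partial>lborel)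
    = (\<integral>\<xi>. complex_of_real (exp (- t * (2 * pi * norm \<xi>)\<^sup>2)) * (M \<xi> * cis (2 * pi * (x \<bullet> \<xi>))) \<partial>lborel)"
proof -
  have [measurable]: "M \<in> borel_measurable borel" using borel_measurable_integrable[OF M] by simp
  have inner: "(\<integral>y. complex_of_real (heat t (x - y)) * cis (2 * pi * (y \<bullet> \<xi>)) \<partial>lborel)
     = complex_of_real (exp (- t * (2 * pi * norm \<xi>)\<^sup>2)) * cis (2 * pi * (x \<bullet> \<xi>))" for \<xi>
  proof -
    have "(\<integral>y. complex_of_real (heat t (x - y)) * cis (2 * pi * (y \<bullet> \<xi>)) \<partial>lborel)
       = (\<integral>y. (\<lambda>z. cis (2 * pi * (x \<bullet> \<xi>)) * (complex_of_real (heat t z) * cis (2 * pi * (z \<bullet> (- \<xi>))))) (x - y) \<partial>lborel)"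
      by (intro Bochner_Integration.integral_cong) (auto simp: cis_mult inner_diff_left algebra_simps)
    also have "\<dots> = (\<integral>z. cis (2 * pi * (x \<bullet> \<xi>)) * (complex_of_real (heat t z) * cis (2 * pi * (z \<bullet> (- \<xi>)))) \<partial>lborel)"
      by (rule lborel_integral_reflect) measurable
    also have "\<dots> = cis (2 * pi * (x \<bullet> \<xi>)) * complex_of_real (exp (- t * (2 * pi * norm \<xi>)\<^sup>2))"
      unfolding integral_mult_right_zero heat_fourier(2)[OF t] by simp
    finally show ?thesis by (simp add: mult.commute)
  qed
  define h where "h y \<xi> = complex_of_real (heat t (x - y)) * (M \<xi> * cis (2 * pi * (y \<bullet> \<xi>)))" for y \<xi>
  have "integrable (lborel \<Otimes>\<^sub>M lborel) (case_prod h)"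
  proof (rule integrable_pair_product_bound[OF heat_integrable_translate(1)[OF t, of x] integrable_norm[OF M]])
    show "case_prod h \<in> borel_measurable (lborel \<Otimes>\<^sub>M lborel)" unfolding h_def by measurable
  qed (simp add: h_def norm_mult)
  then have "(\<integral>\<xi>. \<integral>y. h y \<xi> \<partial>lborel \<partial>lborel) = (\<integral>y. \<integral>\<xi>. h y \<xi> \<partial>lborel \<partial>lborel)"
    by (rule lborel_pair.Fubini_integral)
  moreover have "(\<integral>\<xi>. h y \<xi> \<partial>lborel) = complex_of_real (heat t (x - y)) * (\<integral>\<xi>. M \<xi> * cis (2 * pi * (y \<bullet> \<xi>)) \<partial>lborel)" for y
    unfolding h_def by simp
  moreover have "(\<integral>y. h y \<xi> \<partial>lborel) = complex_of_real (exp (- t * (2 * pi * norm \<xi>)\<^sup>2)) * (M \<xi> * cis (2 * pi * (x \<bullet> \<xi>)))" for \<xi>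
  proof -
    have "(\<integral>y. h y \<xi> \<partial>lborel) = (\<integral>y. M \<xi> * (complex_of_real (heat t (x - y)) * cis (2 * pi * (y \<bullet> \<xi>))) \<partial>lborel)"
      unfolding h_def by (simp add: mult_ac)
    then show ?thesis unfolding integral_mult_right_zero inner by (simp only: mult_ac)
  qed
  ultimately show ?thesis by simp
qed

definition heat_conv :: "real \<Rightarrow> ('a::euclidean_space \<Rightarrow> real) \<Rightarrow> 'a \<Rightarrow> real" where
  "heat_conv t f x = (\<integral>y. f y * heat t (x - y) \<partial>lborel)"

lemma heat_conv_measurable [measurable (raw)]:
  fixes f :: "'a::euclidean_space \<Rightarrow> real"
  assumes [measurable]: "f \<in> borel_measurable borel" "g \<in> borel_measurable M" "h \<in> measurable M borel"
  shows "(\<lambda>w. heat_conv (g w) f (h w)) \<in> borel_measurable M"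
  unfolding heat_conv_def by measurable

lemma heat_conv_fourier:
  fixes f :: "'a::euclidean_space \<Rightarrow> real"
  assumes f: "f \<in> Cc_inf" and t: "0 < t"
  shows "complex_of_real (heat_conv t f x)
    = (\<integral>\<xi>. complex_of_real (exp (- t * (2 * pi * norm \<xi>)\<^sup>2)) * (rfourier f \<xi> * cis (2 * pi * (x \<bullet> \<xi>))) \<partial>lborel)"
proof -
  have [measurable]: "f \<in> borel_measurable borel" using f by (rule Cc_inf_measurable)
  have gi: "integrable lborel (\<lambda>\<xi>::'a. exp (- t * (2 * pi * norm \<xi>)\<^sup>2))"
    using inverse_heat_fourier(1)[OF t, of "0::'a"] by (simp only: inner_zero_left mult_zero_right cis_zero mult_1_right complex_of_real_integrable_eq)
  define h where "h y \<xi> = complex_of_real (f y) * (complex_of_real (exp (- t * (2 * pi * norm \<xi>)\<^sup>2)) * cis (2 * pi * ((x - y) \<bullet> \<xi>)))" for y \<xi>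
  have "integrable (lborel \<Otimes>\<^sub>M lborel) (case_prod h)"
  proof (rule integrable_pair_product_bound[OF integrable_norm[OF Cc_inf_integrable[OF f]] gi])
    show "case_prod h \<in> borel_measurable (lborel \<Otimes>\<^sub>M lborel)" unfolding h_def by measurable
  qed (simp add: h_def norm_mult)
  then have "(\<integral>\<xi>. \<integral>y. h y \<xi> \<partial>lborel \<partial>lborel) = (\<integral>y. \<integral>\<xi>. h y \<xi> \<partial>lborel \<partial>lborel)"
    by (rule lborel_pair.Fubini_integral)
  moreover have "(\<integral>\<xi>. h y \<xi> \<partial>lborel) = complex_of_real (f y * heat t (x - y))" for y
    unfolding h_def integral_mult_right_zero inverse_heat_fourier(2)[OF t] by simp
  moreover have "(\<integral>y. h y \<xi> \<partial>lborel) = complex_of_real (exp (- t * (2 * pi * norm \<xi>)\<^sup>2)) * (rfourier f \<xi> * cis (2 * pi * (x \<bullet> \<xi>)))" for \<xi>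
  proof -
    have "(\<integral>y. h y \<xi> \<partial>lborel) = (\<integral>y. complex_of_real (exp (- t * (2 * pi * norm \<xi>)\<^sup>2)) * cis (2 * pi * (x \<bullet> \<xi>))
        * (complex_of_real (f y) * cis (- 2 * pi * (y \<bullet> \<xi>))) \<partial>lborel)"
    proof -
      have "cis (2 * pi * ((x - y) \<bullet> \<xi>)) = cis (2 * pi * (x \<bullet> \<xi>)) * cis (- 2 * pi * (y \<bullet> \<xi>))" for y
        by (simp add: cis_mult inner_diff_left algebra_simps)
      then show ?thesis unfolding h_def by (simp only: mult_ac)
    qed
    then show ?thesis unfolding fourier_def integral_mult_right_zero by (simp only: mult_ac)
  qed
  ultimately show ?thesis unfolding heat_conv_def by (simp flip: integral_complex_of_real)
qed

text \<open>The kernel has mass 1, so \<open>f x\<close> can be brought under the integral. The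
  bound by translation differences serves both the uniform and the L^1 estimate.\<close>

lemma heat_conv_diff:
  fixes f :: "'a::euclidean_space \<Rightarrow> real"
  assumes f: "f \<in> Cc_inf" and t: "0 < t"
  shows "ennreal \<bar>f x - heat_conv t f x\<bar> \<le> (\<integral>\<^sup>+z. ennreal \<bar>f (x - z) - f x\<bar> * ennreal (heat t z) \<partial>lborel)"
proof -
  have [measurable]: "f \<in> borel_measurable borel" using f by (rule Cc_inf_measurable)
  obtain K where K: "\<And>x. \<bar>f x\<bar> \<le> K" using Cc_inf_bounded_borel[OF f] by (auto simp: bounded_borel_def)
  have i1: "integrable lborel (\<lambda>z. f (x - z) * heat t z)"
    by (rule Bochner_Integration.integrable_bound[OF integrable_mult_right[OF heat_integral(1)[OF t], of K]])
       (use K in \<open>auto intro!: AE_I2 mult_mono simp: abs_mult intro: order_trans[OF _ abs_ge_self]\<close>)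
  have i2: "integrable lborel (\<lambda>z::'a. f x * heat t z)" by (intro integrable_mult_right heat_integral t)
  have "heat_conv t f x = (\<integral>y. (\<lambda>z. f (x - z) * heat t z) (x - y) \<partial>lborel)" by (simp add: heat_conv_def)
  also have "\<dots> = (\<integral>z. f (x - z) * heat t z \<partial>lborel)" by (rule lborel_integral_reflect) measurable
  finally have "heat_conv t f x - f x = (\<integral>z. f (x - z) * heat t z \<partial>lborel) - (\<integral>z. f x * heat t (z::'a) \<partial>lborel)"
    using heat_integral(2)[OF t, where 'a='a] by simp
  also have "\<dots> = (\<integral>z. (f (x - z) - f x) * heat t z \<partial>lborel)"
    by (subst Bochner_Integration.integral_diff[OF i1 i2, symmetric]) (simp add: algebra_simps)
  finally have "ennreal \<bar>f x - heat_conv t f x\<bar> = ennreal (norm (\<integral>z. (f (x - z) - f x) * heat t z \<partial>lborel))"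
    by (simp add: abs_minus_commute)
  also have "\<dots> \<le> (\<integral>\<^sup>+z. ennreal (norm ((f (x - z) - f x) * heat t z)) \<partial>lborel)"
    using Bochner_Integration.integrable_diff[OF i1 i2]
    by (intro integral_norm_bound_ennreal) (simp add: algebra_simps)
  finally show ?thesis by (simp add: abs_mult ennreal_mult)
qed

lemma heat_conv_tendsto:
  fixes f :: "'a::euclidean_space \<Rightarrow> real"
  assumes f: "f \<in> Cc_inf"
  obtains C where "0 \<le> C" "\<And>t x. 0 < t \<Longrightarrow> \<bar>f x - heat_conv t f x\<bar> \<le> C * sqrt t"
proof -
  obtain L where L: "0 \<le> L" "\<And>x y. \<bar>f x - f y\<bar> \<le> L * norm (x - y)" using Cc_inf_Lipschitz[OF f] by blast
  define c where "c = 2 * 2 powr (real DIM('a) / 2)"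
  have c: "0 \<le> c" by (simp add: c_def)
  have "\<bar>f x - heat_conv t f x\<bar> \<le> L * c * sqrt t" if t: "0 < t" for t x
  proof -
    have "ennreal \<bar>f x - heat_conv t f x\<bar> \<le> (\<integral>\<^sup>+z. ennreal L * ennreal (norm z * heat t (z::'a)) \<partial>lborel)"
    proof (rule order_trans[OF heat_conv_diff[OF f t]], rule nn_integral_mono)
      fix z :: 'a
      have "\<bar>f (x - z) - f x\<bar> * heat t z \<le> L * norm z * heat t z"
        using L(2)[of "x - z" x] by (intro mult_right_mono) auto
      then show "ennreal \<bar>f (x - z) - f x\<bar> * ennreal (heat t z) \<le> ennreal L * ennreal (norm z * heat t z)"
        using L by (simp add: ennreal_mult[symmetric] ennreal_leI mult_ac)
    qed
    also have "\<dots> = ennreal L * (\<integral>\<^sup>+z. ennreal (norm z * heat t (z::'a)) \<partial>lborel)" by (rule nn_integral_cmult) measurable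
    also have "\<dots> \<le> ennreal L * ennreal (c * sqrt t)"
      unfolding c_def using heat_first_moment[OF t] by (intro mult_left_mono) auto
    also have "\<dots> = ennreal (L * c * sqrt t)" using L c t by (simp add: ennreal_mult[symmetric] mult_ac)
    finally show ?thesis using L c t by (simp add: ennreal_le_iff)
  qed
  then show thesis using L c by (intro that[of "L * c"]) auto
qed

text \<open>By Tonelli the L^1 norm is at most the average, against the kernel, of the L^1 norms of
  translation differences. Those are at most twice the norm of \<open>f\<close>, which is good for
  large times, and linear in \<open>norm z\<close>, where the first moment of the kernel gives
  \<open>sqrt t\<close>.\<close>

lemma heat_conv_L1:
  fixes f :: "'a::euclidean_space \<Rightarrow> real"
  assumes f: "f \<in> Cc_inf"
  obtains A B where "0 \<le> A" "0 \<le> B"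
    "\<And>t. 0 < t \<Longrightarrow> (\<integral>\<^sup>+x. ennreal \<bar>f x - heat_conv t f x\<bar> \<partial>lborel) \<le> ennreal (min A (B * sqrt t))"
proof -
  have [measurable]: "f \<in> borel_measurable borel" using f by (rule Cc_inf_measurable)
  obtain B0 where B0: "0 \<le> B0" "\<And>z. (\<integral>\<^sup>+x. ennreal \<bar>f (x - z) - f x\<bar> \<partial>lborel) \<le> ennreal (B0 * norm z)"
    using Cc_inf_L1_translate[OF f] by blast
  define A where "A = 2 * (\<integral>x. \<bar>f x\<bar> \<partial>lborel)"
  have A0: "0 \<le> A" by (simp add: A_def)
  have A: "(\<integral>\<^sup>+x. ennreal \<bar>f (x - z) - f x\<bar> \<partial>lborel) \<le> ennreal A" for z
  proof -
    have "(\<integral>\<^sup>+x. ennreal \<bar>f (x - z) - f x\<bar> \<partial>lborel) \<le> (\<integral>\<^sup>+x. ennreal \<bar>f (x - z)\<bar> + ennreal \<bar>f x\<bar> \<partial>lborel)"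
      by (intro nn_integral_mono) (auto simp: ennreal_plus[symmetric] simp del: ennreal_plus intro!: ennreal_leI)
    also have "\<dots> = (\<integral>\<^sup>+x. ennreal \<bar>f (x - z)\<bar> \<partial>lborel) + (\<integral>\<^sup>+x. ennreal \<bar>f x\<bar> \<partial>lborel)"
      by (rule nn_integral_add) measurable
    also have "(\<integral>\<^sup>+x. ennreal \<bar>f (x - z)\<bar> \<partial>lborel) = (\<integral>\<^sup>+x. ennreal \<bar>f x\<bar> \<partial>lborel)"
      by (rule lborel_nn_integral_affine(2)) measurable
    also have "(\<integral>\<^sup>+x. ennreal \<bar>f x\<bar> \<partial>lborel) = ennreal (\<integral>x. \<bar>f x\<bar> \<partial>lborel)"
      using Cc_inf_integrable[OF f] by (intro nn_integral_eq_integral) auto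
    finally show ?thesis by (simp add: A_def ennreal_plus[symmetric] del: ennreal_plus)
  qed
  define c where "c = 2 * 2 powr (real DIM('a) / 2)"
  have c: "0 \<le> c" by (simp add: c_def)
  show thesis
  proof (rule that[OF A0, of "B0 * c"])
    show "0 \<le> B0 * c" using B0 c by simp
    fix t :: real assume t: "0 < t"
    have "(\<integral>\<^sup>+x. ennreal \<bar>f x - heat_conv t f x\<bar> \<partial>lborel)
       \<le> (\<integral>\<^sup>+x. \<integral>\<^sup>+z. ennreal \<bar>f (x - z) - f x\<bar> * ennreal (heat t z) \<partial>lborel \<partial>lborel)"
      by (intro nn_integral_mono heat_conv_diff f t)
    also have "\<dots> = (\<integral>\<^sup>+z. \<integral>\<^sup>+x. ennreal \<bar>f (x - z) - f x\<bar> * ennreal (heat t z) \<partial>lborel \<partial>lborel)"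
      by (rule lborel_pair.Fubini') measurable
    also have "\<dots> = (\<integral>\<^sup>+z. (\<integral>\<^sup>+x. ennreal \<bar>f (x - z) - f x\<bar> \<partial>lborel) * ennreal (heat t z) \<partial>lborel)"
      by (intro nn_integral_cong nn_integral_multc) measurable
    finally have main: "(\<integral>\<^sup>+x. ennreal \<bar>f x - heat_conv t f x\<bar> \<partial>lborel)
       \<le> (\<integral>\<^sup>+z. (\<integral>\<^sup>+x. ennreal \<bar>f (x - z) - f x\<bar> \<partial>lborel) * ennreal (heat t z) \<partial>lborel)" .
    have 1: "(\<integral>\<^sup>+z. (\<integral>\<^sup>+x. ennreal \<bar>f (x - z) - f x\<bar> \<partial>lborel) * ennreal (heat t z) \<partial>lborel) \<le> ennreal A"
    proof -
      have "(\<integral>\<^sup>+z. (\<integral>\<^sup>+x. ennreal \<bar>f (x - z) - f x\<bar> \<partial>lborel) * ennreal (heat t z) \<partial>lborel)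
        \<le> (\<integral>\<^sup>+z. ennreal A * ennreal (heat t (z::'a)) \<partial>lborel)"
        by (intro nn_integral_mono mult_right_mono A) auto
      also have "\<dots> = ennreal A" using t by (subst nn_integral_cmult) (auto simp: heat_integral(3))
      finally show ?thesis .
    qed
    have 2: "(\<integral>\<^sup>+z. (\<integral>\<^sup>+x. ennreal \<bar>f (x - z) - f x\<bar> \<partial>lborel) * ennreal (heat t z) \<partial>lborel) \<le> ennreal (B0 * c * sqrt t)"
    proof -
      have "(\<integral>\<^sup>+z. (\<integral>\<^sup>+x. ennreal \<bar>f (x - z) - f x\<bar> \<partial>lborel) * ennreal (heat t z) \<partial>lborel)
        \<le> (\<integral>\<^sup>+z. ennreal (B0 * norm z) * ennreal (heat t (z::'a)) \<partial>lborel)"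
        by (intro nn_integral_mono mult_right_mono B0) auto
      also have "\<dots> = (\<integral>\<^sup>+z. ennreal B0 * ennreal (norm z * heat t (z::'a)) \<partial>lborel)"
        using B0 by (intro nn_integral_cong) (simp add: ennreal_mult mult_ac)
      also have "\<dots> = ennreal B0 * (\<integral>\<^sup>+z. ennreal (norm z * heat t (z::'a)) \<partial>lborel)" by (rule nn_integral_cmult) measurable
      also have "\<dots> \<le> ennreal B0 * ennreal (c * sqrt t)"
        unfolding c_def using heat_first_moment[OF t] by (intro mult_left_mono) auto
      also have "\<dots> = ennreal (B0 * c * sqrt t)" using B0 c t by (simp add: ennreal_mult[symmetric] mult_ac)
      finally show ?thesis .
    qed
    show "(\<integral>\<^sup>+x. ennreal \<bar>f x - heat_conv t f x\<bar> \<partial>lborel) \<le> ennreal (min A (B0 * c * sqrt t))"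
      using order_trans[OF main 1] order_trans[OF main 2] by (auto simp: min_def)
  qed
qed

text \<open>Damping by a Gaussian turns the inverse transform into a heat convolution. As the time
  tends to 0, the damped integral converges by domination, since the transform is integrable, and
  the convolution tends to \<open>f x\<close>.\<close>

lemma rfourier_inversion:
  fixes f :: "'a::euclidean_space \<Rightarrow> real"
  assumes f: "f \<in> Cc_inf"
  shows "(\<integral>\<xi>. rfourier f \<xi> * cis (2 * pi * (x \<bullet> \<xi>)) \<partial>lborel) = complex_of_real (f x)"
proof -
  define t where "t k = inverse (real (Suc k))" for k
  have t: "0 < t k" for k by (auto simp: t_def)
  have t0: "t \<longlonglongrightarrow> 0" unfolding t_def by (rule LIMSEQ_inverse_real_of_nat)
  have int: "integrable lborel (rfourier f)" using weighted_rfourier_integrable(2)[OF f, of 1] by simp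
  have [measurable]: "rfourier f \<in> borel_measurable borel" using borel_measurable_integrable[OF int] by simp
  have "(\<lambda>k. \<integral>\<xi>. complex_of_real (exp (- t k * (2 * pi * norm \<xi>)\<^sup>2)) * (rfourier f \<xi> * cis (2 * pi * (x \<bullet> \<xi>))) \<partial>lborel)
     \<longlonglongrightarrow> (\<integral>\<xi>. rfourier f \<xi> * cis (2 * pi * (x \<bullet> \<xi>)) \<partial>lborel)"
  proof (rule integral_dominated_convergence[where w="\<lambda>\<xi>. cmod (rfourier f \<xi>)"])
    show "AE \<xi> in lborel. (\<lambda>k. complex_of_real (exp (- t k * (2 * pi * norm \<xi>)\<^sup>2)) * (rfourier f \<xi> * cis (2 * pi * (x \<bullet> \<xi>))))
        \<longlonglongrightarrow> rfourier f \<xi> * cis (2 * pi * (x \<bullet> \<xi>))"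
    proof (rule AE_I2)
      fix \<xi> :: 'a
      have "(\<lambda>k. complex_of_real (exp (- t k * (2 * pi * norm \<xi>)\<^sup>2)) * (rfourier f \<xi> * cis (2 * pi * (x \<bullet> \<xi>))))
        \<longlonglongrightarrow> complex_of_real (exp (- 0 * (2 * pi * norm \<xi>)\<^sup>2)) * (rfourier f \<xi> * cis (2 * pi * (x \<bullet> \<xi>)))"
        by (intro tendsto_intros t0)
      then show "(\<lambda>k. complex_of_real (exp (- t k * (2 * pi * norm \<xi>)\<^sup>2)) * (rfourier f \<xi> * cis (2 * pi * (x \<bullet> \<xi>))))
        \<longlonglongrightarrow> rfourier f \<xi> * cis (2 * pi * (x \<bullet> \<xi>))" by simp
    qed
    show "AE \<xi> in lborel. norm (complex_of_real (exp (- t k * (2 * pi * norm \<xi>)\<^sup>2)) * (rfourier f \<xi> * cis (2 * pi * (x \<bullet> \<xi>)))) \<le> cmod (rfourier f \<xi>)" for k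
      using less_imp_le[OF t[of k]] by (intro AE_I2) (auto simp: norm_mult intro!: mult_left_le_one_le)
    show "integrable lborel (\<lambda>\<xi>. cmod (rfourier f \<xi>))" using int by (rule integrable_norm)
  qed measurable
  then have 1: "(\<lambda>k. complex_of_real (heat_conv (t k) f x)) \<longlonglongrightarrow> (\<integral>\<xi>. rfourier f \<xi> * cis (2 * pi * (x \<bullet> \<xi>)) \<partial>lborel)"
    using heat_conv_fourier[OF f t] by simp
  obtain C where C: "0 \<le> C" "\<And>t x. 0 < t \<Longrightarrow> \<bar>f x - heat_conv t f x\<bar> \<le> C * sqrt t" using heat_conv_tendsto[OF f] by blast
  have "(\<lambda>k. C * sqrt (t k)) \<longlonglongrightarrow> C * sqrt 0" by (intro tendsto_intros t0)
  then have z: "(\<lambda>k. C * sqrt (t k)) \<longlonglongrightarrow> 0" by simp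
  have "(\<lambda>k. f x - heat_conv (t k) f x) \<longlonglongrightarrow> 0"
    by (rule Lim_null_comparison[OF _ z]) (use C(2) t in auto)
  from tendsto_diff[OF tendsto_const[of "f x"] this] have "(\<lambda>k. heat_conv (t k) f x) \<longlonglongrightarrow> f x" by simp
  then have 2: "(\<lambda>k. complex_of_real (heat_conv (t k) f x)) \<longlonglongrightarrow> complex_of_real (f x)" by (rule tendsto_of_real)
  show ?thesis by (rule LIMSEQ_unique[OF 1 2])
qed

section \<open>Integrability of the fractional Laplacian\<close>

text \<open>A non-integrable function has Bochner integral 0, so the bound covers that case as well,
  and absolute values may be taken inside freely.\<close>

lemma norm_integral_le_nn_integral:
  fixes f :: "'b \<Rightarrow> complex"
  shows "ennreal (cmod (\<integral>x. f x \<partial>M)) \<le> (\<integral>\<^sup>+x. ennreal (cmod (f x)) \<partial>M)"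
  by (cases "integrable M f") (auto simp: not_integrable_integral_eq integral_norm_bound_ennreal)

section \<open>Power integrals behind subordination\<close>

lemma nn_integral_powr_scaling:
  fixes h :: "real \<Rightarrow> real"
  assumes [measurable]: "h \<in> borel_measurable borel" and "\<And>u. 0 \<le> h u" and l: "0 < l"
  shows "(\<integral>\<^sup>+t. ennreal (t powr a * h (l * t)) * indicator {0<..} t \<partial>lborel)
    = ennreal (l powr (- a - 1)) * (\<integral>\<^sup>+u. ennreal (u powr a * h u) * indicator {0<..} u \<partial>lborel)"
proof -
  have pt: "ennreal ((0 + l * t) powr a * h (0 + l * t)) * indicator {0<..} (0 + l * t)
     = ennreal (l powr a) * (ennreal (t powr a * h (l * t)) * indicator {0<..} t)" for t
    using l assms(2)[of "l * t"]
    by (auto simp: indicator_def powr_mult ennreal_mult[symmetric] mult_ac zero_less_mult_iff)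
  have "(\<integral>\<^sup>+u. ennreal (u powr a * h u) * indicator {0<..} u \<partial>lborel)
     = ennreal \<bar>l\<bar> * (\<integral>\<^sup>+t. ennreal ((0 + l * t) powr a * h (0 + l * t)) * indicator {0<..} (0 + l * t) \<partial>lborel)"
    using l by (intro nn_integral_real_affine) auto
  also have "\<dots> = ennreal l * (ennreal (l powr a) * (\<integral>\<^sup>+t. ennreal (t powr a * h (l * t)) * indicator {0<..} t \<partial>lborel))"
    unfolding pt using l by (subst nn_integral_cmult) auto
  finally have "ennreal (l powr (- a - 1)) * (\<integral>\<^sup>+u. ennreal (u powr a * h u) * indicator {0<..} u \<partial>lborel)
     = ennreal (l powr (- a - 1) * l * l powr a) * (\<integral>\<^sup>+t. ennreal (t powr a * h (l * t)) * indicator {0<..} t \<partial>lborel)"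
    using l by (simp add: ennreal_mult mult.assoc)
  also have "l powr (- a - 1) * l * l powr a = l powr (- a - 1) * l powr 1 * l powr a" using l by simp
  also have "\<dots> = 1" using l unfolding powr_add[symmetric] by simp
  finally show ?thesis by simp
qed

lemma ennreal_pos_finite:
  fixes x :: ennreal
  assumes "x < \<infinity>" "0 < x" obtains c where "0 < c" "x = ennreal c"
  using assms by (cases x) auto

text \<open>The substitution \<open>u = l\<^sup>2 * t\<close> extracts the power of
  \<open>l\<close>. The integral in \<open>u\<close> is finite at 0 by
  \<open>1 - exp (- u) \<le> u\<close> and \<open>s < 2\<close>, at infinity by
  \<open>0 < s\<close>; its positivity matters because the fractional Laplacian is later bounded
  after division by it. The absolute value keeps the factor nonnegative for negative arguments, as
  the scaling lemma demands.\<close>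

lemma frac_power_integral:
  assumes s: "0 < s" "s < 2"
  obtains c where "0 < c" "\<And>l. 0 \<le> l \<Longrightarrow>
    (\<integral>\<^sup>+t. ennreal (t powr (- s / 2 - 1) * (1 - exp (- \<bar>l\<^sup>2 * t\<bar>))) * indicator {0<..} t \<partial>lborel) = ennreal (c * l powr s)"
proof -
  define I where "I = (\<integral>\<^sup>+u. ennreal (u powr (- s / 2 - 1) * (1 - exp (- \<bar>u\<bar>))) * indicator {0<..} u \<partial>lborel)"
  have "I \<le> (\<integral>\<^sup>+u. ennreal (u powr (- s / 2)) * indicator {0<..<1} u + ennreal (u powr (- s / 2 - 1)) * indicator {1<..} u \<partial>lborel)"
    unfolding I_def
  proof (rule nn_integral_mono_AE, rule AE_mp[OF AE_lborel_singleton[of 1]], rule AE_I2, rule impI)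
    fix u :: real assume "u \<noteq> 1"
    then consider "u \<le> 0" | "0 < u" "u < 1" | "1 < u" by linarith
    then show "ennreal (u powr (- s / 2 - 1) * (1 - exp (- \<bar>u\<bar>))) * indicator {0<..} u
      \<le> ennreal (u powr (- s / 2)) * indicator {0<..<1} u + ennreal (u powr (- s / 2 - 1)) * indicator {1<..} u"
    proof cases
      case 2
      have "1 - exp (- u) \<le> u" using exp_ge_add_one_self[of "- u"] by simp
      then have "u powr (- s / 2 - 1) * (1 - exp (- u)) \<le> u powr (- s / 2 - 1) * u"
        by (intro mult_left_mono) auto
      also have "\<dots> = u powr (- s / 2)" using 2 powr_add[of u "- s / 2 - 1" 1] by simp
      finally show ?thesis using 2 by (simp add: ennreal_leI)
    next
      case 3
      have "u powr (- s / 2 - 1) * (1 - exp (- u)) \<le> u powr (- s / 2 - 1) * 1" by (intro mult_left_mono) auto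
      then show ?thesis using 3 by (simp add: ennreal_leI)
    qed simp
  qed
  also have "\<dots> < \<infinity>" using s
    by (subst nn_integral_add) (auto simp: nn_integral_powr_from_0 nn_integral_powr_to_inf)
  finally have fin: "I < \<infinity>" .
  \<comment> \<open>For \<open>u > 1\<close> one has \<open>exp u \<ge> 2\<close>, hence
    \<open>1 - exp (- u) \<ge> 1 / 2\<close>; this already makes the integral positive.\<close>
  define d :: real where "d = 1 / 2"
  have d: "0 < d" by (simp add: d_def)
  then have "0 < ennreal d * (\<integral>\<^sup>+u. ennreal (u powr (- s / 2 - 1)) * indicator {1<..} u \<partial>lborel)"
    using s by (subst nn_integral_powr_to_inf) (auto simp: ennreal_zero_less_mult_iff)
  also have "\<dots> = (\<integral>\<^sup>+u. ennreal d * (ennreal (u powr (- s / 2 - 1)) * indicator {1<..} u) \<partial>lborel)"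
    by (rule nn_integral_cmult[symmetric]) measurable
  also have "\<dots> \<le> I" unfolding I_def
  proof (rule nn_integral_mono)
    fix u :: real
    show "ennreal d * (ennreal (u powr (- s / 2 - 1)) * indicator {1<..} u)
      \<le> ennreal (u powr (- s / 2 - 1) * (1 - exp (- \<bar>u\<bar>))) * indicator {0<..} u"
    proof (cases "1 < u")
      case True
      have "2 \<le> exp u" using exp_ge_add_one_self[of u] True by linarith
      then have "exp (- u) \<le> 1 / 2" by (simp add: exp_minus field_simps)
      then have "u powr (- s / 2 - 1) * d \<le> u powr (- s / 2 - 1) * (1 - exp (- u))"
        by (intro mult_left_mono) (auto simp: d_def)
      then show ?thesis using True d by (simp add: ennreal_mult[symmetric] ennreal_leI mult.commute)
    qed simp
  qed
  finally have pos: "0 < I" .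
  obtain c where c: "0 < c" "I = ennreal c" using ennreal_pos_finite[OF fin pos] by blast
  show thesis
  proof (rule that[OF c(1)])
    fix l :: real assume "0 \<le> l"
    show "(\<integral>\<^sup>+t. ennreal (t powr (- s / 2 - 1) * (1 - exp (- \<bar>l\<^sup>2 * t\<bar>))) * indicator {0<..} t \<partial>lborel) = ennreal (c * l powr s)"
    proof (cases "l = 0")
      case False
      then have l: "0 < l" using \<open>0 \<le> l\<close> by simp
      have "(\<integral>\<^sup>+t. ennreal (t powr (- s / 2 - 1) * (1 - exp (- \<bar>l\<^sup>2 * t\<bar>))) * indicator {0<..} t \<partial>lborel)
         = ennreal ((l\<^sup>2) powr (- (- s / 2 - 1) - 1)) * I"
        unfolding I_def using l by (intro nn_integral_powr_scaling[where h="\<lambda>u. 1 - exp (- \<bar>u\<bar>)"]) auto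
      also have "(l\<^sup>2) powr (- (- s / 2 - 1) - 1) = l powr s"
        using l by (simp add: powr_powr flip: powr_numeral)
      finally show ?thesis using c by (simp add: ennreal_mult[symmetric] mult.commute)
    qed simp
  qed
qed

text \<open>The constant is the Gamma function at \<open>s / 2\<close>. Its finiteness and
  positivity come from comparison with pure powers on the two sides of 1.\<close>

lemma gamma_power_integral:
  assumes s: "0 < s" "s < 2"
  obtains c where "0 < c" "\<And>l. 0 < l \<Longrightarrow>
    (\<integral>\<^sup>+t. ennreal (t powr (s / 2 - 1) * exp (- (l\<^sup>2 * t))) * indicator {0<..} t \<partial>lborel) = ennreal (c * l powr (- s))"
proof -
  define I where "I = (\<integral>\<^sup>+u. ennreal (u powr (s / 2 - 1) * exp (- u)) * indicator {0<..} u \<partial>lborel)"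
  have "I \<le> (\<integral>\<^sup>+u. ennreal (u powr (s / 2 - 1)) * indicator {0<..<1} u + ennreal (u powr (s / 2 - 2)) * indicator {1<..} u \<partial>lborel)"
    unfolding I_def
  proof (rule nn_integral_mono_AE, rule AE_mp[OF AE_lborel_singleton[of 1]], rule AE_I2, rule impI)
    fix u :: real assume "u \<noteq> 1"
    then consider "u \<le> 0" | "0 < u" "u < 1" | "1 < u" by linarith
    then show "ennreal (u powr (s / 2 - 1) * exp (- u)) * indicator {0<..} u
      \<le> ennreal (u powr (s / 2 - 1)) * indicator {0<..<1} u + ennreal (u powr (s / 2 - 2)) * indicator {1<..} u"
    proof cases
      case 2
      have "u powr (s / 2 - 1) * exp (- u) \<le> u powr (s / 2 - 1) * 1" using 2 by (intro mult_left_mono) auto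
      then show ?thesis using 2 by (simp add: ennreal_leI)
    next
      case 3
      have "u \<le> exp u" using exp_ge_add_one_self[of u] by linarith
      then have "exp (- u) \<le> 1 / u" using 3 by (simp add: exp_minus field_simps)
      then have "u powr (s / 2 - 1) * exp (- u) \<le> u powr (s / 2 - 1) * (1 / u)" by (intro mult_left_mono) auto
      also have "\<dots> = u powr (s / 2 - 2)" using 3 powr_diff[of u "s / 2 - 1" 1] by simp
      finally show ?thesis using 3 by (simp add: ennreal_leI)
    qed simp
  qed
  also have "\<dots> < \<infinity>" using s
    by (subst nn_integral_add) (auto simp: nn_integral_powr_from_0 nn_integral_powr_to_inf)
  finally have fin: "I < \<infinity>" .
  have "0 < ennreal (exp (- 1)) * (\<integral>\<^sup>+u. ennreal (u powr (s / 2 - 1)) * indicator {0<..<1} u \<partial>lborel)"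
    using s by (subst nn_integral_powr_from_0) (auto simp: ennreal_zero_less_mult_iff)
  also have "\<dots> = (\<integral>\<^sup>+u. ennreal (exp (- 1)) * (ennreal (u powr (s / 2 - 1)) * indicator {0<..<1} u) \<partial>lborel)"
    by (rule nn_integral_cmult[symmetric]) measurable
  also have "\<dots> \<le> I" unfolding I_def
  proof (rule nn_integral_mono)
    fix u :: real
    show "ennreal (exp (- 1)) * (ennreal (u powr (s / 2 - 1)) * indicator {0<..<1} u)
      \<le> ennreal (u powr (s / 2 - 1) * exp (- u)) * indicator {0<..} u"
    proof (cases "0 < u \<and> u < 1")
      case True
      then have "u powr (s / 2 - 1) * exp (- 1) \<le> u powr (s / 2 - 1) * exp (- u)"
        by (intro mult_left_mono) auto
      then show ?thesis using True by (simp add: ennreal_mult[symmetric] ennreal_leI mult.commute)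
    qed auto
  qed
  finally have pos: "0 < I" .
  obtain c where c: "0 < c" "I = ennreal c" using ennreal_pos_finite[OF fin pos] by blast
  show thesis
  proof (rule that[OF c(1)])
    fix l :: real assume l: "0 < l"
    have "(\<integral>\<^sup>+t. ennreal (t powr (s / 2 - 1) * exp (- (l\<^sup>2 * t))) * indicator {0<..} t \<partial>lborel)
       = ennreal ((l\<^sup>2) powr (- (s / 2 - 1) - 1)) * I"
      unfolding I_def using l by (intro nn_integral_powr_scaling[where h="\<lambda>u. exp (- u)"]) auto
    also have "(l\<^sup>2) powr (- (s / 2 - 1) - 1) = l powr (- s)"
      using l by (simp add: powr_powr flip: powr_numeral)
    finally show "(\<integral>\<^sup>+t. ennreal (t powr (s / 2 - 1) * exp (- (l\<^sup>2 * t))) * indicator {0<..} t \<partial>lborel) = ennreal (c * l powr (- s))"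
      using c by (simp add: ennreal_mult[symmetric] mult.commute)
  qed
qed

abbreviation (input) rfrac_lap :: "real \<Rightarrow> ('a::euclidean_space \<Rightarrow> real) \<Rightarrow> 'a \<Rightarrow> complex" where
  "rfrac_lap s f \<equiv> frac_lap s (\<lambda>y. complex_of_real (f y))"

lemma rfourier_measurable: "f \<in> Cc_inf \<Longrightarrow> rfourier f \<in> borel_measurable borel"
  using Cc_inf_measurable by (intro fourier_measurable) measurable

lemma rfrac_lap_measurable:
  fixes f :: "'a::euclidean_space \<Rightarrow> real"
  assumes "f \<in> Cc_inf" shows "rfrac_lap s f \<in> borel_measurable borel"
proof -
  have [measurable]: "rfourier f \<in> borel_measurable borel" using assms by (rule rfourier_measurable)
  show ?thesis unfolding frac_lap_def[abs_def] by measurable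
qed

lemma rfrac_lap_bounded:
  fixes f :: "'a::euclidean_space \<Rightarrow> real"
  shows "\<exists>B. \<forall>x. cmod (rfrac_lap s f x) \<le> B"
proof (intro exI allI)
  fix x
  show "cmod (rfrac_lap s f x) \<le> (\<integral>\<xi>. cmod (complex_of_real ((2 * pi * norm \<xi>) powr s) * rfourier f \<xi>) \<partial>lborel)"
    unfolding frac_lap_def by (rule order_trans[OF integral_norm_bound]) (simp add: norm_mult)
qed

text \<open>Subordination: \<open>\<lambda>\<^sup>s\<close> is a multiple of \<open>\<integral> t\<^bsup>-s/2-1\<^esup> (1 - exp (- t \<lambda>\<^sup>2)) dt\<close>, so the fractional
  Laplacian is a superposition of the differences \<open>f - heat_conv t f\<close>, whose \<open>L\<^sup>1\<close> norms are
  \<open>O(min 1 (sqrt t))\<close>.\<close>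

lemma rfrac_lap_heat_bound:
  fixes f :: "'a::euclidean_space \<Rightarrow> real"
  assumes f: "f \<in> Cc_inf" and s: "0 < s" "s < 1"
  obtains c where "0 < c" "\<And>x. ennreal (c * cmod (rfrac_lap s f x))
    \<le> (\<integral>\<^sup>+t. ennreal (t powr (- s / 2 - 1)) * indicator {0<..} t * ennreal \<bar>f x - heat_conv t f x\<bar> \<partial>lborel)"
proof -
  obtain c where c: "0 < c" and ci: "\<And>l. 0 \<le> l \<Longrightarrow>
    (\<integral>\<^sup>+t. ennreal (t powr (- s / 2 - 1) * (1 - exp (- \<bar>l\<^sup>2 * t\<bar>))) * indicator {0<..} t \<partial>lborel) = ennreal (c * l powr s)"
    using frac_power_integral[of s] s by auto
  have [measurable]: "rfourier f \<in> borel_measurable borel" using f by (rule rfourier_measurable)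
  define w where "w t \<xi> = t powr (- s / 2 - 1) * (1 - exp (- \<bar>(2 * pi * norm \<xi>)\<^sup>2 * t\<bar>)) * indicator {0<..} t" for t :: real and \<xi> :: 'a
  have w0: "0 \<le> w t \<xi>" for t \<xi> by (simp add: w_def)
  have [measurable]: "(\<lambda>(t, \<xi>). w t \<xi>) \<in> borel_measurable (borel \<Otimes>\<^sub>M borel)" unfolding w_def by measurable
  have [measurable]: "(\<lambda>t. w t \<xi>) \<in> borel_measurable borel" for \<xi> unfolding w_def by measurable
  have wn: "(\<integral>\<^sup>+t. ennreal (w t \<xi>) \<partial>lborel) = ennreal (c * (2 * pi * norm \<xi>) powr s)" for \<xi>
    unfolding ci[of "2 * pi * norm \<xi>", simplified, symmetric] w_def
    by (intro nn_integral_cong) (auto simp: indicator_def)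
  have wi: "(\<integral>t. w t \<xi> \<partial>lborel) = c * (2 * pi * norm \<xi>) powr s" for \<xi>
    using w0 c by (subst integral_eq_nn_integral) (auto simp: wn)
  have mint: "integrable lborel (\<lambda>\<xi>. complex_of_real ((2 * pi * norm \<xi>) powr s) * rfourier f \<xi>)"
    and fint: "integrable lborel (rfourier f)"
    using weighted_rfourier_integrable[OF f, of s] s by auto
  show thesis
  proof (rule that[OF c])
    fix x :: 'a
    define H where "H t \<xi> = complex_of_real (w t \<xi>) * (rfourier f \<xi> * cis (2 * pi * (x \<bullet> \<xi>)))" for t \<xi>
    have Hm: "case_prod H \<in> borel_measurable (lborel \<Otimes>\<^sub>M lborel)" unfolding H_def by measurable
    \<comment> \<open>Integrating the weight in \<open>t\<close> first returns a multiple of the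
      multiplier, so absolute convergence of \<open>H\<close> amounts to integrability of the
      multiplier times the transform.\<close>
    have "integrable (lborel \<Otimes>\<^sub>M lborel) (case_prod H)"
    proof (rule integrableI_bounded[OF Hm])
      have "(\<integral>\<^sup>+z. ennreal (norm (case_prod H z)) \<partial>(lborel \<Otimes>\<^sub>M lborel))
         = (\<integral>\<^sup>+\<xi>. \<integral>\<^sup>+t. ennreal (norm (case_prod H (t, \<xi>))) \<partial>lborel \<partial>lborel)"
        unfolding H_def by (intro lborel_pair.nn_integral_snd[symmetric]) measurable
      also have "\<dots> = (\<integral>\<^sup>+\<xi>. \<integral>\<^sup>+t. ennreal (w t \<xi>) * ennreal (cmod (rfourier f \<xi>)) \<partial>lborel \<partial>lborel)"
        using w0 by (intro nn_integral_cong) (simp add: H_def norm_mult ennreal_mult)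
      also have "\<dots> = (\<integral>\<^sup>+\<xi>. ennreal (c * (2 * pi * norm \<xi>) powr s) * ennreal (cmod (rfourier f \<xi>)) \<partial>lborel)"
        by (intro nn_integral_cong) (simp add: nn_integral_multc wn)
      also have "\<dots> = (\<integral>\<^sup>+\<xi>. ennreal c * ennreal (norm (complex_of_real ((2 * pi * norm \<xi>) powr s) * rfourier f \<xi>)) \<partial>lborel)"
        using c by (intro nn_integral_cong) (simp add: norm_mult ennreal_mult mult.assoc)
      also have "\<dots> = ennreal c * (\<integral>\<^sup>+\<xi>. ennreal (norm (complex_of_real ((2 * pi * norm \<xi>) powr s) * rfourier f \<xi>)) \<partial>lborel)"
        by (rule nn_integral_cmult) measurable
      also have "\<dots> < \<infinity>" using mint by (auto simp: integrable_iff_bounded ennreal_mult_less_top)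
      finally show "(\<integral>\<^sup>+z. ennreal (norm (case_prod H z)) \<partial>(lborel \<Otimes>\<^sub>M lborel)) < \<infinity>" .
    qed
    then have fub: "(\<integral>\<xi>. \<integral>t. H t \<xi> \<partial>lborel \<partial>lborel) = (\<integral>t. \<integral>\<xi>. H t \<xi> \<partial>lborel \<partial>lborel)"
      by (rule lborel_pair.Fubini_integral)
    have "(\<integral>\<xi>. \<integral>t. H t \<xi> \<partial>lborel \<partial>lborel)
       = (\<integral>\<xi>. complex_of_real c * (complex_of_real ((2 * pi * norm \<xi>) powr s) * rfourier f \<xi> * cis (2 * pi * (x \<bullet> \<xi>))) \<partial>lborel)"
      unfolding H_def integral_mult_left_zero integral_complex_of_real wi by (simp add: mult.assoc)
    also have "\<dots> = complex_of_real c * rfrac_lap s f x" by (simp add: frac_lap_def)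
    finally have F: "complex_of_real c * rfrac_lap s f x = (\<integral>t. \<integral>\<xi>. H t \<xi> \<partial>lborel \<partial>lborel)" using fub by simp
    \<comment> \<open>For fixed \<open>t\<close> the 1 in the weight yields \<open>f x\<close> by
      inversion, and the exponential yields the heat convolution.\<close>
    have inner: "(\<integral>\<xi>. H t \<xi> \<partial>lborel) = complex_of_real (t powr (- s / 2 - 1) * indicator {0<..} t * (f x - heat_conv t f x))" for t
    proof (cases "0 < t")
      case True
      have i1: "integrable lborel (\<lambda>\<xi>. rfourier f \<xi> * cis (2 * pi * (x \<bullet> \<xi>)))"
        by (intro cis_mult_integrable fint) measurable
      have i2: "integrable lborel (\<lambda>\<xi>. complex_of_real (exp (- t * (2 * pi * norm \<xi>)\<^sup>2)) * (rfourier f \<xi> * cis (2 * pi * (x \<bullet> \<xi>))))"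
        by (rule Bochner_Integration.integrable_bound[OF fint])
           (use True in \<open>auto simp: norm_mult intro!: mult_left_le_one_le AE_I2\<close>)
      have "H t \<xi> = complex_of_real (t powr (- s / 2 - 1)) * (rfourier f \<xi> * cis (2 * pi * (x \<bullet> \<xi>))
          - complex_of_real (exp (- t * (2 * pi * norm \<xi>)\<^sup>2)) * (rfourier f \<xi> * cis (2 * pi * (x \<bullet> \<xi>))))" for \<xi>
        using True by (simp add: H_def w_def algebra_simps)
      then have "(\<integral>\<xi>. H t \<xi> \<partial>lborel) = complex_of_real (t powr (- s / 2 - 1)) *
          (\<integral>\<xi>. (rfourier f \<xi> * cis (2 * pi * (x \<bullet> \<xi>))
          - complex_of_real (exp (- t * (2 * pi * norm \<xi>)\<^sup>2)) * (rfourier f \<xi> * cis (2 * pi * (x \<bullet> \<xi>)))) \<partial>lborel)"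
        by (simp only: integral_mult_right_zero)
      also have "(\<integral>\<xi>. (rfourier f \<xi> * cis (2 * pi * (x \<bullet> \<xi>))
          - complex_of_real (exp (- t * (2 * pi * norm \<xi>)\<^sup>2)) * (rfourier f \<xi> * cis (2 * pi * (x \<bullet> \<xi>)))) \<partial>lborel)
          = complex_of_real (f x) - complex_of_real (heat_conv t f x)"
        unfolding Bochner_Integration.integral_diff[OF i1 i2] rfourier_inversion[OF f] heat_conv_fourier[OF f True] ..
      finally show ?thesis using True by simp
    qed (simp add: H_def w_def)
    have "ennreal (c * cmod (rfrac_lap s f x)) = ennreal (cmod (\<integral>t. \<integral>\<xi>. H t \<xi> \<partial>lborel \<partial>lborel))"
      unfolding F[symmetric] using c by (simp add: norm_mult)
    also have "\<dots> \<le> (\<integral>\<^sup>+t. ennreal (cmod (\<integral>\<xi>. H t \<xi> \<partial>lborel)) \<partial>lborel)" by (rule norm_integral_le_nn_integral)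
    also have "\<dots> = (\<integral>\<^sup>+t. ennreal (t powr (- s / 2 - 1)) * indicator {0<..} t * ennreal \<bar>f x - heat_conv t f x\<bar> \<partial>lborel)"
      unfolding inner norm_of_real by (intro nn_integral_cong) (auto simp: indicator_def abs_mult ennreal_mult)
    finally show "ennreal (c * cmod (rfrac_lap s f x))
       \<le> (\<integral>\<^sup>+t. ennreal (t powr (- s / 2 - 1)) * indicator {0<..} t * ennreal \<bar>f x - heat_conv t f x\<bar> \<partial>lborel)" .
  qed
qed

text \<open>Decay of the transform gives boundedness, not integrability in \<open>x\<close>; that
  comes from the heat differences. Against \<open>t powr (- s / 2 - 1)\<close> the bound
  \<open>B * sqrt t\<close> of their L^1 norms is integrable at 0 exactly because
  \<open>s < 1\<close>, and the bound \<open>A\<close> at infinity because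
  \<open>0 < s\<close>.\<close>

lemma rfrac_lap_integrable:
  fixes f :: "'a::euclidean_space \<Rightarrow> real"
  assumes f: "f \<in> Cc_inf" and s: "0 < s" "s < 1"
  shows "integrable lborel (rfrac_lap s f)"
proof -
  have [measurable]: "f \<in> borel_measurable borel" using f by (rule Cc_inf_measurable)
  have [measurable]: "rfrac_lap s f \<in> borel_measurable borel" using f by (rule rfrac_lap_measurable)
  obtain c where c: "0 < c" "\<And>x. ennreal (c * cmod (rfrac_lap s f x))
    \<le> (\<integral>\<^sup>+t. ennreal (t powr (- s / 2 - 1)) * indicator {0<..} t * ennreal \<bar>f x - heat_conv t f x\<bar> \<partial>lborel)"
    using rfrac_lap_heat_bound[OF f s] by blast
  obtain A B where AB: "0 \<le> A" "0 \<le> B"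
    "\<And>t. 0 < t \<Longrightarrow> (\<integral>\<^sup>+x. ennreal \<bar>f x - heat_conv t f x\<bar> \<partial>lborel) \<le> ennreal (min A (B * sqrt t))"
    using heat_conv_L1[OF f] by blast
  have "ennreal c * (\<integral>\<^sup>+x. ennreal (cmod (rfrac_lap s f x)) \<partial>lborel) = (\<integral>\<^sup>+x. ennreal (c * cmod (rfrac_lap s f x)) \<partial>lborel)"
    using c by (subst nn_integral_cmult[symmetric]) (auto simp: ennreal_mult)
  also have "\<dots> \<le> (\<integral>\<^sup>+x. \<integral>\<^sup>+t. ennreal (t powr (- s / 2 - 1)) * indicator {0<..} t * ennreal \<bar>f x - heat_conv t f x\<bar> \<partial>lborel \<partial>lborel)"
    by (intro nn_integral_mono c)
  also have "\<dots> = (\<integral>\<^sup>+t. \<integral>\<^sup>+x. ennreal (t powr (- s / 2 - 1)) * indicator {0<..} t * ennreal \<bar>f x - heat_conv t f x\<bar> \<partial>lborel \<partial>lborel)"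
    by (rule lborel_pair.Fubini') measurable
  also have "\<dots> = (\<integral>\<^sup>+t. ennreal (t powr (- s / 2 - 1)) * indicator {0<..} t * (\<integral>\<^sup>+x. ennreal \<bar>f x - heat_conv t f x\<bar> \<partial>lborel) \<partial>lborel)"
    by (intro nn_integral_cong nn_integral_cmult) measurable
  also have "\<dots> \<le> (\<integral>\<^sup>+t. ennreal B * (ennreal (t powr (- s / 2 - 1 / 2)) * indicator {0<..<1} t) + ennreal A * (ennreal (t powr (- s / 2 - 1)) * indicator {1<..} t) \<partial>lborel)"
  proof (rule nn_integral_mono_AE, rule AE_mp[OF AE_lborel_singleton[of 1]], rule AE_I2, rule impI)
    fix t :: real assume "t \<noteq> 1"
    then consider "t \<le> 0" | "0 < t" "t < 1" | "1 < t" by linarith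
    then show "ennreal (t powr (- s / 2 - 1)) * indicator {0<..} t * (\<integral>\<^sup>+x. ennreal \<bar>f x - heat_conv t f x\<bar> \<partial>lborel)
      \<le> ennreal B * (ennreal (t powr (- s / 2 - 1 / 2)) * indicator {0<..<1} t) + ennreal A * (ennreal (t powr (- s / 2 - 1)) * indicator {1<..} t)"
    proof cases
      case 2
      have "ennreal (t powr (- s / 2 - 1)) * (\<integral>\<^sup>+x. ennreal \<bar>f x - heat_conv t f x\<bar> \<partial>lborel)
         \<le> ennreal (t powr (- s / 2 - 1)) * ennreal (B * sqrt t)"
        using AB(3)[OF 2(1)] by (intro mult_left_mono) (auto intro: order_trans[OF _ ennreal_leI])
      also have "\<dots> = ennreal (B * (t powr (- s / 2 - 1) * t powr (1 / 2)))"
        using 2 AB by (simp add: ennreal_mult[symmetric] powr_half_sqrt mult_ac)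
      also have "t powr (- s / 2 - 1) * t powr (1 / 2) = t powr (- s / 2 - 1 / 2)"
        unfolding powr_add[symmetric] by (rule arg_cong[where f="\<lambda>a. t powr a"]) (simp add: field_simps)
      finally show ?thesis using 2 AB by (simp add: ennreal_mult)
    next
      case 3
      have "ennreal (t powr (- s / 2 - 1)) * (\<integral>\<^sup>+x. ennreal \<bar>f x - heat_conv t f x\<bar> \<partial>lborel)
         \<le> ennreal (t powr (- s / 2 - 1)) * ennreal A"
        using AB(3)[of t] 3 by (intro mult_left_mono) (auto intro: order_trans[OF _ ennreal_leI])
      then show ?thesis using 3 by (simp add: mult.commute)
    qed simp
  qed
  also have "\<dots> < \<infinity>" using s
    by (subst nn_integral_add) (auto simp: nn_integral_cmult nn_integral_powr_from_0 nn_integral_powr_to_inf ennreal_mult_less_top)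
  finally have "(\<integral>\<^sup>+x. ennreal (cmod (rfrac_lap s f x)) \<partial>lborel) < \<infinity>"
    using c by (auto simp: ennreal_mult_less_top)
  then show ?thesis by (intro integrableI_bounded) auto
qed

section \<open>Riesz potentials\<close>

text \<open>For \<open>0 < s < n\<close>, with \<open>n\<close> the dimension, and
  \<open>z \<noteq> 0\<close> this is a multiple of the Riesz kernel
  \<open>norm z powr (s - n)\<close>. The subordinated form lets the heat kernel identities apply,
  and an upper bound by the power is enough. At \<open>z = 0\<close> the integral diverges, and its
  Bochner value is 0.\<close>

definition riesz :: "real \<Rightarrow> 'a::euclidean_space \<Rightarrow> real" where
  "riesz s z = (\<integral>t. t powr (s / 2 - 1) * heat t z * indicator {0<..} t \<partial>lborel)"

text \<open>The extended value, infinite where the Bochner integral defaults to 0; estimates and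
  Tonelli exchanges are made for this version.\<close>

definition riesz_nn :: "real \<Rightarrow> 'a::euclidean_space \<Rightarrow> ennreal" where
  "riesz_nn s z = (\<integral>\<^sup>+t. ennreal (t powr (s / 2 - 1) * heat t z * indicator {0<..} t) \<partial>lborel)"

lemma riesz_measurable [measurable (raw)]:
  assumes [measurable]: "g \<in> measurable M (borel :: 'a::euclidean_space measure)"
  shows "(\<lambda>w. riesz s (g w)) \<in> borel_measurable M"
  unfolding riesz_def by measurable

lemma riesz_nn_measurable [measurable (raw)]:
  assumes [measurable]: "g \<in> measurable M (borel :: 'a::euclidean_space measure)"
  shows "(\<lambda>w. riesz_nn s (g w)) \<in> borel_measurable M"
  unfolding riesz_nn_def by measurable

lemma riesz_nonneg: "0 \<le> riesz s z"
  unfolding riesz_def by (intro Bochner_Integration.integral_nonneg) auto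

lemma riesz_commute: "riesz s (x - y) = riesz s (y - x)"
  by (simp add: riesz_def heat_commute)

lemma riesz_le_nn: "ennreal (riesz s z) \<le> riesz_nn s z"
  unfolding riesz_nn_def riesz_def
  by (cases "integrable lborel (\<lambda>t. t powr (s / 2 - 1) * heat t z * indicator {0<..} t)")
     (auto simp: not_integrable_integral_eq nn_integral_eq_integral)

text \<open>The inequality \<open>sqrt v \<le> n * exp (v / n)\<close> raised to the n-th power.
  With \<open>v\<close> the Gaussian exponent it converts exponential decay into a power of the
  distance.\<close>

lemma powr_half_le_exp:
  fixes v :: real and n :: nat
  assumes "0 < v" "0 < n" shows "v powr (real n / 2) \<le> real n ^ n * exp v"
proof -
  have "sqrt v \<le> 1 + v" using assms by (intro real_le_lsqrt) (auto simp: power2_eq_square algebra_simps)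
  also have "\<dots> \<le> real n + v" using assms by simp
  also have "\<dots> = real n * (1 + v / real n)" using assms by (simp add: field_simps)
  also have "\<dots> \<le> real n * exp (v / real n)" by (intro mult_left_mono exp_ge_add_one_self) auto
  finally have "sqrt v ^ n \<le> (real n * exp (v / real n)) ^ n" using assms by (intro power_mono) auto
  also have "\<dots> = real n ^ n * exp v" using assms by (simp add: power_mult_distrib exp_of_nat_mult[symmetric])
  also have "sqrt v ^ n = v powr (real n / 2)"
    using assms by (simp add: powr_half_sqrt[symmetric] powr_realpow[symmetric] powr_powr)
  finally show ?thesis .
qed

text \<open>The first bound drops the exponential and serves times above
  \<open>(norm z)\<^sup>2\<close>. The second spends the exponential on a power in which
  \<open>t\<close> cancels, and serves smaller times.\<close>

lemma heat_le:
  fixes z :: "'a::euclidean_space"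
  assumes t: "0 < t"
  shows "heat t z \<le> t powr (- (real DIM('a) / 2))"
    and "z \<noteq> 0 \<Longrightarrow> heat t z \<le> real DIM('a) ^ DIM('a) * norm z powr (- real DIM('a))"
proof -
  define n where "n = real DIM('a)"
  have n: "0 < n" by (simp add: n_def)
  have p1: "t powr (n / 2) \<le> (4 * pi * t) powr (n / 2)"
    using t n pi_gt3 by (intro powr_mono2) auto
  have "heat t z \<le> 1 / (4 * pi * t) powr (n / 2)"
    unfolding heat_def n_def using t by (intro divide_right_mono) auto
  also have "\<dots> \<le> 1 / t powr (n / 2)" using p1 t by (intro divide_left_mono) auto
  finally show "heat t z \<le> t powr (- (real DIM('a) / 2))" by (simp add: powr_minus n_def inverse_eq_divide)
  assume z: "z \<noteq> 0"
  define v where "v = (norm z)\<^sup>2 / (4 * t)"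
  have v: "0 < v" using t z by (simp add: v_def)
  have "v powr (n / 2) * exp (- v) \<le> real DIM('a) ^ DIM('a)"
    using powr_half_le_exp[OF v, of "DIM('a)"] by (simp add: n_def exp_minus field_simps)
  then have "exp (- v) \<le> real DIM('a) ^ DIM('a) / v powr (n / 2)" using v by (simp add: field_simps)
  then have "heat t z \<le> (real DIM('a) ^ DIM('a) / v powr (n / 2)) / (4 * pi * t) powr (n / 2)"
    unfolding heat_def n_def v_def using t by (intro divide_right_mono) auto
  also have "\<dots> = real DIM('a) ^ DIM('a) / (v * (4 * pi * t)) powr (n / 2)"
    using v t by (simp add: powr_mult)
  also have "v * (4 * pi * t) = pi * (norm z)\<^sup>2" using t by (simp add: v_def)
  also have "real DIM('a) ^ DIM('a) / (pi * (norm z)\<^sup>2) powr (n / 2) \<le> real DIM('a) ^ DIM('a) / ((norm z)\<^sup>2) powr (n / 2)"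
    using z n pi_gt3 by (intro divide_left_mono powr_mono2) auto
  also have "((norm z)\<^sup>2) powr (n / 2) = norm z powr n"
    using z by (simp add: powr_powr flip: powr_numeral)
  finally show "heat t z \<le> real DIM('a) ^ DIM('a) * norm z powr (- real DIM('a))"
    by (simp add: powr_minus n_def field_simps)
qed

text \<open>The time integral is split at \<open>(norm z)\<^sup>2\<close>, where the two bounds of
  \<open>heat_le\<close> are of the same order. Convergence uses \<open>0 < s\<close> below and
  \<open>s < n\<close> above, and both pieces scale like \<open>norm z powr (s - n)\<close>, with
  \<open>n\<close> the dimension.\<close>

lemma riesz_nn_le:
  assumes s: "0 < s" "s < real DIM('a::euclidean_space)"
  obtains C where "0 < C" "\<And>z::'a. z \<noteq> 0 \<Longrightarrow> riesz_nn s z \<le> ennreal (C * norm z powr (s - real DIM('a)))"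
proof -
  define n where "n = real DIM('a)"
  define D where "D = real DIM('a) ^ DIM('a)"
  have n: "0 < n" and ns: "s < n" using s by (auto simp: n_def)
  have D: "0 < D" by (simp add: D_def)
  define C where "C = D * (2 / s) + 2 / (n - s)"
  have C: "0 < C" using D s ns by (simp add: C_def add_pos_pos)
  show thesis
  proof (rule that[OF C])
    fix z :: 'a assume z: "z \<noteq> 0"
    define T where "T = (norm z)\<^sup>2"
    have T: "0 < T" using z by (simp add: T_def)
    have Tp: "T powr a = norm z powr (2 * a)" for a using z by (simp add: T_def powr_powr flip: powr_numeral)
    define d where "d = D * norm z powr (- n)"
    have d: "0 \<le> d" using D by (simp add: d_def)
    have "riesz_nn s z \<le> (\<integral>\<^sup>+t. ennreal d * (ennreal (t powr (s / 2 - 1)) * indicator {0<..<T} t)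
         + ennreal (t powr (s / 2 - n / 2 - 1)) * indicator {T<..} t \<partial>lborel)"
      unfolding riesz_nn_def
    proof (rule nn_integral_mono_AE, rule AE_mp[OF AE_lborel_singleton[of T]], rule AE_I2, rule impI)
      fix t assume "t \<noteq> T"
      then consider "t \<le> 0" | "0 < t" "t < T" | "0 < t" "T < t" using T by linarith
      then show "ennreal (t powr (s / 2 - 1) * heat t z * indicator {0<..} t)
        \<le> ennreal d * (ennreal (t powr (s / 2 - 1)) * indicator {0<..<T} t) + ennreal (t powr (s / 2 - n / 2 - 1)) * indicator {T<..} t"
      proof cases
        case 2
        have "t powr (s / 2 - 1) * heat t z \<le> t powr (s / 2 - 1) * d"
          unfolding d_def D_def n_def using 2 z by (intro mult_left_mono heat_le) auto
        then show ?thesis using 2 d by (simp add: ennreal_mult[symmetric] ennreal_leI mult.commute)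
      next
        case 3
        have "t powr (s / 2 - 1) * heat t z \<le> t powr (s / 2 - 1) * t powr (- (n / 2))"
          unfolding n_def using 3 by (intro mult_left_mono heat_le) auto
        also have "\<dots> = t powr (s / 2 - n / 2 - 1)"
          unfolding powr_add[symmetric] by (rule arg_cong[where f="\<lambda>a. t powr a"]) (simp add: field_simps)
        finally show ?thesis using 3 by (simp add: ennreal_leI)
      qed simp
    qed
    also have "\<dots> = ennreal d * ennreal (T powr (s / 2 - 1 + 1) / (s / 2 - 1 + 1))
        + ennreal (T powr (s / 2 - n / 2 - 1 + 1) / - (s / 2 - n / 2 - 1 + 1))"
      using s ns T by (subst nn_integral_add)
        (auto simp: nn_integral_cmult nn_integral_powr_from_0 nn_integral_powr_to_inf simp del: minus_add_distrib minus_diff_eq)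
    also have "\<dots> = ennreal (d * (T powr (s / 2) / (s / 2)) + T powr (s / 2 - n / 2) / ((n - s) / 2))"
    proof -
      have e: "- (s / 2 - n / 2 - 1 + 1) = (n - s) / 2" by (simp add: field_simps)
      show ?thesis unfolding e using d s ns
        by (simp add: ennreal_mult[symmetric] ennreal_plus[symmetric] del: ennreal_plus)
    qed
    also have "d * (T powr (s / 2) / (s / 2)) + T powr (s / 2 - n / 2) / ((n - s) / 2) = C * norm z powr (s - n)"
    proof -
      have e1: "norm z powr (- n) * norm z powr s = norm z powr (s - n)" by (simp add: powr_add[symmetric])
      have e2: "2 * (s / 2 - n / 2) = s - n" "2 * (s / 2) = s" by (simp_all add: field_simps)
      have e3: "d * (norm z powr s / (s / 2)) = D * (2 / s) * (norm z powr (- n) * norm z powr s)" by (simp add: d_def)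
      show ?thesis unfolding Tp e2 e3 e1 C_def by (simp add: distrib_right)
    qed
    finally show "riesz_nn s z \<le> ennreal (C * norm z powr (s - real DIM('a)))" by (simp add: n_def)
  qed
qed

text \<open>For \<open>t < 1\<close> the kernel has mass 1 and \<open>F\<close> is bounded; for
  \<open>t > 1\<close> the kernel is at most \<open>t powr (- n / 2)\<close> and \<open>F\<close> is
  integrable, with \<open>n\<close> the dimension. \<open>K\<close> is uniform in \<open>x\<close>,
  so the potential may be integrated against a second integrable function.\<close>

lemma riesz_potential_bound:
  fixes F :: "'a::euclidean_space \<Rightarrow> complex"
  assumes s: "0 < s" "s < real DIM('a)" and F: "integrable lborel F" "\<And>x. cmod (F x) \<le> B"
  obtains K where "0 \<le> K" "\<And>x. (\<integral>\<^sup>+t. \<integral>\<^sup>+y. ennreal (t powr (s / 2 - 1) * heat t (x - y) * indicator {0<..} t) * ennreal (cmod (F y)) \<partial>lborel \<partial>lborel) \<le> ennreal K"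
proof -
  have [measurable]: "F \<in> borel_measurable borel" using borel_measurable_integrable[OF F(1)] by simp
  have B: "0 \<le> B" using F(2)[of 0] norm_ge_zero order_trans by blast
  define A where "A = (\<integral>y. cmod (F y) \<partial>lborel)"
  have A: "0 \<le> A" by (simp add: A_def)
  have An: "(\<integral>\<^sup>+y. ennreal (cmod (F y)) \<partial>lborel) = ennreal A"
    unfolding A_def using F(1) by (intro nn_integral_eq_integral) auto
  define n where "n = real DIM('a)"
  have ns: "s < n" using s by (simp add: n_def)
  define K where "K = B / (s / 2) + A / ((n - s) / 2)"
  have K: "0 \<le> K" using A B s ns by (simp add: K_def)
  show thesis
  proof (rule that[OF K])
    fix x :: 'a
    define J where "J t = (\<integral>\<^sup>+y. ennreal (heat t (x - y)) * ennreal (cmod (F y)) \<partial>lborel)" for t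
    have J1: "J t \<le> ennreal B" if t: "0 < t" for t
    proof -
      have "J t \<le> (\<integral>\<^sup>+y. ennreal (heat t (x - y)) * ennreal B \<partial>lborel)"
        unfolding J_def using F(2) by (intro nn_integral_mono mult_left_mono ennreal_leI) auto
      also have "\<dots> = (\<integral>\<^sup>+y. ennreal (heat t (x - y)) \<partial>lborel) * ennreal B" by (rule nn_integral_multc) measurable
      also have "(\<integral>\<^sup>+y. ennreal (heat t (x - y)) \<partial>lborel) = 1"
        using heat_integrable_translate[OF t, of x] by (subst nn_integral_eq_integral) auto
      finally show ?thesis by simp
    qed
    have J2: "J t \<le> ennreal (t powr (- (n / 2)) * A)" if t: "0 < t" for t
    proof -
      have "J t \<le> (\<integral>\<^sup>+y. ennreal (t powr (- (n / 2))) * ennreal (cmod (F y)) \<partial>lborel)"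
        unfolding J_def n_def using heat_le(1)[OF t] by (intro nn_integral_mono mult_right_mono ennreal_leI) auto
      also have "\<dots> = ennreal (t powr (- (n / 2))) * ennreal A" by (subst nn_integral_cmult) (auto simp: An)
      finally show ?thesis using A by (simp add: ennreal_mult)
    qed
    have "(\<integral>\<^sup>+t. \<integral>\<^sup>+y. ennreal (t powr (s / 2 - 1) * heat t (x - y) * indicator {0<..} t) * ennreal (cmod (F y)) \<partial>lborel \<partial>lborel)
       = (\<integral>\<^sup>+t. \<integral>\<^sup>+y. ennreal (t powr (s / 2 - 1) * indicator {0<..} t) * (ennreal (heat t (x - y)) * ennreal (cmod (F y))) \<partial>lborel \<partial>lborel)"
      by (intro nn_integral_cong) (auto simp: indicator_def ennreal_mult mult.assoc)
    also have "\<dots> = (\<integral>\<^sup>+t. ennreal (t powr (s / 2 - 1) * indicator {0<..} t) * J t \<partial>lborel)"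
      unfolding J_def by (intro nn_integral_cong nn_integral_cmult) measurable
    also have "\<dots> \<le> (\<integral>\<^sup>+t. ennreal B * (ennreal (t powr (s / 2 - 1)) * indicator {0<..<1} t)
        + ennreal A * (ennreal (t powr (s / 2 - n / 2 - 1)) * indicator {1<..} t) \<partial>lborel)"
    proof (rule nn_integral_mono_AE, rule AE_mp[OF AE_lborel_singleton[of 1]], rule AE_I2, rule impI)
      fix t :: real assume "t \<noteq> 1"
      then consider "t \<le> 0" | "0 < t" "t < 1" | "0 < t" "1 < t" by linarith
      then show "ennreal (t powr (s / 2 - 1) * indicator {0<..} t) * J t
        \<le> ennreal B * (ennreal (t powr (s / 2 - 1)) * indicator {0<..<1} t) + ennreal A * (ennreal (t powr (s / 2 - n / 2 - 1)) * indicator {1<..} t)"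
      proof cases
        case 2
        then show ?thesis using mult_left_mono[OF J1[OF 2(1)], of "ennreal (t powr (s / 2 - 1))"] by (simp add: mult.commute)
      next
        case 3
        have "ennreal (t powr (s / 2 - 1)) * J t \<le> ennreal (t powr (s / 2 - 1)) * ennreal (t powr (- (n / 2)) * A)"
          by (intro mult_left_mono J2 3) auto
        also have "\<dots> = ennreal (A * (t powr (s / 2 - 1) * t powr (- (n / 2))))"
          using A by (simp add: ennreal_mult[symmetric] mult_ac)
        also have "t powr (s / 2 - 1) * t powr (- (n / 2)) = t powr (s / 2 - n / 2 - 1)"
          unfolding powr_add[symmetric] by (rule arg_cong[where f="\<lambda>a. t powr a"]) (simp add: field_simps)
        finally show ?thesis using 3 A by (simp add: ennreal_mult)
      qed simp
    qed
    also have "\<dots> = ennreal B * ennreal (1 powr (s / 2 - 1 + 1) / (s / 2 - 1 + 1))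
        + ennreal A * ennreal (1 powr (s / 2 - n / 2 - 1 + 1) / - (s / 2 - n / 2 - 1 + 1))"
      using s ns by (subst nn_integral_add)
        (auto simp: nn_integral_cmult nn_integral_powr_from_0 nn_integral_powr_to_inf simp del: minus_add_distrib minus_diff_eq powr_one_eq_one)
    also have "\<dots> = ennreal K"
    proof -
      have e: "- (s / 2 - n / 2 - 1 + 1) = (n - s) / 2" by (simp add: field_simps)
      show ?thesis unfolding K_def e using A B s ns
        by (simp add: ennreal_mult[symmetric] ennreal_plus[symmetric] del: ennreal_plus)
    qed
    finally show "(\<integral>\<^sup>+t. \<integral>\<^sup>+y. ennreal (t powr (s / 2 - 1) * heat t (x - y) * indicator {0<..} t) * ennreal (cmod (F y)) \<partial>lborel \<partial>lborel) \<le> ennreal K" .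
  qed
qed

section \<open>Symmetry and inversion by Riesz potentials\<close>

lemma riesz_potential_pair_integrable:
  fixes u v :: "'a::euclidean_space \<Rightarrow> complex"
  assumes s: "0 < s" "s < real DIM('a)" and u: "integrable lborel u" "\<And>x. cmod (u x) \<le> B" and v: "integrable lborel v"
  shows "integrable (lborel \<Otimes>\<^sub>M lborel) (\<lambda>(x, y). v x * (complex_of_real (riesz s (x - y)) * u y))"
proof -
  have [measurable]: "u \<in> borel_measurable borel" "v \<in> borel_measurable borel"
    using borel_measurable_integrable[OF u(1)] borel_measurable_integrable[OF v] by auto
  obtain K where K: "0 \<le> K" "\<And>x. (\<integral>\<^sup>+t. \<integral>\<^sup>+y. ennreal (t powr (s / 2 - 1) * heat t (x - y) * indicator {0<..} t) * ennreal (cmod (u y)) \<partial>lborel \<partial>lborel) \<le> ennreal K"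
    using riesz_potential_bound[OF s u] by blast
  have R: "(\<integral>\<^sup>+y. ennreal (riesz s (x - y)) * ennreal (cmod (u y)) \<partial>lborel) \<le> ennreal K" for x
  proof -
    have "(\<integral>\<^sup>+y. ennreal (riesz s (x - y)) * ennreal (cmod (u y)) \<partial>lborel)
       \<le> (\<integral>\<^sup>+y. riesz_nn s (x - y) * ennreal (cmod (u y)) \<partial>lborel)"
      by (intro nn_integral_mono mult_right_mono riesz_le_nn) auto
    also have "\<dots> = (\<integral>\<^sup>+y. \<integral>\<^sup>+t. ennreal (t powr (s / 2 - 1) * heat t (x - y) * indicator {0<..} t) * ennreal (cmod (u y)) \<partial>lborel \<partial>lborel)"
      unfolding riesz_nn_def by (intro nn_integral_cong nn_integral_multc[symmetric]) measurable
    also have "\<dots> = (\<integral>\<^sup>+t. \<integral>\<^sup>+y. ennreal (t powr (s / 2 - 1) * heat t (x - y) * indicator {0<..} t) * ennreal (cmod (u y)) \<partial>lborel \<partial>lborel)"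
      by (rule lborel_pair.Fubini') measurable
    also note K(2)
    finally show ?thesis .
  qed
  have m: "(\<lambda>(x, y). v x * (complex_of_real (riesz s (x - y)) * u y)) \<in> borel_measurable (lborel \<Otimes>\<^sub>M lborel)" by measurable
  show ?thesis
  proof (rule integrableI_bounded[OF m])
    have "(\<integral>\<^sup>+z. ennreal (norm (case z of (x, y) \<Rightarrow> v x * (complex_of_real (riesz s (x - y)) * u y))) \<partial>(lborel \<Otimes>\<^sub>M lborel))
       = (\<integral>\<^sup>+x. \<integral>\<^sup>+y. ennreal (norm (v x * (complex_of_real (riesz s (x - y)) * u y))) \<partial>lborel \<partial>lborel)"
      by (subst lborel.nn_integral_fst[symmetric]) (auto)
    also have "\<dots> = (\<integral>\<^sup>+x. \<integral>\<^sup>+y. ennreal (cmod (v x)) * (ennreal (riesz s (x - y)) * ennreal (cmod (u y))) \<partial>lborel \<partial>lborel)"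
      by (intro nn_integral_cong) (simp add: norm_mult riesz_nonneg ennreal_mult)
    also have "\<dots> = (\<integral>\<^sup>+x. ennreal (cmod (v x)) * (\<integral>\<^sup>+y. ennreal (riesz s (x - y)) * ennreal (cmod (u y)) \<partial>lborel) \<partial>lborel)"
      by (intro nn_integral_cong nn_integral_cmult) measurable
    also have "\<dots> \<le> (\<integral>\<^sup>+x. ennreal (cmod (v x)) * ennreal K \<partial>lborel)"
      by (intro nn_integral_mono mult_left_mono R) auto
    also have "\<dots> = (\<integral>\<^sup>+x. ennreal (cmod (v x)) \<partial>lborel) * ennreal K" by (rule nn_integral_multc) measurable
    also have "\<dots> < \<infinity>" using v by (auto simp: integrable_iff_bounded ennreal_mult_less_top)
    finally show "(\<integral>\<^sup>+z. ennreal (norm (case z of (x, y) \<Rightarrow> v x * (complex_of_real (riesz s (x - y)) * u y))) \<partial>(lborel \<Otimes>\<^sub>M lborel)) < \<infinity>" .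
  qed
qed

lemma riesz_potential_symmetric:
  fixes u v :: "'a::euclidean_space \<Rightarrow> complex"
  assumes s: "0 < s" "s < real DIM('a)" and u: "integrable lborel u" "\<And>x. cmod (u x) \<le> B" and v: "integrable lborel v"
  shows "(\<integral>x. v x * (\<integral>y. complex_of_real (riesz s (x - y)) * u y \<partial>lborel) \<partial>lborel)
    = (\<integral>x. u x * (\<integral>y. complex_of_real (riesz s (x - y)) * v y \<partial>lborel) \<partial>lborel)"
proof -
  have "(\<integral>x. v x * (\<integral>y. complex_of_real (riesz s (x - y)) * u y \<partial>lborel) \<partial>lborel)
     = (\<integral>x. \<integral>y. v x * (complex_of_real (riesz s (x - y)) * u y) \<partial>lborel \<partial>lborel)" by simp
  also have "\<dots> = (\<integral>y. \<integral>x. v x * (complex_of_real (riesz s (x - y)) * u y) \<partial>lborel \<partial>lborel)"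
    by (rule lborel_pair.Fubini_integral[symmetric]) (rule riesz_potential_pair_integrable[OF s u v])
  also have "\<dots> = (\<integral>y. \<integral>x. u y * (complex_of_real (riesz s (y - x)) * v x) \<partial>lborel \<partial>lborel)"
    by (simp add: mult_ac riesz_commute[of s])
  finally show ?thesis by simp
qed

text \<open>The Gamma integral represents \<open>(2 * pi * norm \<xi>) powr (- s)\<close>, which
  cancels the multiplier, and Fourier inversion returns \<open>f\<close>. Integrating in \<xi> first
  gives instead heat convolutions of the fractional Laplacian, whose superposition in
  \<open>t\<close> is its Riesz potential. Fubini is used in \<open>t\<close> and \<xi>, then in
  \<open>t\<close> and \<open>y\<close>; the second use rests on boundedness and integrability of
  the fractional Laplacian.\<close>

lemma rfrac_lap_riesz_inverse:
  fixes s :: real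
  assumes s: "0 < s" "s < 1"
  obtains c where "0 < c" "\<And>(f::'a::euclidean_space \<Rightarrow> real) x. f \<in> Cc_inf \<Longrightarrow>
    complex_of_real (c * f x) = (\<integral>y. complex_of_real (riesz s (x - y)) * rfrac_lap s f y \<partial>lborel)"
proof -
  have sn: "s < real DIM('a)"
  proof -
    have "1 \<le> real DIM('a)" using DIM_positive[where 'a='a] by linarith
    then show ?thesis using s by linarith
  qed
  obtain c where c: "0 < c" and ci: "\<And>l. 0 < l \<Longrightarrow>
    (\<integral>\<^sup>+t. ennreal (t powr (s / 2 - 1) * exp (- (l\<^sup>2 * t))) * indicator {0<..} t \<partial>lborel) = ennreal (c * l powr (- s))"
    using gamma_power_integral[of s] s by auto
  show thesis
  proof (rule that[OF c])
    fix f :: "'a \<Rightarrow> real" and x :: 'a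
    assume f: "f \<in> Cc_inf"
    have [measurable]: "rfourier f \<in> borel_measurable borel" using f by (rule rfourier_measurable)
    have [measurable]: "rfrac_lap s f \<in> borel_measurable borel" using f by (rule rfrac_lap_measurable)
    define M where "M \<xi> = complex_of_real ((2 * pi * norm \<xi>) powr s) * rfourier f \<xi>" for \<xi>
    have [measurable]: "M \<in> borel_measurable borel" unfolding M_def by measurable
    have Mint: "integrable lborel M" and fint: "integrable lborel (rfourier f)"
      using weighted_rfourier_integrable[OF f, of s] s unfolding M_def by auto
    have F: "rfrac_lap s f y = (\<integral>\<xi>. M \<xi> * cis (2 * pi * (y \<bullet> \<xi>)) \<partial>lborel)" for y
      by (simp add: frac_lap_def M_def)
    define v where "v t \<xi> = t powr (s / 2 - 1) * exp (- ((2 * pi * norm \<xi>)\<^sup>2 * t)) * indicator {0<..} t" for t :: real and \<xi> :: 'a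
    have v0: "0 \<le> v t \<xi>" for t \<xi> by (simp add: v_def)
    have [measurable]: "(\<lambda>(t, \<xi>). v t \<xi>) \<in> borel_measurable (borel \<Otimes>\<^sub>M borel)" unfolding v_def by measurable
    have [measurable]: "(\<lambda>t. v t \<xi>) \<in> borel_measurable borel" for \<xi> unfolding v_def by measurable
    have vn: "(\<integral>\<^sup>+t. ennreal (v t \<xi>) \<partial>lborel) = ennreal (c * (2 * pi * norm \<xi>) powr (- s))" if "\<xi> \<noteq> 0" for \<xi>
    proof -
      have "(\<integral>\<^sup>+t. ennreal (v t \<xi>) \<partial>lborel)
        = (\<integral>\<^sup>+t. ennreal (t powr (s / 2 - 1) * exp (- ((2 * pi * norm \<xi>)\<^sup>2 * t))) * indicator {0<..} t \<partial>lborel)"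
        unfolding v_def by (intro nn_integral_cong) (auto simp: indicator_def)
      then show ?thesis using ci[of "2 * pi * norm \<xi>"] that by simp
    qed
    have vi: "(\<integral>t. v t \<xi> \<partial>lborel) = c * (2 * pi * norm \<xi>) powr (- s)" if "\<xi> \<noteq> 0" for \<xi>
      using v0 c by (subst integral_eq_nn_integral) (auto simp: vn[OF that])
    have cancel: "(2 * pi * norm \<xi>) powr (- s) * (2 * pi * norm \<xi>) powr s = 1" if "\<xi> \<noteq> 0" for \<xi> :: 'a
      using that by (simp add: powr_add[symmetric])
    define H where "H t \<xi> = complex_of_real (v t \<xi>) * (M \<xi> * cis (2 * pi * (x \<bullet> \<xi>)))" for t \<xi>
    have Hm: "case_prod H \<in> borel_measurable (lborel \<Otimes>\<^sub>M lborel)" unfolding H_def by measurable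
    have "integrable (lborel \<Otimes>\<^sub>M lborel) (case_prod H)"
    proof (rule integrableI_bounded[OF Hm])
      have "(\<integral>\<^sup>+z. ennreal (norm (case_prod H z)) \<partial>(lborel \<Otimes>\<^sub>M lborel))
         = (\<integral>\<^sup>+\<xi>. \<integral>\<^sup>+t. ennreal (norm (case_prod H (t, \<xi>))) \<partial>lborel \<partial>lborel)"
        unfolding H_def by (intro lborel_pair.nn_integral_snd[symmetric]) measurable
      also have "\<dots> = (\<integral>\<^sup>+\<xi>. \<integral>\<^sup>+t. ennreal (v t \<xi>) * ennreal (cmod (M \<xi>)) \<partial>lborel \<partial>lborel)"
        using v0 by (intro nn_integral_cong) (simp add: H_def norm_mult ennreal_mult)
      also have "\<dots> = (\<integral>\<^sup>+\<xi>. (\<integral>\<^sup>+t. ennreal (v t \<xi>) \<partial>lborel) * ennreal (cmod (M \<xi>)) \<partial>lborel)"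
        by (intro nn_integral_cong nn_integral_multc) measurable
      also have "\<dots> = (\<integral>\<^sup>+\<xi>. ennreal c * ennreal (cmod (rfourier f \<xi>)) \<partial>lborel)"
      \<comment> \<open>The frequency 0 is discarded as a null set: since
        \<open>0 powr a = 0\<close>, the two powers do not cancel there.\<close>
      proof (rule nn_integral_cong_AE, rule AE_mp[OF AE_lborel_singleton[of 0]], rule AE_I2, rule impI)
        fix \<xi> :: 'a assume \<xi>: "\<xi> \<noteq> 0"
        have "c * (2 * pi * norm \<xi>) powr (- s) * cmod (M \<xi>) = c * cmod (rfourier f \<xi>) * ((2 * pi * norm \<xi>) powr (- s) * (2 * pi * norm \<xi>) powr s)"
          by (simp add: M_def norm_mult)
        then show "(\<integral>\<^sup>+t. ennreal (v t \<xi>) \<partial>lborel) * ennreal (cmod (M \<xi>)) = ennreal c * ennreal (cmod (rfourier f \<xi>))"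
          unfolding vn[OF \<xi>] cancel[OF \<xi>] using c by (simp add: ennreal_mult[symmetric])
      qed
      also have "\<dots> = ennreal c * (\<integral>\<^sup>+\<xi>. ennreal (cmod (rfourier f \<xi>)) \<partial>lborel)" by (rule nn_integral_cmult) measurable
      also have "\<dots> < \<infinity>" using fint by (auto simp: integrable_iff_bounded ennreal_mult_less_top)
      finally show "(\<integral>\<^sup>+z. ennreal (norm (case_prod H z)) \<partial>(lborel \<Otimes>\<^sub>M lborel)) < \<infinity>" .
    qed
    then have fub: "(\<integral>\<xi>. \<integral>t. H t \<xi> \<partial>lborel \<partial>lborel) = (\<integral>t. \<integral>\<xi>. H t \<xi> \<partial>lborel \<partial>lborel)"
      by (rule lborel_pair.Fubini_integral)
    have "(\<integral>\<xi>. \<integral>t. H t \<xi> \<partial>lborel \<partial>lborel) = (\<integral>\<xi>. complex_of_real (\<integral>t. v t \<xi> \<partial>lborel) * (M \<xi> * cis (2 * pi * (x \<bullet> \<xi>))) \<partial>lborel)"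
      unfolding H_def integral_mult_left_zero integral_complex_of_real ..
    also have "\<dots> = (\<integral>\<xi>. complex_of_real c * (rfourier f \<xi> * cis (2 * pi * (x \<bullet> \<xi>))) \<partial>lborel)"
    proof (rule integral_cong_AE)
      show "AE \<xi> in lborel. complex_of_real (\<integral>t. v t \<xi> \<partial>lborel) * (M \<xi> * cis (2 * pi * (x \<bullet> \<xi>)))
          = complex_of_real c * (rfourier f \<xi> * cis (2 * pi * (x \<bullet> \<xi>)))"
      proof (rule AE_mp[OF AE_lborel_singleton[of 0]], rule AE_I2, rule impI)
        fix \<xi> :: 'a assume \<xi>: "\<xi> \<noteq> 0"
        have "complex_of_real (\<integral>t. v t \<xi> \<partial>lborel) * (M \<xi> * cis (2 * pi * (x \<bullet> \<xi>)))
           = complex_of_real ((2 * pi * norm \<xi>) powr (- s) * (2 * pi * norm \<xi>) powr s) * (complex_of_real c * (rfourier f \<xi> * cis (2 * pi * (x \<bullet> \<xi>))))"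
          unfolding vi[OF \<xi>] M_def by simp
        then show "complex_of_real (\<integral>t. v t \<xi> \<partial>lborel) * (M \<xi> * cis (2 * pi * (x \<bullet> \<xi>)))
          = complex_of_real c * (rfourier f \<xi> * cis (2 * pi * (x \<bullet> \<xi>)))" unfolding cancel[OF \<xi>] by simp
      qed
    qed measurable
    also have "\<dots> = complex_of_real (c * f x)"
      unfolding integral_mult_right_zero rfourier_inversion[OF f] by simp
    finally have L: "complex_of_real (c * f x) = (\<integral>t. \<integral>\<xi>. H t \<xi> \<partial>lborel \<partial>lborel)" using fub by simp
    define h where "h t y = complex_of_real (t powr (s / 2 - 1) * heat t (x - y) * indicator {0<..} t) * rfrac_lap s f y" for t y
    have inner: "(\<integral>\<xi>. H t \<xi> \<partial>lborel) = (\<integral>y. h t y \<partial>lborel)" for t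
    proof (cases "0 < t")
      case True
      have "(\<integral>\<xi>. H t \<xi> \<partial>lborel) = (\<integral>\<xi>. complex_of_real (t powr (s / 2 - 1)) *
          (complex_of_real (exp (- t * (2 * pi * norm \<xi>)\<^sup>2)) * (M \<xi> * cis (2 * pi * (x \<bullet> \<xi>)))) \<partial>lborel)"
        unfolding H_def v_def using True by (intro Bochner_Integration.integral_cong) (auto simp: mult_ac)
      also have "\<dots> = complex_of_real (t powr (s / 2 - 1)) * (\<integral>y. complex_of_real (heat t (x - y)) * rfrac_lap s f y \<partial>lborel)"
        unfolding integral_mult_right_zero heat_conv_inverse_fourier[OF Mint True, symmetric] F ..
      also have "\<dots> = (\<integral>y. complex_of_real (t powr (s / 2 - 1)) * (complex_of_real (heat t (x - y)) * rfrac_lap s f y) \<partial>lborel)"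
        by (simp only: integral_mult_right_zero)
      also have "\<dots> = (\<integral>y. h t y \<partial>lborel)"
        unfolding h_def using True by (intro Bochner_Integration.integral_cong) auto
      finally show ?thesis .
    qed (simp add: H_def h_def v_def)
    obtain B where B: "\<And>y. cmod (rfrac_lap s f y) \<le> B" using rfrac_lap_bounded by blast
    obtain K where K: "\<And>x. (\<integral>\<^sup>+t. \<integral>\<^sup>+y. ennreal (t powr (s / 2 - 1) * heat t (x - y) * indicator {0<..} t) * ennreal (cmod (rfrac_lap s f y)) \<partial>lborel \<partial>lborel) \<le> ennreal K"
      using riesz_potential_bound[OF s(1) sn rfrac_lap_integrable[OF f s] B] by blast
    have hm: "case_prod h \<in> borel_measurable (lborel \<Otimes>\<^sub>M lborel)" unfolding h_def by measurable
    have "integrable (lborel \<Otimes>\<^sub>M lborel) (case_prod h)"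
    proof (rule integrableI_bounded[OF hm])
      have "(\<integral>\<^sup>+z. ennreal (norm (case_prod h z)) \<partial>(lborel \<Otimes>\<^sub>M lborel))
         = (\<integral>\<^sup>+t. \<integral>\<^sup>+y. ennreal (norm (case_prod h (t, y))) \<partial>lborel \<partial>lborel)"
        unfolding h_def by (intro lborel.nn_integral_fst[symmetric]) measurable
      also have "\<dots> = (\<integral>\<^sup>+t. \<integral>\<^sup>+y. ennreal (t powr (s / 2 - 1) * heat t (x - y) * indicator {0<..} t) * ennreal (cmod (rfrac_lap s f y)) \<partial>lborel \<partial>lborel)"
        by (intro nn_integral_cong) (simp add: h_def norm_mult ennreal_mult abs_mult)
      also note K[of x]
      finally show "(\<integral>\<^sup>+z. ennreal (norm (case_prod h z)) \<partial>(lborel \<Otimes>\<^sub>M lborel)) < \<infinity>"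
        using le_less_trans ennreal_less_top by (metis infinity_ennreal_def)
    qed
    then have "(\<integral>y. \<integral>t. h t y \<partial>lborel \<partial>lborel) = (\<integral>t. \<integral>y. h t y \<partial>lborel \<partial>lborel)"
      by (rule lborel_pair.Fubini_integral)
    moreover have "(\<integral>t. h t y \<partial>lborel) = complex_of_real (riesz s (x - y)) * rfrac_lap s f y" for y
      unfolding h_def riesz_def integral_mult_left_zero integral_complex_of_real ..
    ultimately show "complex_of_real (c * f x) = (\<integral>y. complex_of_real (riesz s (x - y)) * rfrac_lap s f y \<partial>lborel)"
      unfolding L inner by simp
  qed
qed

section \<open>The commutator estimate\<close>

text \<open>The pairing is bilinear, so the transform of \<open>g\<close> is evaluated at
  \<open>- \<xi>\<close> instead of being conjugated. The right side is then unchanged when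
  \<open>h\<close> and \<open>g\<close> are exchanged and \<xi> is reflected, which is
  self-adjointness.\<close>

lemma rfrac_lap_pairing:
  fixes h g :: "'a::euclidean_space \<Rightarrow> real"
  assumes h: "h \<in> Cc_inf" and g: "g \<in> Cc_inf" and s: "0 < s" "s < 1"
  shows "(\<integral>x. complex_of_real (g x) * rfrac_lap s h x \<partial>lborel)
    = (\<integral>\<xi>. complex_of_real ((2 * pi * norm \<xi>) powr s) * (rfourier h \<xi> * rfourier g (- \<xi>)) \<partial>lborel)"
proof -
  have [measurable]: "rfourier h \<in> borel_measurable borel" using h by (rule rfourier_measurable)
  have [measurable]: "g \<in> borel_measurable borel" using g by (rule Cc_inf_measurable)
  define M where "M \<xi> = complex_of_real ((2 * pi * norm \<xi>) powr s) * rfourier h \<xi>" for \<xi>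
  have [measurable]: "M \<in> borel_measurable borel" unfolding M_def by measurable
  have Mint: "integrable lborel M"
    using weighted_rfourier_integrable[OF h, of s] s unfolding M_def by auto
  define H where "H x \<xi> = complex_of_real (g x) * (M \<xi> * cis (2 * pi * (x \<bullet> \<xi>)))" for x \<xi>
  have "integrable (lborel \<Otimes>\<^sub>M lborel) (case_prod H)"
  proof (rule integrable_pair_product_bound[OF integrable_norm[OF Cc_inf_integrable[OF g]] integrable_norm[OF Mint]])
    show "case_prod H \<in> borel_measurable (lborel \<Otimes>\<^sub>M lborel)" unfolding H_def by measurable
  qed (simp add: H_def norm_mult)
  then have "(\<integral>\<xi>. \<integral>x. H x \<xi> \<partial>lborel \<partial>lborel) = (\<integral>x. \<integral>\<xi>. H x \<xi> \<partial>lborel \<partial>lborel)"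
    by (rule lborel_pair.Fubini_integral)
  moreover have "(\<integral>\<xi>. H x \<xi> \<partial>lborel) = complex_of_real (g x) * rfrac_lap s h x" for x
    unfolding H_def integral_mult_right_zero frac_lap_def M_def ..
  moreover have "(\<integral>x. H x \<xi> \<partial>lborel) = complex_of_real ((2 * pi * norm \<xi>) powr s) * (rfourier h \<xi> * rfourier g (- \<xi>))" for \<xi>
  proof -
    have "(\<integral>x. H x \<xi> \<partial>lborel) = (\<integral>x. M \<xi> * (complex_of_real (g x) * cis (- 2 * pi * (x \<bullet> (- \<xi>)))) \<partial>lborel)"
      unfolding H_def by (intro Bochner_Integration.integral_cong) auto
    also have "\<dots> = M \<xi> * rfourier g (- \<xi>)" unfolding integral_mult_right_zero fourier_def ..
    finally show ?thesis by (simp add: M_def)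
  qed
  ultimately show ?thesis by simp
qed

lemma rfrac_lap_selfadjoint:
  fixes h g :: "'a::euclidean_space \<Rightarrow> real"
  assumes h: "h \<in> Cc_inf" and g: "g \<in> Cc_inf" and s: "0 < s" "s < 1"
  shows "(\<integral>x. complex_of_real (g x) * rfrac_lap s h x \<partial>lborel) = (\<integral>x. complex_of_real (h x) * rfrac_lap s g x \<partial>lborel)"
proof -
  have [measurable]: "rfourier h \<in> borel_measurable borel" "rfourier g \<in> borel_measurable borel"
    using h g by (auto intro: rfourier_measurable)
  define k where "k \<xi> = complex_of_real ((2 * pi * norm \<xi>) powr s) * (rfourier h \<xi> * rfourier g (- \<xi>))" for \<xi>
  have e1: "(\<integral>\<xi>. k (0 - \<xi>) \<partial>lborel) = (\<integral>\<xi>. k \<xi> \<partial>lborel)"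
    unfolding k_def by (rule lborel_integral_reflect) measurable
  have e2: "k (0 - \<xi>) = complex_of_real ((2 * pi * norm \<xi>) powr s) * (rfourier g \<xi> * rfourier h (- \<xi>))" for \<xi>
    by (simp add: k_def mult_ac)
  show ?thesis
    unfolding rfrac_lap_pairing[OF h g s] rfrac_lap_pairing[OF g h s] e1[unfolded e2] by (simp add: k_def[abs_def])
qed

lemma integrable_bounded_mult:
  fixes u :: "'a::euclidean_space \<Rightarrow> complex" and k :: "'a \<Rightarrow> real"
  assumes u: "integrable lborel u" and k: "bounded_borel k"
  shows "integrable lborel (\<lambda>x. complex_of_real (k x) * u x)"
proof -
  have [measurable]: "u \<in> borel_measurable borel" "k \<in> borel_measurable borel"
    using borel_measurable_integrable[OF u] k by (auto simp: bounded_borel_measurable)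
  obtain K where K: "\<And>x. \<bar>k x\<bar> \<le> K" using k by (auto simp: bounded_borel_def)
  have "integrable lborel (\<lambda>x. K * cmod (u x))" using u by (intro integrable_mult_right integrable_norm)
  then show ?thesis
    by (rule Bochner_Integration.integrable_bound)
       (use K in \<open>auto simp: norm_mult intro!: AE_I2 mult_right_mono intro: order_trans[OF _ abs_ge_self]\<close>)
qed

text \<open>Self-adjointness for the test function \<open>\<phi> * f\<close> leaves the integral of
  \<open>\<phi> * f * G\<close> minus that of \<open>\<phi> * g * F\<close>. After multiplication by
  \<open>c\<close>, \<open>f\<close> and \<open>g\<close> become Riesz potentials of F and G.
  Symmetry of the kernel moves \<phi> to the inner variable in the second integral, and the factor
  \<open>\<phi> x - \<phi> y\<close> appears.\<close>

lemma frac_comm_riesz_form: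
  fixes s :: real
  assumes s: "0 < s" "s < 1"
  obtains c where "0 < c" "\<And>\<phi> f (g::'a::euclidean_space \<Rightarrow> real). \<phi> \<in> Cc_inf \<Longrightarrow> f \<in> Cc_inf \<Longrightarrow> g \<in> Cc_inf \<Longrightarrow>
    complex_of_real c * (\<integral>x. frac_comm s \<phi> f x * complex_of_real (g x) \<partial>lborel)
    = (\<integral>x. \<integral>y. rfrac_lap s g x * (complex_of_real (riesz s (x - y)) * (complex_of_real (\<phi> x - \<phi> y) * rfrac_lap s f y)) \<partial>lborel \<partial>lborel)"
proof -
  have sn: "s < real DIM('a)"
  proof -
    have "1 \<le> real DIM('a)" using DIM_positive[where 'a='a] by linarith
    then show ?thesis using s by linarith
  qed
  obtain c where c: "0 < c" and rep: "\<And>(f::'a \<Rightarrow> real) x. f \<in> Cc_inf \<Longrightarrow>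
    complex_of_real (c * f x) = (\<integral>y. complex_of_real (riesz s (x - y)) * rfrac_lap s f y \<partial>lborel)"
    using rfrac_lap_riesz_inverse[OF s, where 'a='a] by blast
  show thesis
  proof (rule that[OF c])
    fix \<phi> f g :: "'a \<Rightarrow> real"
    assume \<phi>: "\<phi> \<in> Cc_inf" and f: "f \<in> Cc_inf" and g: "g \<in> Cc_inf"
    define F where "F = rfrac_lap s f"
    define G where "G = rfrac_lap s g"
    have Fi: "integrable lborel F" and Gi: "integrable lborel G"
      unfolding F_def G_def by (intro rfrac_lap_integrable f g s)+
    obtain BF where BF: "\<And>x. cmod (F x) \<le> BF" unfolding F_def using rfrac_lap_bounded by blast
    obtain BG where BG: "\<And>x. cmod (G x) \<le> BG" unfolding G_def using rfrac_lap_bounded by blast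
    note bb = \<phi>[THEN Cc_inf_bounded_borel] f[THEN Cc_inf_bounded_borel] g[THEN Cc_inf_bounded_borel]
    obtain K where K: "\<And>x. \<bar>\<phi> x\<bar> \<le> K" using bb(1) by (auto simp: bounded_borel_def)
    have \<phi>Fi: "integrable lborel (\<lambda>x. complex_of_real (\<phi> x) * F x)"
      and \<phi>Gi: "integrable lborel (\<lambda>x. complex_of_real (\<phi> x) * G x)"
      by (intro integrable_bounded_mult Fi Gi bb)+
    have BF': "cmod (complex_of_real (\<phi> x) * F x) \<le> K * BF" for x
      unfolding norm_mult using K[of x] BF[of x] by (intro mult_mono) (auto intro: order_trans[OF abs_ge_zero])
    have i1: "integrable lborel (\<lambda>x. complex_of_real (g x) * rfrac_lap s (\<lambda>y. \<phi> y * f y) x)"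
      by (intro integrable_bounded_mult rfrac_lap_integrable Cc_inf_mult \<phi> f s bb)
    have i2: "integrable lborel (\<lambda>x. complex_of_real (g x) * (complex_of_real (\<phi> x) * F x))"
      by (intro integrable_bounded_mult \<phi>Fi bb)
    have "(\<integral>x. frac_comm s \<phi> f x * complex_of_real (g x) \<partial>lborel)
       = (\<integral>x. complex_of_real (g x) * rfrac_lap s (\<lambda>y. \<phi> y * f y) x - complex_of_real (g x) * (complex_of_real (\<phi> x) * F x) \<partial>lborel)"
      unfolding frac_comm_def F_def by (intro Bochner_Integration.integral_cong) (auto simp: algebra_simps)
    also have "\<dots> = (\<integral>x. complex_of_real (g x) * rfrac_lap s (\<lambda>y. \<phi> y * f y) x \<partial>lborel) - (\<integral>x. complex_of_real (g x) * (complex_of_real (\<phi> x) * F x) \<partial>lborel)"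
      by (rule Bochner_Integration.integral_diff[OF i1 i2])
    also have "(\<integral>x. complex_of_real (g x) * rfrac_lap s (\<lambda>y. \<phi> y * f y) x \<partial>lborel) = (\<integral>x. complex_of_real (\<phi> x * f x) * G x \<partial>lborel)"
      unfolding G_def by (rule rfrac_lap_selfadjoint[OF Cc_inf_mult[OF \<phi> f] g s])
    finally have "complex_of_real c * (\<integral>x. frac_comm s \<phi> f x * complex_of_real (g x) \<partial>lborel)
       = (\<integral>x. complex_of_real c * (complex_of_real (\<phi> x * f x) * G x) \<partial>lborel) - (\<integral>x. complex_of_real c * (complex_of_real (g x) * (complex_of_real (\<phi> x) * F x)) \<partial>lborel)"
      by (simp only: integral_mult_right_zero right_diff_distrib)
    also have "(\<integral>x. complex_of_real c * (complex_of_real (\<phi> x * f x) * G x) \<partial>lborel)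
       = (\<integral>x. (complex_of_real (\<phi> x) * G x) * (\<integral>y. complex_of_real (riesz s (x - y)) * F y \<partial>lborel) \<partial>lborel)"
      unfolding F_def rep[OF f, symmetric] by (simp add: mult_ac)
    also have "\<dots> = (\<integral>x. \<integral>y. (complex_of_real (\<phi> x) * G x) * (complex_of_real (riesz s (x - y)) * F y) \<partial>lborel \<partial>lborel)"
      by simp
    also have "(\<integral>x. complex_of_real c * (complex_of_real (g x) * (complex_of_real (\<phi> x) * F x)) \<partial>lborel)
       = (\<integral>x. (complex_of_real (\<phi> x) * F x) * (\<integral>y. complex_of_real (riesz s (x - y)) * G y \<partial>lborel) \<partial>lborel)"
      unfolding G_def rep[OF g, symmetric] by (simp add: mult_ac)
    also have "\<dots> = (\<integral>x. G x * (\<integral>y. complex_of_real (riesz s (x - y)) * (complex_of_real (\<phi> y) * F y) \<partial>lborel) \<partial>lborel)"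
      by (rule riesz_potential_symmetric[OF s(1) sn Gi BG \<phi>Fi])
    also have "\<dots> = (\<integral>x. \<integral>y. G x * (complex_of_real (riesz s (x - y)) * (complex_of_real (\<phi> y) * F y)) \<partial>lborel \<partial>lborel)"
      by simp
    also have "(\<integral>x. \<integral>y. (complex_of_real (\<phi> x) * G x) * (complex_of_real (riesz s (x - y)) * F y) \<partial>lborel \<partial>lborel) - \<dots>
      = (\<integral>x. \<integral>y. G x * (complex_of_real (riesz s (x - y)) * (complex_of_real (\<phi> x - \<phi> y) * F y)) \<partial>lborel \<partial>lborel)"
    proof -
      define P where "P = (\<lambda>(x, y). (complex_of_real (\<phi> x) * G x) * (complex_of_real (riesz s (x - y)) * F y))"
      define Q where "Q = (\<lambda>(x, y). G x * (complex_of_real (riesz s (x - y)) * (complex_of_real (\<phi> y) * F y)))"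
      \<comment> \<open>Boundedness of \<phi> makes each of the two double integrals converge
        absolutely by itself, so their difference may be formed under the integral sign.\<close>
      have P: "integrable (lborel \<Otimes>\<^sub>M lborel) P"
        unfolding P_def by (rule riesz_potential_pair_integrable[OF s(1) sn Fi BF \<phi>Gi])
      have Q: "integrable (lborel \<Otimes>\<^sub>M lborel) Q"
        unfolding Q_def by (rule riesz_potential_pair_integrable[OF s(1) sn \<phi>Fi BF' Gi])
      have "(\<integral>x. \<integral>y. P (x, y) \<partial>lborel \<partial>lborel) - (\<integral>x. \<integral>y. Q (x, y) \<partial>lborel \<partial>lborel) = (\<integral>z. P z - Q z \<partial>(lborel \<Otimes>\<^sub>M lborel))"
        unfolding lborel_pair.integral_fst'[OF P] lborel_pair.integral_fst'[OF Q]
        by (rule Bochner_Integration.integral_diff[OF P Q, symmetric])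
      also have "\<dots> = (\<integral>x. \<integral>y. P (x, y) - Q (x, y) \<partial>lborel \<partial>lborel)"
        by (rule lborel_pair.integral_fst'[OF Bochner_Integration.integrable_diff[OF P Q], symmetric])
      finally show ?thesis by (simp add: P_def Q_def algebra_simps)
    qed
    finally show "complex_of_real c * (\<integral>x. frac_comm s \<phi> f x * complex_of_real (g x) \<partial>lborel)
      = (\<integral>x. \<integral>y. rfrac_lap s g x * (complex_of_real (riesz s (x - y)) * (complex_of_real (\<phi> x - \<phi> y) * rfrac_lap s f y)) \<partial>lborel \<partial>lborel)"
      by (simp add: F_def G_def)
  qed
qed

text \<open>\<open>enn2real\<close> sends infinity to 0, so \<open>Lp_norm\<close> represents the
  integral only once that is known to be finite. Finiteness follows from integrability and
  boundedness, by \<open>cmod (h x) powr p \<le> B powr (p - 1) * cmod (h x)\<close>.\<close>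

lemma nn_integral_powr_Lp_norm:
  fixes h :: "'a::euclidean_space \<Rightarrow> complex"
  assumes h: "integrable lborel h" "\<And>x. cmod (h x) \<le> B" and p: "1 < p"
  shows "(\<integral>\<^sup>+x. ennreal (cmod (h x) powr p) \<partial>lborel) = ennreal (Lp_norm p h powr p)"
proof -
  have [measurable]: "h \<in> borel_measurable borel" using borel_measurable_integrable[OF h(1)] by simp
  have B: "0 \<le> B" using h(2)[of 0] norm_ge_zero order_trans by blast
  have "(\<integral>\<^sup>+x. ennreal (cmod (h x) powr p) \<partial>lborel) \<le> (\<integral>\<^sup>+x. ennreal (B powr (p - 1)) * ennreal (cmod (h x)) \<partial>lborel)"
  proof (rule nn_integral_mono)
    fix x
    have "cmod (h x) powr p = cmod (h x) powr (p - 1) * cmod (h x)"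
      using p powr_add[of "cmod (h x)" "p - 1" 1] by simp
    also have "\<dots> \<le> B powr (p - 1) * cmod (h x)" using p h(2) by (intro mult_right_mono powr_mono2) auto
    finally show "ennreal (cmod (h x) powr p) \<le> ennreal (B powr (p - 1)) * ennreal (cmod (h x))"
      by (simp add: ennreal_mult[symmetric] ennreal_leI)
  qed
  also have "\<dots> = ennreal (B powr (p - 1)) * (\<integral>\<^sup>+x. ennreal (cmod (h x)) \<partial>lborel)" by (rule nn_integral_cmult) measurable
  also have "\<dots> < \<infinity>" using h(1) by (auto simp: integrable_iff_bounded ennreal_mult_less_top)
  finally have "(\<integral>\<^sup>+x. ennreal (cmod (h x) powr p) \<partial>lborel) = ennreal (enn2real (\<integral>\<^sup>+x. ennreal (cmod (h x) powr p) \<partial>lborel))"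
    by (intro ennreal_enn2real[symmetric]) (simp add: less_top)
  then show ?thesis unfolding Lp_norm_def using p by (simp add: powr_powr)
qed

lemma mean_osc_le_mono: "mean_osc_le \<phi> N \<Longrightarrow> N \<le> N' \<Longrightarrow> mean_osc_le \<phi> N'"
  unfolding mean_osc_le_def by (meson order_trans)

lemma mean_osc_le_nonneg:
  assumes "mean_osc_le \<phi> N" shows "0 \<le> N"
proof -
  have "0 \<le> ball_avg (\<lambda>y. \<bar>\<phi> y - ball_avg \<phi> 0 1\<bar>) 0 1" by (intro ball_avg_nonneg) auto
  also have "\<dots> \<le> N" using assms by (simp add: mean_osc_le_def)
  finally show ?thesis .
qed

theorem theorem3p7:
  fixes s p q q' :: real
  assumes "0 < s" and "s < 1"
    and "1 < p" and "p < real DIM('a::euclidean_space) / s"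
    and "1 / q = 1 / p - s / real DIM('a)"
    and "1 / q' + 1 / q = 1"
  shows "\<exists>C. \<forall>\<phi> \<in> (Cc_inf :: ('a \<Rightarrow> real) set). \<forall>f \<in> Cc_inf. \<forall>g \<in> Cc_inf.
           cmod (\<integral>x. frac_comm s \<phi> f x * complex_of_real (g x) \<partial>lborel)
             \<le> C * bmo_seminorm \<phi>
                 * Lp_norm p (frac_lap s (\<lambda>y. complex_of_real (f y)))
                 * Lp_norm q' (frac_lap s (\<lambda>y. complex_of_real (g y)))"
proof -
  have "1 \<le> real DIM('a)" using DIM_positive[where 'a='a] by linarith
  then have sn: "s < real DIM('a)" using assms(2) by linarith
  have q'1: "1 < q'" by (rule sobolev_exponents_gt_1(2)[OF assms(1) _ assms(3-6)]) simp
  obtain C1 where C1: "0 < C1" and form: "\<And>(\<phi>::'a \<Rightarrow> real) N F G a b. continuous_on UNIV \<phi> \<Longrightarrow> bounded_borel \<phi> \<Longrightarrow>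
    0 < N \<Longrightarrow> mean_osc_le \<phi> N \<Longrightarrow> bounded_borel F \<Longrightarrow> (\<forall>y. 0 \<le> F y) \<Longrightarrow> bounded_borel G \<Longrightarrow> (\<forall>y. 0 \<le> G y) \<Longrightarrow>
    0 \<le> a \<Longrightarrow> 0 \<le> b \<Longrightarrow> (\<integral>\<^sup>+y. ennreal (F y powr p) \<partial>lborel) \<le> ennreal (a powr p) \<Longrightarrow>
    (\<integral>\<^sup>+y. ennreal (G y powr q') \<partial>lborel) \<le> ennreal (b powr q') \<Longrightarrow>
    (\<integral>\<^sup>+(u, v). ennreal (\<bar>\<phi> u - \<phi> v\<bar> * norm (u - v) powr (s - real DIM('a)) * F v * G u) \<partial>(lborel \<Otimes>\<^sub>M lborel))
      \<le> ennreal (C1 * N * a * b)"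
    using commutator_form_bound[OF assms(1) sn assms(3-6)] by blast
  obtain C2 where C2: "0 < C2" and ker: "\<And>z::'a. z \<noteq> 0 \<Longrightarrow> riesz_nn s z \<le> ennreal (C2 * norm z powr (s - real DIM('a)))"
    using riesz_nn_le[OF assms(1) sn] by blast
  obtain c where c: "0 < c" and rep: "\<And>\<phi> f (g::'a \<Rightarrow> real). \<phi> \<in> Cc_inf \<Longrightarrow> f \<in> Cc_inf \<Longrightarrow> g \<in> Cc_inf \<Longrightarrow>
    complex_of_real c * (\<integral>x. frac_comm s \<phi> f x * complex_of_real (g x) \<partial>lborel)
    = (\<integral>x. \<integral>y. rfrac_lap s g x * (complex_of_real (riesz s (x - y)) * (complex_of_real (\<phi> x - \<phi> y) * rfrac_lap s f y)) \<partial>lborel \<partial>lborel)"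
    using frac_comm_riesz_form[OF assms(1,2), where 'a='a] by blast
  \<comment> \<open>\<open>C2\<close> compares the subordinated kernel with the pure power,
    \<open>C1\<close> is the constant of the form bound, and \<open>c\<close> normalises the
    potential representation; all are fixed before \<phi>, \<open>f\<close> and
    \<open>g\<close>.\<close>
  define C where "C = C2 * C1 / c"
  show ?thesis
  proof (intro exI[of _ C] ballI)
    fix \<phi> f g :: "'a \<Rightarrow> real"
    assume \<phi>: "\<phi> \<in> Cc_inf" and f: "f \<in> Cc_inf" and g: "g \<in> Cc_inf"
    define F where "F = rfrac_lap s f"
    define G where "G = rfrac_lap s g"
    define a where "a = Lp_norm p F"
    define b where "b = Lp_norm q' G"
    have ab: "0 \<le> a" "0 \<le> b" by (auto simp: a_def b_def Lp_norm_def)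
    have [measurable]: "\<phi> \<in> borel_measurable borel" using \<phi> by (rule Cc_inf_measurable)
    have [measurable]: "F \<in> borel_measurable borel" "G \<in> borel_measurable borel"
      unfolding F_def G_def using f g by (auto intro: rfrac_lap_measurable)
    have Fi: "integrable lborel F" and Gi: "integrable lborel G"
      unfolding F_def G_def by (intro rfrac_lap_integrable f g assms)+
    obtain BF where BF: "\<And>x. cmod (F x) \<le> BF" unfolding F_def using rfrac_lap_bounded by blast
    obtain BG where BG: "\<And>x. cmod (G x) \<le> BG" unfolding G_def using rfrac_lap_bounded by blast
    have bbF: "bounded_borel (\<lambda>x. cmod (F x))" and bbG: "bounded_borel (\<lambda>x. cmod (G x))"
      using BF BG by (auto intro!: bounded_borelI)
    have bb\<phi>: "bounded_borel \<phi>" using \<phi> by (rule Cc_inf_bounded_borel)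
    define b0 where "b0 = bmo_seminorm \<phi>"
    have osc: "mean_osc_le \<phi> b0" unfolding b0_def by (rule mean_osc_le_bmo_seminorm[OF bb\<phi>])
    have b0: "0 \<le> b0" by (rule mean_osc_le_nonneg[OF osc])
    define X where "X = cmod (\<integral>x. frac_comm s \<phi> f x * complex_of_real (g x) \<partial>lborel)"
    \<comment> \<open>The seminorm may vanish while the stopping level \<open>\<Lambda> N\<close> must be positive, hence the limit at the end.\<close>
    have main: "X \<le> C * N * a * b" if N: "0 < N" "b0 \<le> N" for N
    proof -
      define Y where "Y x y = G x * (complex_of_real (riesz s (x - y)) * (complex_of_real (\<phi> x - \<phi> y) * F y))" for x y
      have pt: "ennreal (cmod (Y x y)) \<le> ennreal C2 * ennreal (\<bar>\<phi> x - \<phi> y\<bar> * norm (x - y) powr (s - real DIM('a)) * cmod (F y) * cmod (G x))" for x y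
      \<comment> \<open>The kernel bound \<open>ker\<close> excludes the origin; on the diagonal
        \<open>Y\<close> vanishes because of the factor \<open>\<phi> x - \<phi> y\<close>.\<close>
      proof (cases "x = y")
        case False
        have "ennreal (riesz s (x - y)) \<le> ennreal (C2 * norm (x - y) powr (s - real DIM('a)))"
          using False by (intro order_trans[OF riesz_le_nn ker]) simp
        then have "riesz s (x - y) \<le> C2 * norm (x - y) powr (s - real DIM('a))"
          using C2 by (subst (asm) ennreal_le_iff) auto
        then have "riesz s (x - y) * (\<bar>\<phi> x - \<phi> y\<bar> * cmod (F y) * cmod (G x))
           \<le> C2 * norm (x - y) powr (s - real DIM('a)) * (\<bar>\<phi> x - \<phi> y\<bar> * cmod (F y) * cmod (G x))"
          by (intro mult_right_mono) auto
        moreover have "cmod (Y x y) = riesz s (x - y) * (\<bar>\<phi> x - \<phi> y\<bar> * cmod (F y) * cmod (G x))"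
          unfolding Y_def norm_mult norm_of_real using riesz_nonneg[of s "x - y"] by (simp add: mult_ac)
        ultimately have "cmod (Y x y) \<le> C2 * (\<bar>\<phi> x - \<phi> y\<bar> * norm (x - y) powr (s - real DIM('a)) * cmod (F y) * cmod (G x))"
          by (simp add: mult_ac)
        then show ?thesis using C2 by (simp add: ennreal_mult[symmetric] ennreal_leI)
      qed (simp add: Y_def)
      have "ennreal (c * X) = ennreal (cmod (\<integral>x. \<integral>y. Y x y \<partial>lborel \<partial>lborel))"
        unfolding Y_def F_def G_def rep[OF \<phi> f g, symmetric] X_def using c by (simp add: norm_mult)
      also have "\<dots> \<le> (\<integral>\<^sup>+x. ennreal (cmod (\<integral>y. Y x y \<partial>lborel)) \<partial>lborel)" by (rule norm_integral_le_nn_integral)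
      also have "\<dots> \<le> (\<integral>\<^sup>+x. \<integral>\<^sup>+y. ennreal (cmod (Y x y)) \<partial>lborel \<partial>lborel)"
        by (intro nn_integral_mono norm_integral_le_nn_integral)
      also have "\<dots> \<le> (\<integral>\<^sup>+x. \<integral>\<^sup>+y. ennreal C2 * ennreal (\<bar>\<phi> x - \<phi> y\<bar> * norm (x - y) powr (s - real DIM('a)) * cmod (F y) * cmod (G x)) \<partial>lborel \<partial>lborel)"
        by (intro nn_integral_mono pt)
      also have "\<dots> = ennreal C2 * (\<integral>\<^sup>+(u, v). ennreal (\<bar>\<phi> u - \<phi> v\<bar> * norm (u - v) powr (s - real DIM('a)) * cmod (F v) * cmod (G u)) \<partial>(lborel \<Otimes>\<^sub>M lborel))"
        by (subst lborel.nn_integral_fst[symmetric]) (simp_all add: nn_integral_cmult)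
      also have "\<dots> \<le> ennreal C2 * ennreal (C1 * N * a * b)"
      proof (intro mult_left_mono form)
        show "(\<integral>\<^sup>+y. ennreal (cmod (F y) powr p) \<partial>lborel) \<le> ennreal (a powr p)"
          unfolding a_def by (simp add: nn_integral_powr_Lp_norm[OF Fi BF assms(3)])
        show "(\<integral>\<^sup>+y. ennreal (cmod (G y) powr q') \<partial>lborel) \<le> ennreal (b powr q')"
          unfolding b_def by (simp add: nn_integral_powr_Lp_norm[OF Gi BG q'1])
        show "mean_osc_le \<phi> N" by (rule mean_osc_le_mono[OF osc N(2)])
      qed (use Cc_inf_continuous[OF \<phi>] bb\<phi> bbF bbG ab N in auto)
      also have "\<dots> = ennreal (C2 * (C1 * N * a * b))" using C1 C2 N ab by (simp add: ennreal_mult)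
      finally have "c * X \<le> C2 * (C1 * N * a * b)" using C1 C2 N ab by (subst (asm) ennreal_le_iff) auto
      then show ?thesis using c by (simp add: C_def field_simps)
    qed
    have "((\<lambda>e. C * (b0 + e) * a * b) \<longlongrightarrow> C * (b0 + 0) * a * b) (at_right 0)" by (intro tendsto_intros)
    then have "X \<le> C * (b0 + 0) * a * b"
      by (rule tendsto_lowerbound) (use main b0 in \<open>auto simp: eventually_at_right_field intro!: exI[of _ 1]\<close>)
    then show "cmod (\<integral>x. frac_comm s \<phi> f x * complex_of_real (g x) \<partial>lborel)
       \<le> C * bmo_seminorm \<phi> * Lp_norm p (rfrac_lap s f) * Lp_norm q' (rfrac_lap s g)"
      by (simp add: X_def b0_def a_def b_def F_def G_def)
  qed
qed

end
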